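(* Consider the 2-block $m$-dimensional CSBM with parameters $n,p,q,\mu,\nu,\sigma$, let $\gamma=\frac{p-q}{p+q}$, and let $k=O(\log n)$ be a positive integer. Suppose $\gamma\geq c_0\,k\sqrt{\frac{\log n}{np}}$ for a sufficiently large absolute constant $c_0$ and $p\geq\frac{\log^3 n}{n}$. Then there is an absolute constant $C$ such that, after $k$ rounds of graph convolution with $\tilde A$, the data is linearly separable (i.e. there exist $w\in\mathbb{R}^m$, $b\in\mathbb{R}$ such that the entries of $\tilde A^k(Xw+b\mathbf 1)$ are positive on one class and negative on the other) with probability $1-n^{-\Omega(1)}$, provided $$\frac{\|\mu-\nu\|}{\sigma}\geq \Omega\!\left(\max\!\left(\sqrt{\frac{\log n}{n}},\ \Big(\frac{C}{\gamma\sqrt{np}}\Big)^k\sqrt{\log n}\right)\right).$$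
   Context: CSBM: $n$ is even; $V=\{1,\dots,n\}$ is partitioned into classes $S,T$ of size $n/2$. A random graph is drawn with each same-class pair an edge independently with probability $p$ and each cross-class pair an edge independently with probability $q$; $A$ is its adjacency matrix and $d=2|E|/n$ the empirical average degree. Independently, $X\in\mathbb{R}^{n\times m}$ has row $i$ equal to $\mu+g_i$ ($i\in S$) or $\nu+g_i$ ($i\in T$) with $g_i\sim\mathcal N(0,\sigma^2 I_m)$ i.i.d. The corrected convolution matrix is $\tilde A=\frac1dA-\frac1n\mathbf 1\mathbf 1^\top$ with $\mathbf 1$ the all-ones vector. Asymptotic notation is as $n\to\infty$ with absolute constants. *)

theory Defs
  imports "HOL-Probability.Probability"
begin

text \<open>Two-block CSBM. Vertices are 0..n-1 (i.e. the set {..<n}); S is one class,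
  T = {..<n} - S the other. A sample is a pair (E, g): E assigns to every unordered
  pair (i,j), i<j<n, whether it is an edge; g (i,l) is the Gaussian noise of
  coordinate l of the feature of vertex i.\<close>

definition csbm_pairs :: "nat \<Rightarrow> (nat \<times> nat) set" where
  "csbm_pairs n = {(i,j). i < j \<and> j < n}"

definition csbm_graph :: "nat \<Rightarrow> nat set \<Rightarrow> real \<Rightarrow> real \<Rightarrow> (nat \<times> nat \<Rightarrow> bool) pmf" where
  "csbm_graph n S p q =
     Pi_pmf (csbm_pairs n) False
       (\<lambda>(i,j). bernoulli_pmf (if (i \<in> S \<longleftrightarrow> j \<in> S) then p else q))"

definition csbm_noise :: "nat \<Rightarrow> nat \<Rightarrow> real \<Rightarrow> (nat \<times> nat \<Rightarrow> real) measure" where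
  "csbm_noise n m \<sigma> = PiM ({..<n} \<times> {..<m}) (\<lambda>_. density lborel (normal_density 0 \<sigma>))"

definition csbm :: "nat \<Rightarrow> nat \<Rightarrow> nat set \<Rightarrow> real \<Rightarrow> real \<Rightarrow> real
      \<Rightarrow> ((nat \<times> nat \<Rightarrow> bool) \<times> (nat \<times> nat \<Rightarrow> real)) measure" where
  "csbm n m S p q \<sigma> = measure_pmf (csbm_graph n S p q) \<Otimes>\<^sub>M csbm_noise n m \<sigma>"

definition adj :: "(nat \<times> nat \<Rightarrow> bool) \<Rightarrow> nat \<Rightarrow> nat \<Rightarrow> real" where
  "adj E i j = (if i \<noteq> j \<and> E (min i j, max i j) then 1 else 0)"

definition avg_degree :: "nat \<Rightarrow> (nat \<times> nat \<Rightarrow> bool) \<Rightarrow> real" where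
  "avg_degree n E = 2 * real (card {e \<in> csbm_pairs n. E e}) / real n"

definition conv_mat :: "nat \<Rightarrow> (nat \<times> nat \<Rightarrow> bool) \<Rightarrow> nat \<Rightarrow> nat \<Rightarrow> real" where
  "conv_mat n E i j = adj E i j / avg_degree n E - 1 / real n"

definition mat_vec :: "nat \<Rightarrow> (nat \<Rightarrow> nat \<Rightarrow> real) \<Rightarrow> (nat \<Rightarrow> real) \<Rightarrow> nat \<Rightarrow> real" where
  "mat_vec n M v = (\<lambda>i. \<Sum>j<n. M i j * v j)"

definition features :: "nat set \<Rightarrow> (nat \<Rightarrow> real) \<Rightarrow> (nat \<Rightarrow> real) \<Rightarrow> (nat \<times> nat \<Rightarrow> real)
      \<Rightarrow> nat \<Rightarrow> nat \<Rightarrow> real" where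
  "features S \<mu> \<nu> g i l = (if i \<in> S then \<mu> l else \<nu> l) + g (i, l)"

definition separable_after :: "nat \<Rightarrow> nat \<Rightarrow> nat set \<Rightarrow> (nat \<Rightarrow> real) \<Rightarrow> (nat \<Rightarrow> real) \<Rightarrow> nat
      \<Rightarrow> (nat \<times> nat \<Rightarrow> bool) \<times> (nat \<times> nat \<Rightarrow> real) \<Rightarrow> bool" where
  "separable_after n m S \<mu> \<nu> k \<omega> =
     (\<exists>(w :: nat \<Rightarrow> real) (b :: real).
        let X = features S \<mu> \<nu> (snd \<omega>);
            y = (mat_vec n (conv_mat n (fst \<omega>)) ^^ k) (\<lambda>i. (\<Sum>l<m. X i l * w l) + b)
        in ((\<forall>i\<in>S. y i > 0) \<and> (\<forall>i\<in>{..<n} - S. y i < 0))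
         \<or> ((\<forall>i\<in>S. y i < 0) \<and> (\<forall>i\<in>{..<n} - S. y i > 0)))"

definition vdist :: "nat \<Rightarrow> (nat \<Rightarrow> real) \<Rightarrow> (nat \<Rightarrow> real) \<Rightarrow> real" where
  "vdist m \<mu> \<nu> = sqrt (\<Sum>l<m. (\<mu> l - \<nu> l)\<^sup>2)"

end

theory Submission
  imports Defs "HOL-Real_Asymp.Real_Asymp"
begin

text \<open>
  Write \<open>N = A - (d/n) 1 1\<^sup>T\<close>, a positive multiple of the convolution matrix, as
  \<open>N = M + (\<Lambda>/n) s s\<^sup>T + e 1 1\<^sup>T\<close>, where \<open>s\<close> is the vector of class signs, \<open>\<Lambda> = n (p - q) / 2\<close> and
  \<open>M\<close> is the centred adjacency matrix with diagonal \<open>- p\<close>; then \<open>n\<^sup>2 e = - 1\<^sup>T M 1\<close>. Taking \<open>w\<close> along \<open>\<mu> - \<nu>\<close> reduces the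
  claim to an entrywise lower bound \<open>s i * (N\<^sup>k s) i \<ge> \<Lambda>\<^sup>k / 4\<close> and to a bound on the Euclidean norms of the rows
  of \<open>N\<^sup>k\<close>, which are the standard deviations of the convolved Gaussian noise. Expanding \<open>N\<^sup>k\<close> in
  powers of \<open>M\<close>, both follow from two properties of \<open>M\<close>.

  (1) The operator norm of \<open>M\<close> is \<open>O(sqrt (n p))\<close>. Grouping closed walks by the partition of time that they
  induce, the expected trace of \<open>M\<^sup>2\<^sup>r\<close> is at most \<open>1/p\<close> times that of \<open>Y\<^sup>2\<^sup>r\<close>, where \<open>Y\<close> is a symmetric
  matrix of size \<open>n p + r\<close> with independent entries equal to 2 with probability 1/3 and to -1 otherwise: such an entry has
  mean 0 and all its higher moments are at least 1. The norm of \<open>Y\<close> is controlled by a net argument.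

  (2) The entries of \<open>M\<^sup>j s\<close> and \<open>M\<^sup>j 1\<close> are at most \<open>(\<Lambda>/64)\<^sup>j\<close> for \<open>j \<le> k\<close>. Splitting a walk at its last visit to
  its starting point \<open>i\<close>, what remains is row \<open>i\<close> of \<open>M\<close> against a vector that does not depend on this row.
  Iterating deletes at most \<open>k\<close> vertices, and a union bound over the \<open>n\<^sup>k\<close> possible sets costs a
  factor \<open>sqrt k\<close> in the deviations, which the hypothesis on \<open>\<gamma>\<close> affords.
\<close>

section \<open>Vectors and matrices\<close>

text \<open>The norm bound (1) alone only gives entries of \<open>M^j s\<close> of size
  \<open>\<kappa>^j * sqrt n\<close>, too weak by \<open>sqrt n\<close> for a statement about every
  vertex; hence (2). In (2), independence cannot be used directly because \<open>M^(j-1) s\<close>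
  involves row \<open>i\<close> again, which deleting \<open>i\<close> repairs. The price is the
  walks that return to \<open>i\<close>; their weights are diagonal entries of powers, for which (1)
  suffices.

  In (1), entries of \<open>M\<close> have variance up to about \<open>p\<close> but size up to 1,
  so a net argument on \<open>M\<close> itself would miss the order \<open>sqrt (n p)\<close>. After
  the comparison the entries are bounded, of constant variance, and there are only about
  \<open>n p\<close> rows. The reference entries cannot be symmetric signs: an edge traversed three
  or more times, an odd number, can have positive moment in \<open>M\<close> but would have moment 0
  for signs. The factor \<open>1/p\<close> arises because a walk may visit one more vertex than it
  uses edges; it is harmless once a root of order \<open>2 r\<close>, with \<open>r\<close> about
  \<open>ln n\<close>, is taken.\<close>

abbreviation vnorm :: "nat \<Rightarrow> (nat \<Rightarrow> real) \<Rightarrow> real" where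
  "vnorm n x \<equiv> L2_set x {..<n}"

abbreviation mat_pow :: "nat \<Rightarrow> (nat \<Rightarrow> nat \<Rightarrow> real) \<Rightarrow> nat \<Rightarrow> (nat \<Rightarrow> real) \<Rightarrow> nat \<Rightarrow> real" where
  "mat_pow n M k \<equiv> mat_vec n M ^^ k"

abbreviation pmf_prob :: "'a pmf \<Rightarrow> 'a set \<Rightarrow> real" where
  "pmf_prob P A \<equiv> measure_pmf.prob P A"

abbreviation pmf_mean :: "'a pmf \<Rightarrow> ('a \<Rightarrow> real) \<Rightarrow> real" where
  "pmf_mean P f \<equiv> measure_pmf.expectation P f"

definition dotp :: "nat \<Rightarrow> (nat \<Rightarrow> real) \<Rightarrow> (nat \<Rightarrow> real) \<Rightarrow> real" where
  "dotp n x y = (\<Sum>i<n. x i * y i)"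

definition op_bounded :: "nat \<Rightarrow> (nat \<Rightarrow> nat \<Rightarrow> real) \<Rightarrow> real \<Rightarrow> bool" where
  "op_bounded n M K \<longleftrightarrow> (\<forall>x. vnorm n (mat_vec n M x) \<le> K * vnorm n x)"

definition unit_vec :: "nat \<Rightarrow> nat \<Rightarrow> real" where
  "unit_vec i = (\<lambda>j. if j = i then 1 else 0)"

definition sym_mat :: "(nat \<Rightarrow> nat \<Rightarrow> real) \<Rightarrow> bool" where
  "sym_mat M \<longleftrightarrow> (\<forall>i j. M i j = M j i)"

lemma mat_vec_lin: "mat_vec n M (\<lambda>i. x i + c * y i) = (\<lambda>i. mat_vec n M x i + c * mat_vec n M y i)"
  by (auto simp: mat_vec_def algebra_simps sum.distrib sum_distrib_left)

lemma mat_vec_scale: "mat_vec n M (\<lambda>i. c * y i) = (\<lambda>i. c * mat_vec n M y i)"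
  by (auto simp: mat_vec_def algebra_simps sum_distrib_left)

lemma mat_vec_sum: "mat_vec n M (\<lambda>i. \<Sum>t\<in>T. x t i) = (\<lambda>i. \<Sum>t\<in>T. mat_vec n M (x t) i)"
proof
  fix i
  show "mat_vec n M (\<lambda>i. \<Sum>t\<in>T. x t i) i = (\<Sum>t\<in>T. mat_vec n M (x t) i)"
    unfolding mat_vec_def sum_distrib_left by (rule sum.swap)
qed

lemma mat_pow_lin:
  "mat_pow n M k (\<lambda>i. x i + c * y i) = (\<lambda>i. mat_pow n M k x i + c * mat_pow n M k y i)"
  by (induction k) (auto simp: mat_vec_lin)

lemma mat_pow_scale: "mat_pow n M k (\<lambda>i. c * y i) = (\<lambda>i. c * mat_pow n M k y i)"
  by (induction k) (auto simp: mat_vec_scale)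

lemma scaled_mat_pow:
  "mat_pow n (\<lambda>i j. c * M i j) k x = (\<lambda>i. c ^ k * mat_pow n M k x i)"
proof (induction k)
  case (Suc k)
  have "mat_vec n (\<lambda>i j. c * M i j) y = (\<lambda>i. c * mat_vec n M y i)" for y
    by (auto simp: mat_vec_def sum_distrib_left algebra_simps)
  then show ?case using Suc by (simp add: mat_vec_scale algebra_simps)
qed simp

lemma dotp_abs_le: "\<bar>dotp n x y\<bar> \<le> vnorm n x * vnorm n y"
proof -
  have "\<bar>dotp n x y\<bar> \<le> (\<Sum>i<n. \<bar>x i\<bar> * \<bar>y i\<bar>)"
    unfolding dotp_def by (rule order_trans[OF sum_abs]) (simp add: abs_mult)
  also have "\<dots> \<le> vnorm n x * vnorm n y" by (rule L2_set_mult_ineq)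
  finally show ?thesis .
qed

lemma dotp_unit_vec: "i < n \<Longrightarrow> dotp n x (unit_vec i) = x i"
  by (simp add: dotp_def unit_vec_def if_distrib[of "\<lambda>t. _ * t"] sum.delta cong: if_cong)

lemma L2_set_unit_vec: "i < n \<Longrightarrow> vnorm n (unit_vec i) = 1"
  by (simp add: L2_set_def unit_vec_def if_distrib[of "\<lambda>t. t ^ 2"] sum.delta cong: if_cong)

lemma L2_set_sq_dotp: "(vnorm n x)\<^sup>2 = dotp n x x"
  by (simp add: L2_set_def dotp_def power2_eq_square sum_nonneg)

lemma dotp_mat_vec:
  assumes "sym_mat M" shows "dotp n (mat_vec n M x) y = dotp n x (mat_vec n M y)"
proof -
  have "dotp n (mat_vec n M x) y = (\<Sum>i<n. \<Sum>j<n. M i j * x j * y i)"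
    by (simp add: dotp_def mat_vec_def sum_distrib_right)
  also have "\<dots> = (\<Sum>j<n. \<Sum>i<n. M i j * x j * y i)" by (rule sum.swap)
  also have "\<dots> = dotp n x (mat_vec n M y)"
    using assms unfolding dotp_def mat_vec_def sum_distrib_left sym_mat_def
    by (intro sum.cong refl) (metis mult.commute mult.left_commute)
  finally show ?thesis .
qed

lemma dotp_mat_pow:
  assumes "sym_mat M" shows "dotp n (mat_pow n M k x) y = dotp n x (mat_pow n M k y)"
proof (induction k arbitrary: x y)
  case (Suc k)
  have "dotp n ((mat_vec n M ^^ Suc k) x) y = dotp n (mat_pow n M k x) (mat_vec n M y)"
    using dotp_mat_vec[OF assms] by simp
  also have "\<dots> = dotp n x (mat_pow n M k (mat_vec n M y))" by (rule Suc)
  finally show ?case by (simp add: funpow_swap1)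
qed simp

lemma op_boundedD: "op_bounded n M K \<Longrightarrow> vnorm n (mat_vec n M x) \<le> K * vnorm n x"
  by (simp add: op_bounded_def)

lemma op_bounded_pow:
  assumes "op_bounded n M K" "K \<ge> 0"
  shows "vnorm n (mat_pow n M k x) \<le> K ^ k * vnorm n x"
proof (induction k)
  case (Suc k)
  have "vnorm n ((mat_vec n M ^^ Suc k) x) \<le> K * vnorm n (mat_pow n M k x)"
    using op_boundedD[OF assms(1)] by simp
  also have "\<dots> \<le> K * (K ^ k * vnorm n x)" using Suc assms(2) by (intro mult_left_mono) auto
  finally show ?case by simp
qed simp

lemma L2_set_sum_le: "L2_set (\<lambda>i. \<Sum>t\<in>T. x t i) A \<le> (\<Sum>t\<in>T. L2_set (x t) A)"
proof (induction T rule: infinite_finite_induct)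
  case (insert t T)
  have "L2_set (\<lambda>i. \<Sum>t\<in>insert t T. x t i) A = L2_set (\<lambda>i. x t i + (\<Sum>t\<in>T. x t i)) A"
    using insert by simp
  also have "\<dots> \<le> L2_set (x t) A + L2_set (\<lambda>i. \<Sum>t\<in>T. x t i) A" by (rule L2_set_triangle_ineq)
  finally show ?case using insert by simp
qed (auto simp: L2_set_def)

lemma L2_set_scale: "L2_set (\<lambda>i. c * x i) A = \<bar>c\<bar> * L2_set x A"
  unfolding L2_set_def power_mult_distrib sum_distrib_left[symmetric] by (simp add: real_sqrt_mult)

lemma L2_member: fixes n :: nat assumes "i < n" shows "\<bar>x i\<bar> \<le> vnorm n x"
proof -
  have "\<bar>x i\<bar> \<le> vnorm n (\<lambda>j. \<bar>x j\<bar>)" using assms by (intro member_le_L2_set) auto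
  then show ?thesis by (simp add: L2_set_def)
qed

text \<open>Split at the last factor \<open>N\<close> that uses the rank-two part: \<open>t\<close>
  factors \<open>N\<close> act before it and \<open>k - 1 - t\<close> factors \<open>M\<close> after
  it.\<close>

lemma duhamel:
  assumes "\<And>u i. mat_vec n N u i = mat_vec n M u i + \<alpha> u * x i + \<beta> u * y i"
  shows "mat_pow n N k v = (\<lambda>i. mat_pow n M k v i
      + (\<Sum>t<k. \<alpha> (mat_pow n N t v) * mat_pow n M (k - 1 - t) x i
            + \<beta> (mat_pow n N t v) * mat_pow n M (k - 1 - t) y i))"
proof (induction k)
  case (Suc k)
  let ?\<alpha> = "\<lambda>t. \<alpha> (mat_pow n N t v)" and ?\<beta> = "\<lambda>t. \<beta> (mat_pow n N t v)"
  let ?P = "\<lambda>j. mat_vec n M ^^ j"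
  have eq: "mat_vec n M (?P (k - 1 - t) u) = ?P (k - t) u" if "t < k" for t u
  proof -
    have "k - t = Suc (k - 1 - t)" using that by simp
    then show ?thesis by simp
  qed
  have lin2: "mat_vec n M (\<lambda>i. c * f i + d * g i) j = c * mat_vec n M f j + d * mat_vec n M g j" for c d f g j
    by (auto simp: mat_vec_def algebra_simps sum.distrib sum_distrib_left)
  show ?case
  proof
    fix i
    have "(mat_vec n N ^^ Suc k) v i = mat_vec n M (mat_pow n N k v) i + ?\<alpha> k * x i + ?\<beta> k * y i"
      by (simp add: assms)
    also have "mat_vec n M (mat_pow n N k v) i
      = mat_vec n M (\<lambda>i. ?P k v i + 1 * (\<Sum>t<k. ?\<alpha> t * ?P (k - 1 - t) x i + ?\<beta> t * ?P (k - 1 - t) y i)) i"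
      by (subst Suc) simp
    also have "\<dots> = ?P (Suc k) v i + (\<Sum>t<k. ?\<alpha> t * ?P (k - t) x i + ?\<beta> t * ?P (k - t) y i)"
    proof -
      have "mat_vec n M (\<lambda>i. \<Sum>t<k. ?\<alpha> t * ?P (k - 1 - t) x i + ?\<beta> t * ?P (k - 1 - t) y i) i
        = (\<Sum>t<k. ?\<alpha> t * ?P (k - t) x i + ?\<beta> t * ?P (k - t) y i)"
        unfolding mat_vec_sum lin2 by (intro sum.cong refl) (simp only: lessThan_iff eq)
      then show ?thesis by (subst mat_vec_lin) simp
    qed
    finally show "(mat_vec n N ^^ Suc k) v i = ?P (Suc k) v i +
       (\<Sum>t<Suc k. ?\<alpha> t * ?P (Suc k - 1 - t) x i + ?\<beta> t * ?P (Suc k - 1 - t) y i)"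
      by simp
  qed
qed simp

text \<open>Meant for \<open>B'\<close> equal to \<open>B\<close> without row and column
  \<open>i\<close>. An iterate started away from \<open>i\<close> follows \<open>B'\<close> until it
  first enters \<open>i\<close>, with weight \<open>\<rho>\<close>, and then follows
  \<open>B\<close> from \<open>unit_vec i\<close>. Read along a walk that starts at
  \<open>i\<close>, this first entrance is the last visit to \<open>i\<close>.\<close>

lemma first_exit:
  assumes "\<And>u j. u i = 0 \<Longrightarrow> mat_vec n B u j = mat_vec n B' u j + \<rho> u * unit_vec i j"
    and "\<And>u. mat_vec n B' u i = 0" and "v i = 0"
  shows "mat_pow n B k v = (\<lambda>j. mat_pow n B' k v j
      + (\<Sum>t<k. \<rho> (mat_pow n B' (k - 1 - t) v) * mat_pow n B t (unit_vec i) j))"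
proof (induction k)
  case (Suc k)
  let ?r = "\<lambda>t. \<rho> (mat_pow n B' t v)" and ?P = "\<lambda>j. mat_vec n B ^^ j"
  have z: "mat_pow n B' k v i = 0" using assms(2,3) by (cases k) auto
  show ?case
  proof
    fix j
    have "?P (Suc k) v j
      = mat_vec n B (\<lambda>j. mat_pow n B' k v j + 1 * (\<Sum>t<k. ?r (k - 1 - t) * ?P t (unit_vec i) j)) j"
      unfolding funpow.simps comp_apply by (subst Suc) simp
    also have "\<dots> = mat_vec n B (mat_pow n B' k v) j + (\<Sum>t<k. ?r (k - 1 - t) * ?P (Suc t) (unit_vec i) j)"
      unfolding mat_vec_lin mat_vec_sum mat_vec_scale by simp
    also have "\<dots> = (mat_vec n B' ^^ Suc k) v j + ?r k * unit_vec i j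
        + (\<Sum>t<k. ?r (k - 1 - t) * ?P (Suc t) (unit_vec i) j)"
      unfolding assms(1)[of "mat_pow n B' k v", OF z] by simp
    also have "\<dots> = (mat_vec n B' ^^ Suc k) v j + (\<Sum>t<Suc k. ?r (Suc k - 1 - t) * ?P t (unit_vec i) j)"
      by (subst sum.lessThan_Suc_shift) simp
    finally show "?P (Suc k) v j = (mat_vec n B' ^^ Suc k) v j +
       (\<Sum>t<Suc k. ?r (Suc k - 1 - t) * ?P t (unit_vec i) j)" .
  qed
qed simp

section \<open>Entries and row norms of powers of signal plus noise, deterministically\<close>

locale signal_noise =
  fixes n k :: nat and M N :: "nat \<Rightarrow> nat \<Rightarrow> real" and s :: "nat \<Rightarrow> real" and e \<kappa> \<Lambda> :: real
  assumes n: "n > 0" and symM: "sym_mat M" and opM: "op_bounded n M \<kappa>"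
    and s: "\<And>i. \<bar>s i\<bar> = 1" and s_bal: "(\<Sum>i<n. s i) = 0"
    and N: "\<And>i j. N i j = M i j + \<Lambda> / n * s i * s j + e"
    and e: "n * \<bar>e\<bar> \<le> \<kappa>" and \<kappa>: "\<kappa> \<ge> 0" and \<Lambda>: "\<Lambda> > 0" and \<kappa>\<Lambda>: "32 * real k * \<kappa> \<le> \<Lambda>" and k: "k \<ge> 1"
    and M_s: "\<And>i j. i < n \<Longrightarrow> j \<le> k \<Longrightarrow> \<bar>mat_pow n M j s i\<bar> \<le> (\<Lambda> / 64) ^ j"
    and M_1: "\<And>i j. i < n \<Longrightarrow> j \<le> k \<Longrightarrow> \<bar>mat_pow n M j (\<lambda>_. 1) i\<bar> \<le> (\<Lambda> / 64) ^ j"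
begin

lemma symN: "sym_mat N"
  using symM by (auto simp: sym_mat_def N)

lemma L2_s: "vnorm n s = sqrt n"
proof -
  have "(s i)\<^sup>2 = 1" for i using s[of i] by (metis power2_abs one_power2)
  then show ?thesis by (simp add: L2_set_def)
qed

lemma L2_1: "vnorm n (\<lambda>_. 1) = sqrt n"
  by (simp add: L2_set_def)

lemma N_vec: "mat_vec n N u i = mat_vec n M u i + (\<Lambda> / n * dotp n s u) * s i + (e * dotp n (\<lambda>_. 1) u) * 1"
  by (simp add: mat_vec_def N dotp_def algebra_simps sum.distrib sum_distrib_left)

text \<open>The signal has norm \<open>\<Lambda>\<close> because \<open>s\<close> has squared norm
  \<open>n\<close>; the noise and the constant matrix \<open>e\<close> contribute at most
  \<open>\<kappa>\<close> each.\<close>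

lemma op_N: "op_bounded n N (\<Lambda> + 2 * \<kappa>)"
  unfolding op_bounded_def
proof
  fix x
  let ?L = "\<lambda>x. vnorm n x"
  have "?L (mat_vec n N x) \<le> ?L (\<lambda>i. mat_vec n M x i + (\<Lambda> / n * dotp n s x) * s i) + ?L (\<lambda>i. (e * dotp n (\<lambda>_. 1) x) * 1)"
    unfolding N_vec by (rule L2_set_triangle_ineq)
  also have "?L (\<lambda>i. mat_vec n M x i + (\<Lambda> / n * dotp n s x) * s i) \<le> ?L (mat_vec n M x) + ?L (\<lambda>i. (\<Lambda> / n * dotp n s x) * s i)"
    by (rule L2_set_triangle_ineq)
  finally have "?L (mat_vec n N x) \<le> ?L (mat_vec n M x) + \<bar>\<Lambda> / n * dotp n s x\<bar> * sqrt n + \<bar>e * dotp n (\<lambda>_. 1) x\<bar> * sqrt n"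
    unfolding L2_set_scale L2_s L2_1 by simp
  also have "\<bar>\<Lambda> / n * dotp n s x\<bar> * sqrt n \<le> \<Lambda> * ?L x"
  proof -
    have "\<bar>\<Lambda> / n * dotp n s x\<bar> * sqrt n \<le> (\<Lambda> / n * (sqrt n * ?L x)) * sqrt n"
      using dotp_abs_le[of n s x] \<Lambda> unfolding L2_s
      by (intro mult_right_mono) (auto simp: abs_mult intro!: divide_right_mono mult_left_mono)
    also have "\<dots> = \<Lambda> * ?L x" using n by (simp add: field_simps)
    finally show ?thesis .
  qed
  also have "\<bar>e * dotp n (\<lambda>_. 1) x\<bar> * sqrt n \<le> \<kappa> * ?L x"
  proof -
    have "\<bar>e * dotp n (\<lambda>_. 1) x\<bar> * sqrt n \<le> (\<bar>e\<bar> * (sqrt n * ?L x)) * sqrt n"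
      using dotp_abs_le[of n "\<lambda>_. 1" x] unfolding L2_1
      by (intro mult_right_mono) (auto simp: abs_mult intro!: mult_left_mono)
    also have "\<dots> = (n * \<bar>e\<bar>) * ?L x" using n by (simp add: field_simps)
    also have "\<dots> \<le> \<kappa> * ?L x" by (intro mult_right_mono e) simp
    finally show ?thesis .
  qed
  also have "?L (mat_vec n M x) \<le> \<kappa> * ?L x" by (rule op_boundedD[OF opM])
  finally show "?L (mat_vec n N x) \<le> (\<Lambda> + 2 * \<kappa>) * ?L x" by (simp add: algebra_simps)
qed

text \<open>The condition \<open>32 * k * \<kappa> \<le> \<Lambda>\<close> keeps the loss over
  \<open>k\<close> rounds bounded: the ratio is at most
  \<open>(1 + 1/(16 k))^k \<le> exp (1/16)\<close>.\<close>

lemma growth: assumes "t \<le> k" shows "(\<Lambda> + 2 * \<kappa>) ^ t \<le> 2 * \<Lambda> ^ t"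
proof -
  have k0: "real k > 0" using k by simp
  have "2 * \<kappa> \<le> \<Lambda> / (16 * k)" using \<kappa>\<Lambda> k0 by (simp add: field_simps)
  then have "(\<Lambda> + 2 * \<kappa>) ^ t \<le> (\<Lambda> * (1 + 1 / (16 * k))) ^ t"
    using \<Lambda> \<kappa> by (intro power_mono) (auto simp: field_simps)
  also have "\<dots> = \<Lambda> ^ t * (1 + 1 / (16 * k)) ^ t" by (rule power_mult_distrib)
  also have "(1 + 1 / (16 * k)) ^ t \<le> (1 + 1 / (16 * k)) ^ k"
    using assms k0 by (intro power_increasing) auto
  also have "\<dots> \<le> exp (1 / (16 * k)) ^ k"
    using k0 by (intro power_mono) (auto intro: exp_ge_add_one_self)
  also have "\<dots> = exp (1 / 16)" using k0 by (simp flip: exp_of_nat_mult)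
  also have "\<dots> \<le> 2"
  proof -
    have "exp (1/16::real) \<le> 1 + 1/16 + (1/16)\<^sup>2" by (rule exp_bound) auto
    then show ?thesis by (simp add: power2_eq_square)
  qed
  finally show ?thesis using \<Lambda> by (simp add: mult.commute)
qed

lemma \<kappa>_le: "32 * \<kappa> \<le> \<Lambda>"
proof -
  have "1 * (32 * \<kappa>) \<le> real k * (32 * \<kappa>)" using k \<kappa> by (intro mult_right_mono) auto
  then show ?thesis using \<kappa>\<Lambda> by simp
qed

lemma dot_N_pow:
  assumes "vnorm n v = sqrt n" "vnorm n u = sqrt n" "t \<le> k"
  shows "\<bar>dotp n u (mat_pow n N t v)\<bar> \<le> n * (2 * \<Lambda> ^ t)"
proof -
  have "\<bar>dotp n u (mat_pow n N t v)\<bar> \<le> vnorm n u * vnorm n (mat_pow n N t v)"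
    by (rule dotp_abs_le)
  also have "\<dots> \<le> sqrt n * ((2 * \<Lambda> ^ t) * sqrt n)"
    unfolding assms(2)
  proof (rule mult_left_mono)
    have "vnorm n (mat_pow n N t v) \<le> (\<Lambda> + 2 * \<kappa>) ^ t * sqrt n"
      using op_bounded_pow[OF op_N, of t v] \<Lambda> \<kappa> assms(1) by simp
    also have "\<dots> \<le> (2 * \<Lambda> ^ t) * sqrt n" using growth[OF assms(3)] by (intro mult_right_mono) auto
    finally show "vnorm n (mat_pow n N t v) \<le> (2 * \<Lambda> ^ t) * sqrt n" .
  qed simp
  also have "\<dots> = (sqrt n * sqrt n) * (2 * \<Lambda> ^ t)" by (simp only: mult_ac)
  finally show ?thesis by simp
qed

lemma coeff_s:
  assumes "vnorm n v = sqrt n" "t \<le> k"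
  shows "\<bar>\<Lambda> / n * dotp n s (mat_pow n N t v)\<bar> \<le> 2 * \<Lambda> ^ Suc t"
proof -
  have "\<bar>\<Lambda> / n * dotp n s (mat_pow n N t v)\<bar> \<le> \<Lambda> / n * (n * (2 * \<Lambda> ^ t))"
    unfolding abs_mult using dot_N_pow[OF assms(1) L2_s assms(2)] \<Lambda> by (intro mult_mono) auto
  then show ?thesis using n by (simp add: field_simps)
qed

text \<open>Because \<open>n * \<bar>e\<bar> \<le> \<kappa>\<close>, a factor
  \<open>\<kappa>\<close> stands where \<open>coeff_s\<close> has \<open>\<Lambda>\<close>: the
  all-ones direction is small against the signal.\<close>

lemma coeff_1:
  assumes "vnorm n v = sqrt n" "t \<le> k"
  shows "\<bar>e * dotp n (\<lambda>_. 1) (mat_pow n N t v)\<bar> \<le> 2 * \<kappa> * \<Lambda> ^ t"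
proof -
  have "\<bar>e * dotp n (\<lambda>_. 1) (mat_pow n N t v)\<bar> \<le> \<bar>e\<bar> * (n * (2 * \<Lambda> ^ t))"
    unfolding abs_mult using dot_N_pow[OF assms(1) L2_1 assms(2)] by (intro mult_mono) auto
  also have "\<dots> = (n * \<bar>e\<bar>) * (2 * \<Lambda> ^ t)" by simp
  also have "\<dots> \<le> \<kappa> * (2 * \<Lambda> ^ t)" using e \<Lambda> by (intro mult_right_mono) auto
  finally show ?thesis by simp
qed

lemma geom64: "(\<Sum>j<m. (1/64::real) ^ j) \<le> 64/63"
proof -
  have "(\<Sum>j<m. (1/64::real) ^ j) = (1 - (1/64) ^ m) / (1 - 1/64)"
    by (subst sum_gp_strict) auto
  also have "\<dots> \<le> 64/63" by simp
  finally show ?thesis .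
qed

text \<open>The constant 3 is 2 from the direction \<open>s\<close> plus 1 from the all-ones
  direction, as \<open>2 * \<kappa> \<le> \<Lambda>\<close>. The decay in \<open>j - 1 - t\<close>
  turns the expansion into a geometric series dominated by \<open>t = j - 1\<close>.\<close>

lemma remainder_term:
  assumes "vnorm n v = sqrt n" "t < j" "j \<le> k" "i < n"
  shows "\<bar>(\<Lambda> / n * dotp n s (mat_pow n N t v)) * mat_pow n M (j - 1 - t) s i
     + (e * dotp n (\<lambda>_. 1) (mat_pow n N t v)) * mat_pow n M (j - 1 - t) (\<lambda>_. 1) i\<bar>
     \<le> 3 * \<Lambda> ^ j * (1/64) ^ (j - 1 - t)"
proof -
  let ?x = "\<Lambda> / n * dotp n s (mat_pow n N t v)"
  let ?y = "e * dotp n (\<lambda>_. 1) (mat_pow n N t v)"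
  let ?ms = "mat_pow n M (j - 1 - t) s i"
  let ?m1 = "mat_pow n M (j - 1 - t) (\<lambda>_. 1) i"
  let ?b = "(\<Lambda> / 64) ^ (j - 1 - t)"
  have "\<bar>?x * ?ms + ?y * ?m1\<bar> \<le> \<bar>?x * ?ms\<bar> + \<bar>?y * ?m1\<bar>"
    by (rule abs_triangle_ineq)
  also have "\<bar>?x * ?ms\<bar> \<le> (2 * \<Lambda> ^ Suc t) * ?b"
    using coeff_s[OF assms(1), of t] M_s[OF assms(4), of "j - 1 - t"] assms(2,3) \<Lambda>
    unfolding abs_mult[of ?x] by (intro mult_mono) auto
  also have "\<bar>?y * ?m1\<bar> \<le> (2 * \<kappa> * \<Lambda> ^ t) * ?b"
    using coeff_1[OF assms(1), of t] M_1[OF assms(4), of "j - 1 - t"] assms(2,3) \<Lambda> \<kappa>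
    unfolding abs_mult[of ?y] by (intro mult_mono) auto
  also have "(2 * \<kappa> * \<Lambda> ^ t) * ?b \<le> (\<Lambda> * \<Lambda> ^ t) * ?b"
    using \<kappa>_le \<kappa> \<Lambda> by (intro mult_right_mono) auto
  also have "2 * \<Lambda> ^ Suc t * ?b + \<Lambda> * \<Lambda> ^ t * ?b = 3 * (\<Lambda> ^ Suc t * \<Lambda> ^ (j - 1 - t)) * (1/64) ^ (j - 1 - t)"
    using power_mult_distrib[of \<Lambda> "1/64" "j - 1 - t"] by simp
  also have "\<dots> = 3 * \<Lambda> ^ j * (1/64) ^ (j - 1 - t)"
  proof -
    have "Suc t + (j - 1 - t) = j" using assms(2) by simp
    then show ?thesis by (metis power_add)
  qed
  finally show ?thesis by simp
qed

lemma geom64_rev: "(\<Sum>t<j. 3 * \<Lambda> ^ m * (1/64) ^ (j - 1 - t)) \<le> 3 * \<Lambda> ^ m * (64/63)"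
proof -
  have "(\<Sum>t<j. (1/64::real) ^ (j - 1 - t)) = (\<Sum>t<j. (1/64) ^ t)"
    using sum.nat_diff_reindex[of "\<lambda>t. (1/64::real) ^ t" j] by simp
  then have "(\<Sum>t<j. 3 * \<Lambda> ^ m * (1/64) ^ (j - 1 - t)) = 3 * \<Lambda> ^ m * (\<Sum>t<j. (1/64) ^ t)"
    by (simp add: sum_distrib_left[symmetric])
  also have "\<dots> \<le> 3 * \<Lambda> ^ m * (64/63)" using geom64[of j] \<Lambda> by (intro mult_left_mono) auto
  finally show ?thesis .
qed

lemma entry_upper:
  assumes v: "vnorm n v = sqrt n" and j: "j \<le> k" and i: "i < n"
    and Mv: "\<bar>mat_pow n M j v i\<bar> \<le> (\<Lambda> / 64) ^ j"
  shows "\<bar>mat_pow n N j v i\<bar> \<le> 6 * \<Lambda> ^ j"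
proof -
  have "\<bar>mat_pow n N j v i\<bar> \<le> (\<Lambda> / 64) ^ j + (\<Sum>t<j. 3 * \<Lambda> ^ j * (1/64) ^ (j - 1 - t))"
    unfolding duhamel[OF N_vec, where k=j]
    by (rule order_trans[OF abs_triangle_ineq add_mono[OF Mv order_trans[OF sum_abs sum_mono]]])
       (use remainder_term[OF v _ j i] in auto)
  also have "\<dots> \<le> (\<Lambda> / 64) ^ j + 3 * \<Lambda> ^ j * (64/63)" using geom64_rev by simp
  also have "(\<Lambda> / 64) ^ j \<le> \<Lambda> ^ j" using \<Lambda> by (intro power_mono) auto
  finally show ?thesis using \<Lambda> by simp
qed

text \<open>Since \<open>s\<close> is orthogonal to the all-ones vector,
  \<open>N s = M s + \<Lambda> s\<close>. Moving one factor \<open>N\<close> onto \<open>s\<close>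
  multiplies the form by \<open>\<Lambda>\<close> up to an error
  \<open>2 * \<kappa> * n * \<Lambda>^t\<close>, a loss of at most \<open>1/(16 k)\<close> of
  \<open>n * \<Lambda>^(t+1)\<close> per round.\<close>

lemma quadratic_lower:
  assumes "t \<le> k" shows "dotp n s (mat_pow n N t s) \<ge> n * \<Lambda> ^ t * (1 - t / (16 * k))"
  using assms
proof (induction t)
  case 0
  have "s i * s i = 1" for i using s[of i] by (metis abs_mult_self_eq mult_1)
  then show ?case by (simp add: dotp_def)
next
  case (Suc t)
  let ?y = "mat_pow n N t s"
  have d1: "dotp n (\<lambda>_. 1) s = 0" using s_bal by (simp add: dotp_def)
  have ss: "dotp n s s = n" using L2_set_sq_dotp[of s n] by (simp add: L2_s)
  have Ns: "mat_vec n N s = (\<lambda>i. mat_vec n M s i + \<Lambda> * s i)"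
    using n by (auto simp: N_vec d1 ss)
  have "dotp n s ((mat_vec n N ^^ Suc t) s) = dotp n (mat_vec n N s) ?y"
    using dotp_mat_vec[OF symN, of n s ?y] by simp
  also have "\<dots> = dotp n (mat_vec n M s) ?y + \<Lambda> * dotp n s ?y"
    unfolding Ns by (simp add: dotp_def algebra_simps sum.distrib sum_distrib_left)
  finally have eq: "dotp n s ((mat_vec n N ^^ Suc t) s) = dotp n (mat_vec n M s) ?y + \<Lambda> * dotp n s ?y" .
  have "\<bar>dotp n (mat_vec n M s) ?y\<bar> \<le> vnorm n (mat_vec n M s) * vnorm n ?y"
    by (rule dotp_abs_le)
  also have "\<dots> \<le> (\<kappa> * sqrt n) * ((2 * \<Lambda> ^ t) * sqrt n)"
  proof (rule mult_mono)
    show "vnorm n (mat_vec n M s) \<le> \<kappa> * sqrt n" using op_boundedD[OF opM, of s] by (simp add: L2_s)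
    have "vnorm n ?y \<le> (\<Lambda> + 2 * \<kappa>) ^ t * sqrt n"
      using op_bounded_pow[OF op_N, of t s] \<Lambda> \<kappa> by (simp add: L2_s)
    also have "\<dots> \<le> (2 * \<Lambda> ^ t) * sqrt n" using growth[of t] Suc.prems by (intro mult_right_mono) auto
    finally show "vnorm n ?y \<le> (2 * \<Lambda> ^ t) * sqrt n" .
  qed (use \<kappa> in auto)
  also have "\<dots> = n * \<Lambda> ^ t * (2 * \<kappa>)" by (simp add: algebra_simps)
  also have "\<dots> \<le> n * \<Lambda> ^ t * (\<Lambda> / (16 * k))"
    using \<kappa>\<Lambda> k \<Lambda> by (intro mult_left_mono) (auto simp: field_simps)
  finally have 1: "dotp n (mat_vec n M s) ?y \<ge> - (n * \<Lambda> ^ t * (\<Lambda> / (16 * k)))" by linarith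
  have 2: "\<Lambda> * dotp n s ?y \<ge> \<Lambda> * (n * \<Lambda> ^ t * (1 - t / (16 * k)))"
    using Suc \<Lambda> by (intro mult_left_mono) auto
  have "n * \<Lambda> ^ Suc t * (1 - Suc t / (16 * k)) = \<Lambda> * (n * \<Lambda> ^ t * (1 - t / (16 * k))) - n * \<Lambda> ^ t * (\<Lambda> / (16 * k))"
    using k by (simp add: field_simps)
  then show ?case using 1 2 unfolding eq by linarith
qed

text \<open>The term \<open>t = k - 1\<close> of the expansion carries no factor \<open>M\<close>:
  its signal part is \<open>s i\<close> times a quadratic form of size at least
  \<open>15/16 * \<Lambda>^k\<close>. Everything else adds up to at most
  \<open>1/64 + 1/20 + 1/16\<close> of \<open>\<Lambda>^k\<close>.\<close>

lemma entry_lower: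
  assumes i: "i < n" shows "s i * mat_pow n N k s i \<ge> \<Lambda> ^ k / 4"
proof -
  obtain k' where k': "k = Suc k'" using k by (cases k) auto
  let ?x = "\<Lambda> / n * dotp n s (mat_pow n N k' s)" and ?y = "e * dotp n (\<lambda>_. 1) (mat_pow n N k' s)" and ?ms = "mat_pow n M k s i"
  let ?f = "\<lambda>t. (\<Lambda> / n * dotp n s (mat_pow n N t s)) * mat_pow n M (k - 1 - t) s i
     + (e * dotp n (\<lambda>_. 1) (mat_pow n N t s)) * mat_pow n M (k - 1 - t) (\<lambda>_. 1) i"
  have sq: "s i * s i = 1" using s[of i] by (metis abs_mult_self_eq mult_1)
  have eq: "mat_pow n N k s i = ?ms + (\<Sum>t<k'. ?f t)
      + ?x * s i + ?y"
    unfolding duhamel[OF N_vec, where k=k] by (simp add: k')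
  have a1: "\<bar>?ms\<bar> \<le> \<Lambda> ^ k / 64"
  proof -
    have "\<bar>?ms\<bar> \<le> (\<Lambda> / 64) ^ k" using M_s[OF i] by simp
    also have "\<dots> = \<Lambda> ^ k * (1/64) ^ k" by (simp add: power_divide)
    also have "\<dots> \<le> \<Lambda> ^ k * (1/64) ^ 1" using k \<Lambda> by (intro mult_left_mono power_decreasing) auto
    finally show ?thesis by simp
  qed
  have a2: "\<bar>\<Sum>t<k'. ?f t\<bar> \<le> \<Lambda> ^ k / 20"
  proof -
    have "\<bar>\<Sum>t<k'. ?f t\<bar> \<le> (\<Sum>t<k'. 3 * \<Lambda> ^ k * (1/64) ^ (k - 1 - t))"
      by (rule order_trans[OF sum_abs sum_mono]) (use remainder_term[OF L2_s _ order_refl i] k' in auto)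
    \<comment> \<open>With the term \<open>t = k - 1\<close> removed, every remaining term has at
      least one factor 1/64.\<close>
    also have "\<dots> = (\<Sum>t<k'. 3 * \<Lambda> ^ k * (1/64) ^ (k' - 1 - t)) / 64"
    proof -
      have "k - 1 - t = Suc (k' - 1 - t)" if "t < k'" for t using that k' by simp
      then show ?thesis unfolding sum_divide_distrib by (intro sum.cong refl) (simp only: lessThan_iff, simp)
    qed
    also have "\<dots> \<le> (3 * \<Lambda> ^ k * (64/63)) / 64" using geom64_rev by (intro divide_right_mono) auto
    also have "\<dots> \<le> \<Lambda> ^ k / 20" using \<Lambda> by simp
    finally show ?thesis .
  qed
  have a3: "\<bar>?y\<bar> \<le> \<Lambda> ^ k / 16"
  proof -
    have "\<bar>?y\<bar> \<le> 2 * \<kappa> * \<Lambda> ^ k'"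
      using coeff_1[OF L2_s] k' by simp
    also have "\<dots> \<le> (\<Lambda> / 16) * \<Lambda> ^ k'" using \<kappa>_le \<Lambda> by (intro mult_right_mono) auto
    finally show ?thesis by (simp add: k')
  qed
  have a4: "?x \<ge> \<Lambda> ^ k * (15/16)"
  proof -
    have "n * \<Lambda> ^ k' * (15/16) \<le> n * \<Lambda> ^ k' * (1 - k' / (16 * k))"
      using k' \<Lambda> by (intro mult_left_mono) (auto simp: field_simps)
    also have "\<dots> \<le> dotp n s (mat_pow n N k' s)" using quadratic_lower[of k'] k' by simp
    finally have "\<Lambda> / n * (n * \<Lambda> ^ k' * (15/16)) \<le> ?x"
      using \<Lambda> by (intro mult_left_mono) auto
    then show ?thesis using n by (simp add: k')
  qed
  have b: "- c \<le> s i * x" if "\<bar>x\<bar> \<le> c" for x c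
  proof -
    have "\<bar>s i * x\<bar> \<le> c" using that by (simp add: abs_mult s)
    then show ?thesis by simp
  qed
  have "s i * mat_pow n N k s i = s i * ?ms + s i * (\<Sum>t<k'. ?f t)
     + (s i * s i) * ?x + s i * ?y"
    unfolding eq by (simp only: distrib_left) (simp add: algebra_simps)
  also have "\<dots> \<ge> \<Lambda> ^ k / 4"
  proof -
    have "\<Lambda> ^ k / 4 \<le> - (\<Lambda> ^ k / 64) + - (\<Lambda> ^ k / 20) + 1 * (\<Lambda> ^ k * (15/16)) + - (\<Lambda> ^ k / 16)"
      using \<Lambda> by simp
    also have "\<dots> \<le> s i * ?ms + s i * (\<Sum>t<k'. ?f t)
     + (s i * s i) * ?x + s i * ?y"
      unfolding sq by (intro add_mono b a1 a2 a3 mult_left_mono a4 zero_le_one)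
    finally show ?thesis .
  qed
  finally show ?thesis .
qed

text \<open>By symmetry the coefficient of \<open>s\<close> is governed by the single entry
  \<open>(N^t s) i\<close>, bounded through \<open>entry_upper\<close>, and likewise for the
  all-ones vector. Cauchy-Schwarz would lose a factor \<open>sqrt n\<close> here, and with it the
  averaging effect \<open>\<Lambda>^k / sqrt n\<close>.\<close>

lemma row_norm:
  assumes i: "i < n" shows "vnorm n (mat_pow n N k (unit_vec i)) \<le> \<kappa> ^ k + 24 * \<Lambda> ^ k / sqrt n"
proof -
  let ?L = "\<lambda>x. vnorm n x"
  let ?a = "\<lambda>t. \<Lambda> / n * dotp n s (mat_pow n N t (unit_vec i))"
  let ?b = "\<lambda>t. e * dotp n (\<lambda>_. 1) (mat_pow n N t (unit_vec i))"
  let ?P = "\<lambda>j. mat_vec n M ^^ j"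
  have fs: "\<bar>?a t\<bar> \<le> 6 * \<Lambda> ^ Suc t / n" if "t < k" for t
  proof -
    have "dotp n s (mat_pow n N t (unit_vec i)) = mat_pow n N t s i"
      using dotp_mat_pow[OF symN, of n t s "unit_vec i"] dotp_unit_vec[OF i] by simp
    moreover have "\<bar>mat_pow n N t s i\<bar> \<le> 6 * \<Lambda> ^ t"
      using that by (intro entry_upper L2_s M_s i) auto
    ultimately have "\<bar>?a t\<bar> \<le> \<Lambda> / n * (6 * \<Lambda> ^ t)"
      using \<Lambda> by (simp add: abs_mult) (intro divide_right_mono mult_left_mono, auto)
    then show ?thesis by (simp add: mult.left_commute)
  qed
  have f1: "\<bar>?b t\<bar> \<le> 6 * \<Lambda> ^ Suc t / n" if "t < k" for t
  proof -
    have "dotp n (\<lambda>_. 1) (mat_pow n N t (unit_vec i)) = mat_pow n N t (\<lambda>_. 1) i"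
      using dotp_mat_pow[OF symN, of n t "\<lambda>_. 1" "unit_vec i"] dotp_unit_vec[OF i] by simp
    moreover have "\<bar>mat_pow n N t (\<lambda>_. 1) i\<bar> \<le> 6 * \<Lambda> ^ t"
      using that by (intro entry_upper L2_1 M_1 i) auto
    ultimately have "\<bar>?b t\<bar> \<le> \<bar>e\<bar> * (6 * \<Lambda> ^ t)"
      by (simp add: abs_mult mult_left_mono)
    also have "\<dots> \<le> \<Lambda> / n * (6 * \<Lambda> ^ t)"
      using e \<kappa>_le n \<kappa> \<Lambda> by (intro mult_right_mono) (auto simp: field_simps)
    finally show ?thesis by (simp add: mult.left_commute)
  qed
  have L: "?L (\<lambda>j. ?a t * ?P (k - 1 - t) s j + ?b t * ?P (k - 1 - t) (\<lambda>_. 1) j)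
      \<le> 12 * \<Lambda> ^ k / sqrt n * (1/2) ^ (k - 1 - t)" if t: "t < k" for t
  proof -
    have p: "?L (?P (k - 1 - t) v) \<le> \<kappa> ^ (k - 1 - t) * sqrt n" if "?L v = sqrt n" for v
      using op_bounded_pow[OF opM \<kappa>, of "k - 1 - t" v] that by simp
    have "?L (\<lambda>j. ?a t * ?P (k - 1 - t) s j + ?b t * ?P (k - 1 - t) (\<lambda>_. 1) j)
       \<le> ?L (\<lambda>j. ?a t * ?P (k - 1 - t) s j) + ?L (\<lambda>j. ?b t * ?P (k - 1 - t) (\<lambda>_. 1) j)"
      by (rule L2_set_triangle_ineq)
    also have "\<dots> \<le> 6 * \<Lambda> ^ Suc t / n * (\<kappa> ^ (k - 1 - t) * sqrt n) + 6 * \<Lambda> ^ Suc t / n * (\<kappa> ^ (k - 1 - t) * sqrt n)"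
      unfolding L2_set_scale
      by (intro add_mono mult_mono p L2_s L2_1 fs f1 t) (use \<Lambda> in auto)
    also have "\<dots> = 12 * \<Lambda> ^ Suc t * \<kappa> ^ (k - 1 - t) / sqrt n"
      using n real_sqrt_mult_self[of n] by (simp add: field_simps)
    also have "\<dots> \<le> 12 * \<Lambda> ^ Suc t * (\<Lambda> / 2) ^ (k - 1 - t) / sqrt n"
      using \<kappa>_le \<kappa> \<Lambda> by (intro divide_right_mono mult_left_mono power_mono) auto
    also have "\<dots> = 12 * \<Lambda> ^ k / sqrt n * (1/2) ^ (k - 1 - t)"
    proof -
      have "Suc t + (k - 1 - t) = k" using t by simp
      then have "\<Lambda> ^ Suc t * \<Lambda> ^ (k - 1 - t) = \<Lambda> ^ k" by (metis power_add)
      then show ?thesis using power_mult_distrib[of \<Lambda> "1/2" "k - 1 - t"] by simp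
    qed
    finally show ?thesis .
  qed
  have "?L (mat_pow n N k (unit_vec i)) \<le> ?L (?P k (unit_vec i))
      + ?L (\<lambda>j. \<Sum>t<k. ?a t * ?P (k - 1 - t) s j + ?b t * ?P (k - 1 - t) (\<lambda>_. 1) j)"
    unfolding duhamel[OF N_vec, where k=k] by (rule L2_set_triangle_ineq)
  also have "?L (?P k (unit_vec i)) \<le> \<kappa> ^ k"
    using op_bounded_pow[OF opM \<kappa>, of k "unit_vec i"] L2_set_unit_vec[OF i] by simp
  also have "?L (\<lambda>j. \<Sum>t<k. ?a t * ?P (k - 1 - t) s j + ?b t * ?P (k - 1 - t) (\<lambda>_. 1) j)
      \<le> (\<Sum>t<k. 12 * \<Lambda> ^ k / sqrt n * (1/2) ^ (k - 1 - t))"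
    by (rule order_trans[OF L2_set_sum_le sum_mono]) (use L in auto)
  also have "\<dots> = 12 * \<Lambda> ^ k / sqrt n * (\<Sum>t<k. (1/2) ^ t)"
    using sum.nat_diff_reindex[of "\<lambda>t. (1/2::real) ^ t" k] unfolding sum_distrib_left[symmetric] by simp
  also have "\<dots> \<le> 12 * \<Lambda> ^ k / sqrt n * 2"
    using \<Lambda> by (intro mult_left_mono, subst sum_gp_strict) auto
  finally show ?thesis by simp
qed

end

section \<open>Comparison of traces\<close>

abbreviation walks :: "nat \<Rightarrow> nat \<Rightarrow> (nat \<Rightarrow> nat) set" where
  "walks l n \<equiv> PiE {..<l} (\<lambda>_. {..<n})"

definition pair_of :: "nat \<Rightarrow> nat \<Rightarrow> nat \<times> nat" where
  "pair_of i j = (min i j, max i j)"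

definition sym_of :: "(nat \<times> nat \<Rightarrow> bool \<Rightarrow> real) \<Rightarrow> (nat \<times> nat \<Rightarrow> bool) \<Rightarrow> nat \<Rightarrow> nat \<Rightarrow> real" where
  "sym_of val E i j = (if i = j then 0 else val (pair_of i j) (E (pair_of i j)))"

text \<open>Closed walks are functions on the times modulo \<open>l\<close>: the step at time 0
  closes the walk, coming from the vertex at time \<open>l - 1\<close>.\<close>

definition cyc_pred :: "nat \<Rightarrow> nat \<Rightarrow> nat" where
  "cyc_pred l t = (if t = 0 then l - 1 else t - 1)"

definition step_edge :: "nat \<Rightarrow> (nat \<Rightarrow> nat) \<Rightarrow> nat \<Rightarrow> nat \<times> nat" where
  "step_edge l f t = pair_of (f (cyc_pred l t)) (f t)"

definition walk_weight :: "(nat \<Rightarrow> nat \<Rightarrow> real) \<Rightarrow> nat \<Rightarrow> (nat \<Rightarrow> nat) \<Rightarrow> real" where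
  "walk_weight M l f = (\<Prod>t<l. M (f (cyc_pred l t)) (f t))"

lemma pair_of_eq_iff: "pair_of a b = pair_of c d \<longleftrightarrow> (a = c \<and> b = d) \<or> (a = d \<and> b = c)"
  by (auto simp: pair_of_def min_def max_def split: if_splits)

lemma pair_of_commute: "pair_of a b = pair_of b a"
  by (simp add: pair_of_eq_iff)

lemma sym_sym_of: "sym_mat (sym_of val E)"
  by (auto simp: sym_mat_def sym_of_def pair_of_commute)

lemma finite_csbm_pairs [simp]: "finite (csbm_pairs n)"
  by (rule finite_subset[of _ "{..<n} \<times> {..<n}"]) (auto simp: csbm_pairs_def)

lemma pair_of_in_csbm_pairs: "i \<noteq> j \<Longrightarrow> i < n \<Longrightarrow> j < n \<Longrightarrow> pair_of i j \<in> csbm_pairs n"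
  by (auto simp: csbm_pairs_def pair_of_def min_def max_def)

lemma cyc_pred_less: "t < l \<Longrightarrow> cyc_pred l t < l"
  by (auto simp: cyc_pred_def)

text \<open>A walk lists the \<open>l\<close> vertices after the start \<open>i\<close>, so
  \<open>f t\<close> is the end of step \<open>t\<close>; the start itself is not part of
  \<open>f\<close>.\<close>

lemma mat_pow_walks:
  "mat_pow n M l x i = (\<Sum>f\<in>walks l n.
     (\<Prod>t<l. M (if t = 0 then i else f (t - 1)) (f t)) * x (if l = 0 then i else f (l - 1)))"
proof (induction l arbitrary: x)
  case (Suc l)
  let ?W = "\<lambda>f m. \<Prod>t<m. M (if t = 0 then i else f (t - 1)) (f t)"
  let ?P = "walks l n"
  have W: "?W (f(l := j)) l = ?W f l" for f :: "nat \<Rightarrow> nat" and j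
    by (intro prod.cong refl) auto
  have W2: "?W (f(l := j)) (Suc l) * x ((f(l := j)) l) = ?W f l * (M (if l = 0 then i else f (l - 1)) j * x j)"
    for f :: "nat \<Rightarrow> nat" and j
  proof -
    have "?W (f(l := j)) (Suc l) = ?W (f(l := j)) l * M (if l = 0 then i else (f(l := j)) (l - 1)) ((f(l := j)) l)"
      by (rule prod.lessThan_Suc)
    then show ?thesis unfolding W by (cases l) auto
  qed
  have inj: "inj_on (\<lambda>(j, f). f(l := j)) ({..<n} \<times> ?P)" by (rule inj_combinator) simp
  have "(mat_vec n M ^^ Suc l) x i = mat_pow n M l (mat_vec n M x) i"
    by (simp add: funpow_swap1)
  also have "\<dots> = (\<Sum>f\<in>?P. ?W f l * (\<Sum>j<n. M (if l = 0 then i else f (l - 1)) j * x j))"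
    unfolding Suc by (simp add: mat_vec_def)
  also have "\<dots> = (\<Sum>f\<in>?P. \<Sum>j<n. ?W f l * (M (if l = 0 then i else f (l - 1)) j * x j))"
    by (simp only: sum_distrib_left)
  also have "\<dots> = (\<Sum>j<n. \<Sum>f\<in>?P. ?W f l * (M (if l = 0 then i else f (l - 1)) j * x j))"
    by (rule sum.swap)
  also have "\<dots> = (\<Sum>(j,f)\<in>{..<n} \<times> ?P. ?W f l * (M (if l = 0 then i else f (l - 1)) j * x j))"
    by (rule sum.cartesian_product)
  also have "\<dots> = (\<Sum>(j,f)\<in>{..<n} \<times> ?P. ?W (f(l := j)) (Suc l) * x ((f(l := j)) l))"
    by (intro sum.cong refl) (simp only: W2 case_prod_beta)
  also have "\<dots> = (\<Sum>g\<in>(\<lambda>(j, f). f(l := j)) ` ({..<n} \<times> ?P). ?W g (Suc l) * x (g l))"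
    unfolding sum.reindex[OF inj] comp_def by (simp only: case_prod_unfold)
  also have "(\<lambda>(j, f). f(l := j)) ` ({..<n} \<times> ?P) = PiE {..<Suc l} (\<lambda>_. {..<n})"
    by (simp add: lessThan_Suc PiE_insert_eq)
  finally show ?case by simp
qed simp

lemma trace_walks:
  assumes "l > 0"
  shows "(\<Sum>i<n. mat_pow n M l (unit_vec i) i) = (\<Sum>f\<in>walks l n. walk_weight M l f)"
proof -
  let ?P = "walks l n"
  let ?W = "\<lambda>f i. \<Prod>t<l. M (if t = 0 then i else f (t - 1)) (f t)"
  have "(\<Sum>i<n. mat_pow n M l (unit_vec i) i) = (\<Sum>i<n. \<Sum>f\<in>?P. ?W f i * unit_vec i (f (l - 1)))"
    unfolding mat_pow_walks using assms by simp
  also have "\<dots> = (\<Sum>f\<in>?P. \<Sum>i<n. ?W f i * unit_vec i (f (l - 1)))" by (rule sum.swap)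
  also have "\<dots> = (\<Sum>f\<in>?P. ?W f (f (l - 1)))"
  proof (intro sum.cong refl)
    fix f assume "f \<in> ?P"
    then have "f (l - 1) < n" using assms by (auto simp: PiE_iff)
    then show "(\<Sum>i<n. ?W f i * unit_vec i (f (l - 1))) = ?W f (f (l - 1))"
      by (simp add: unit_vec_def if_distrib[of "\<lambda>t. _ * t"] sum.delta' cong: if_cong)
  qed
  also have "\<dots> = (\<Sum>f\<in>?P. walk_weight M l f)"
    unfolding walk_weight_def by (intro sum.cong prod.cong refl) (auto simp: cyc_pred_def)
  finally show ?thesis .
qed

lemma trace_even_power:
  assumes "sym_mat M"
  shows "(\<Sum>i<n. mat_pow n M (2 * r) (unit_vec i) i) = (\<Sum>i<n. (vnorm n (mat_pow n M r (unit_vec i)))\<^sup>2)"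
proof (intro sum.cong refl)
  fix i assume "i \<in> {..<n}"
  then have "mat_pow n M (2 * r) (unit_vec i) i = dotp n (mat_pow n M (2 * r) (unit_vec i)) (unit_vec i)"
    by (simp add: dotp_unit_vec)
  also have "\<dots> = dotp n (mat_pow n M r (mat_pow n M r (unit_vec i))) (unit_vec i)"
    by (simp add: mult_2 funpow_add)
  also have "\<dots> = dotp n (mat_pow n M r (unit_vec i)) (mat_pow n M r (unit_vec i))"
    by (rule dotp_mat_pow[OF assms])
  finally show "mat_pow n M (2 * r) (unit_vec i) i = (vnorm n (mat_pow n M r (unit_vec i)))\<^sup>2"
    by (simp add: L2_set_sq_dotp)
qed

text \<open>For symmetric \<open>M\<close> the squared norm of \<open>M^r x\<close> is the inner
  product of \<open>x\<close> with \<open>M^(2 r) x\<close>, so Cauchy-Schwarz doubles the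
  exponent.\<close>

lemma norm_power_iterate:
  assumes "sym_mat M"
  shows "vnorm n (mat_vec n M x) ^ (2 ^ h) \<le> vnorm n x ^ (2 ^ h - 1) * vnorm n (mat_pow n M (2 ^ h) x)"
proof (induction h)
  case (Suc h)
  let ?L = "\<lambda>x. vnorm n x" and ?P = "\<lambda>k. mat_pow n M k x"
  have "?L (?P (2 ^ h)) ^ 2 = dotp n x (?P (2 ^ Suc h))"
    unfolding L2_set_sq_dotp using dotp_mat_pow[OF assms, of n "2 ^ h" x "?P (2 ^ h)"]
    by (simp add: mult_2 funpow_add)
  also have "\<dots> \<le> ?L x * ?L (?P (2 ^ Suc h))" using dotp_abs_le abs_le_D1 by blast
  finally have 1: "?L (?P (2 ^ h)) ^ 2 \<le> ?L x * ?L (?P (2 ^ Suc h))" .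
  have "?L (mat_vec n M x) ^ (2 ^ Suc h) = (?L (mat_vec n M x) ^ (2 ^ h)) ^ 2"
    by (simp add: power_mult[symmetric] mult.commute)
  also have "\<dots> \<le> (?L x ^ (2 ^ h - 1) * ?L (?P (2 ^ h))) ^ 2"
    by (intro power_mono Suc) simp
  also have "\<dots> = ?L x ^ (2 * (2 ^ h - 1)) * ?L (?P (2 ^ h)) ^ 2"
    by (simp add: power_mult_distrib power_mult[symmetric] mult.commute)
  also have "\<dots> \<le> ?L x ^ (2 * (2 ^ h - 1)) * (?L x * ?L (?P (2 ^ Suc h)))"
    using 1 by (intro mult_left_mono) auto
  also have "\<dots> = ?L x ^ Suc (2 * (2 ^ h - 1)) * ?L (?P (2 ^ Suc h))" by simp
  also have "Suc (2 * (2 ^ h - 1)) = 2 ^ Suc h - (1::nat)"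
    by (cases "2 ^ h :: nat") auto
  finally show ?case .
qed simp

text \<open>Replaces the spectral theorem: repeated squaring bounds the operator norm by the Frobenius norm
  of a high power.\<close>

lemma op_bounded_of_trace:
  assumes sym: "sym_mat M" and K: "K \<ge> 0"
    and tr: "(\<Sum>i<n. mat_pow n M (2 * 2 ^ h) (unit_vec i) i) \<le> K ^ (2 * 2 ^ h)"
  shows "op_bounded n M K"
  unfolding op_bounded_def
proof
  fix x
  let ?L = "\<lambda>x. vnorm n x" and ?r = "2 ^ h :: nat"
  have "?L (mat_pow n M ?r x) ^ 2 = (\<Sum>i<n. (mat_pow n M ?r x i)\<^sup>2)"
    by (simp add: L2_set_def sum_nonneg)
  also have "\<dots> \<le> (\<Sum>i<n. (?L (mat_pow n M ?r (unit_vec i)))\<^sup>2 * (?L x)\<^sup>2)"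
  proof (rule sum_mono)
    fix i assume "i \<in> {..<n}"
    then have "mat_pow n M ?r x i = dotp n x (mat_pow n M ?r (unit_vec i))"
      using dotp_mat_pow[OF sym, of n ?r x "unit_vec i"] by (simp add: dotp_unit_vec)
    then have "\<bar>mat_pow n M ?r x i\<bar> \<le> ?L (mat_pow n M ?r (unit_vec i)) * ?L x"
      by (metis dotp_abs_le mult.commute)
    then have "\<bar>mat_pow n M ?r x i\<bar> ^ 2 \<le> (?L (mat_pow n M ?r (unit_vec i)) * ?L x) ^ 2"
      by (intro power_mono) auto
    then show "(mat_pow n M ?r x i)\<^sup>2 \<le> (?L (mat_pow n M ?r (unit_vec i)))\<^sup>2 * (?L x)\<^sup>2"
      by (simp add: power_mult_distrib)
  qed
  also have "\<dots> = (\<Sum>i<n. (?L (mat_pow n M ?r (unit_vec i)))\<^sup>2) * (?L x)\<^sup>2"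
    by (simp only: sum_distrib_right)
  also have "\<dots> \<le> K ^ (2 * ?r) * (?L x)\<^sup>2"
    using tr trace_even_power[OF sym, where n=n and r="?r"] by (intro mult_right_mono) auto
  also have "\<dots> = (K ^ ?r * ?L x)\<^sup>2" by (simp add: power_mult_distrib power_mult[symmetric] mult.commute)
  finally have F: "?L (mat_pow n M ?r x) \<le> K ^ ?r * ?L x"
    by (rule power2_le_imp_le) (use K in simp)
  have "?L (mat_vec n M x) ^ ?r \<le> ?L x ^ (?r - 1) * ?L (mat_pow n M ?r x)"
    by (rule norm_power_iterate[OF sym])
  also have "\<dots> \<le> ?L x ^ (?r - 1) * (K ^ ?r * ?L x)" using F by (intro mult_left_mono) auto
  also have "\<dots> = (?L x ^ (?r - 1) * ?L x) * K ^ ?r" by simp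
  also have "?L x ^ (?r - 1) * ?L x = ?L x ^ ?r" by (metis One_nat_def Suc_pred mult.commute power_Suc zero_less_numeral zero_less_power)
  also have "?L x ^ ?r * K ^ ?r = (K * ?L x) ^ ?r" by (simp add: power_mult_distrib)
  finally show "?L (mat_vec n M x) \<le> K * ?L x"
    using K by (subst (asm) power_mono_iff) auto
qed

section \<open>Walks grouped by the coincidences among their vertices\<close>

definition same_kernel :: "nat \<Rightarrow> (nat \<Rightarrow> nat) \<Rightarrow> (nat \<Rightarrow> nat) \<Rightarrow> bool" where
  "same_kernel l f g \<longleftrightarrow> (\<forall>s<l. \<forall>t<l. f s = f t \<longleftrightarrow> g s = g t)"

lemma same_kernel_sym: "same_kernel l f g \<Longrightarrow> same_kernel l g f"
  by (auto simp: same_kernel_def)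

lemma same_kernel_card:
  assumes "same_kernel l f g" shows "card (f ` {..<l}) = card (g ` {..<l})"
proof -
  have *: "card (f ` {..<l}) \<le> card (g ` {..<l})" if K: "same_kernel l f g" for f g
  proof (rule card_inj_on_le)
    let ?i = "inv_into {..<l} f"
    show "inj_on (\<lambda>y. g (?i y)) (f ` {..<l})"
    proof (rule inj_onI)
      fix x y assume xy: "x \<in> f ` {..<l}" "y \<in> f ` {..<l}" and "g (?i x) = g (?i y)"
      moreover have "?i x < l" "?i y < l" using xy by (metis inv_into_into lessThan_iff)+
      ultimately have "f (?i x) = f (?i y)" using K by (auto simp: same_kernel_def)
      then show "x = y" using xy by (simp add: f_inv_into_f)
    qed
    show "(\<lambda>y. g (?i y)) ` f ` {..<l} \<subseteq> g ` {..<l}"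
    proof (rule image_subsetI)
      fix y assume "y \<in> f ` {..<l}"
      then have "?i y \<in> {..<l}" by (rule inv_into_into)
      then show "g (?i y) \<in> g ` {..<l}" by (rule imageI)
    qed
  qed simp
  show ?thesis using *[OF assms] *[OF same_kernel_sym[OF assms]] by simp
qed

text \<open>A walk with the kernel of \<open>g\<close> is determined by its values at one
  representative time for each vertex of \<open>g\<close>.\<close>

lemma card_same_kernel_le:
  "card {f \<in> walks l n. same_kernel l f g} \<le> n ^ card (g ` {..<l})"
proof -
  let ?A = "{f \<in> walks l n. same_kernel l f g}"
  let ?i = "inv_into {..<l} g"
  let ?h = "\<lambda>f. restrict (\<lambda>y. f (?i y)) (g ` {..<l})"
  have il: "?i (g t) < l" "g (?i (g t)) = g t" if "t < l" for t
    using that by (metis imageI inv_into_into lessThan_iff, simp add: f_inv_into_f)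
  have "card ?A \<le> card (PiE (g ` {..<l}) (\<lambda>_. {..<n}))"
  proof (rule card_inj_on_le)
    show "inj_on ?h ?A"
    proof (rule inj_onI)
      fix f f' assume f: "f \<in> ?A" "f' \<in> ?A" and eq: "?h f = ?h f'"
      have "f t = f' t" if "t \<in> {..<l}" for t
      proof -
        have t: "t < l" using that by simp
        have "f t = f (?i (g t))" "f' t = f' (?i (g t))"
          using f il[OF t] t by (auto simp: same_kernel_def)
        moreover have "f (?i (g t)) = f' (?i (g t))" using fun_cong[OF eq, of "g t"] t by simp
        ultimately show "f t = f' t" by simp
      qed
      with f show "f = f'" by (intro PiE_ext[of f "{..<l}" "\<lambda>_. {..<n}" f']) auto
    qed
    show "?h ` ?A \<subseteq> PiE (g ` {..<l}) (\<lambda>_. {..<n})" using il by (fastforce simp: PiE_iff)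
  qed (auto intro: finite_PiE)
  then show ?thesis by (simp add: card_PiE)
qed

text \<open>Composing \<open>f\<close> with an injection of its \<open>m\<close> vertices into
  \<open>{..<d}\<close> preserves the kernel. The falling factorial that counts these injections has
  all its factors at least \<open>Suc d - m\<close>.\<close>

lemma card_same_kernel_ge:
  assumes "card (f ` {..<l}) \<le> Suc d"
  shows "(Suc d - card (f ` {..<l})) ^ card (f ` {..<l}) \<le> card {g \<in> walks l d. same_kernel l f g}"
proof -
  let ?K = "{g \<in> walks l d. same_kernel l f g}"
  let ?m = "card (f ` {..<l})"
  let ?A = "{\<psi> \<in> PiE (f ` {..<l}) (\<lambda>_. {..<d}). inj_on \<psi> (f ` {..<l})}"
  let ?h = "\<lambda>\<psi>. restrict (\<lambda>t. \<psi> (f t)) {..<l}"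
  have "(\<Prod>i\<in>{0..<?m}. Suc d - ?m) \<le> (\<Prod>i\<in>{0..<?m}. d - i)" by (intro prod_mono) auto
  also have "\<dots> = card ?A"
    using card_inj_on_subset_funcset[of "f ` {..<l}" "{..<d}" "f ` {..<l}"] by (simp add: comp_def)
  also have "\<dots> \<le> card ?K"
  proof (rule card_inj_on_le)
    show "inj_on ?h ?A"
    proof (rule inj_onI)
      fix \<phi> \<psi> assume f: "\<phi> \<in> ?A" "\<psi> \<in> ?A" and eq: "?h \<phi> = ?h \<psi>"
      have "\<phi> (f t) = \<psi> (f t)" if "t < l" for t using fun_cong[OF eq, of t] that by simp
      with f show "\<phi> = \<psi>" by (intro PiE_ext[of \<phi> "f ` {..<l}" "\<lambda>_. {..<d}" \<psi>]) auto
    qed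
    show "?h ` ?A \<subseteq> ?K"
    proof (rule image_subsetI)
      fix \<psi> assume "\<psi> \<in> ?A"
      then have "\<psi> (f t) < d" "\<psi> (f s) = \<psi> (f t) \<longleftrightarrow> f s = f t" if "s < l" "t < l" for s t
        using that by (auto dest: inj_onD)
      then show "?h \<psi> \<in> ?K"
        by (auto simp: same_kernel_def)
    qed
    show "finite ?K"
      by (rule finite_subset[OF _ finite_PiE[of "{..<l}" "\<lambda>_. {..<d}"]]) auto
  qed
  finally show ?thesis by simp
qed

text \<open>Double counting: \<open>f\<close> is charged to the walks \<open>g\<close> of the same
  kernel, each paying \<open>b g / (p * n^m)\<close> with \<open>m\<close> its number of vertices.
  If \<open>a f > 0\<close>, at least \<open>(p n)^m\<close> such \<open>g\<close> exist, which
  covers \<open>a f\<close>; conversely each \<open>g\<close> is charged by at most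
  \<open>n^m\<close> walks.\<close>

lemma kernel_comparison:
  fixes a b :: "(nat \<Rightarrow> nat) \<Rightarrow> real" and p :: real
  assumes p: "p > 0" and n: "n > 0" and d: "real d \<ge> p * n + r"
    and b: "\<And>g. g \<in> walks l d \<Longrightarrow> b g \<ge> 0"
    and am: "\<And>f. f \<in> walks l n \<Longrightarrow> a f > 0 \<Longrightarrow> card (f ` {..<l}) \<le> Suc r"
    and ab: "\<And>f g. f \<in> walks l n \<Longrightarrow> g \<in> walks l d \<Longrightarrow> a f > 0 \<Longrightarrow>
        same_kernel l f g \<Longrightarrow> p * a f \<le> p ^ card (f ` {..<l}) * b g"
  shows "(\<Sum>f\<in>walks l n. a f) \<le> (\<Sum>g\<in>walks l d. b g) / p"
proof -
  let ?F = "walks l n" and ?G = "walks l d"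
  let ?m = "\<lambda>f. card (f ` {..<l})"
  let ?K = "\<lambda>f. {g \<in> ?G. same_kernel l f g}"
  have fin: "finite ?F" "finite ?G" by (auto intro: finite_PiE)
  have 1: "a f \<le> (\<Sum>g\<in>?K f. b g / (p * n ^ ?m g))" if f: "f \<in> ?F" for f
  proof (cases "a f > 0")
    case False
    have "(\<Sum>g\<in>?K f. b g / (p * n ^ ?m g)) \<ge> 0" using b p by (intro sum_nonneg) auto
    then show ?thesis using False by linarith
  next
    case True
    have m: "?m f \<le> Suc r" by (rule am[OF f True])
    have "r \<le> d" using d p n by (smt (verit) mult_pos_pos of_nat_0_less_iff of_nat_le_iff)
    \<comment> \<open>From \<open>m \<le> r + 1\<close> and \<open>d \<ge> p n + r\<close>, the
      factor \<open>Suc d - m\<close> is at least \<open>p n\<close>.\<close>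
    have "(p * n) ^ ?m f \<le> real (Suc d - ?m f) ^ ?m f"
      using d m p \<open>r \<le> d\<close> by (intro power_mono) auto
    also have "\<dots> \<le> real (card (?K f))"
    proof -
      have "?m f \<le> Suc d" using m \<open>r \<le> d\<close> by simp
      from card_same_kernel_ge[OF this] show ?thesis by (simp only: of_nat_power[symmetric] of_nat_le_iff)
    qed
    finally have c: "(p * n) ^ ?m f \<le> real (card (?K f))" .
    have "(p * n) ^ ?m f * (p * a f) \<le> card (?K f) * (p * a f)" using c True p by (intro mult_right_mono) auto
    also have "\<dots> = (\<Sum>g\<in>?K f. p * a f)" by simp
    also have "\<dots> \<le> (\<Sum>g\<in>?K f. p ^ ?m f * b g)" using ab[OF f _ True] by (intro sum_mono) auto
    also have "\<dots> = (\<Sum>g\<in>?K f. (p * n) ^ ?m f * p * (b g / (p * n ^ ?m g)))"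
    proof (intro sum.cong refl)
      fix g assume "g \<in> ?K f"
      then have "?m g = ?m f" using same_kernel_card by force
      then show "p ^ ?m f * b g = (p * n) ^ ?m f * p * (b g / (p * n ^ ?m g))"
        using p n by (simp add: power_mult_distrib)
    qed
    also have "\<dots> = ((p * n) ^ ?m f * p) * (\<Sum>g\<in>?K f. b g / (p * n ^ ?m g))"
      by (simp only: sum_distrib_left)
    finally have "((p * n) ^ ?m f * p) * a f \<le> ((p * n) ^ ?m f * p) * (\<Sum>g\<in>?K f. b g / (p * n ^ ?m g))"
      by (simp only: mult.assoc)
    moreover have "(p * n) ^ ?m f * p > 0" using p n by simp
    ultimately show ?thesis by (subst (asm) mult_le_cancel_left_pos)
  qed
  have "(\<Sum>f\<in>?F. a f) \<le> (\<Sum>f\<in>?F. \<Sum>g\<in>?K f. b g / (p * n ^ ?m g))"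
    using 1 by (intro sum_mono) auto
  also have "\<dots> = (\<Sum>g\<in>?G. \<Sum>f\<in>{f \<in> ?F. same_kernel l f g}. b g / (p * n ^ ?m g))"
    by (rule sum.swap_restrict[OF fin])
  also have "\<dots> \<le> (\<Sum>g\<in>?G. b g / p)"
  proof (rule sum_mono)
    fix g assume g: "g \<in> ?G"
    have "(\<Sum>f\<in>{f \<in> ?F. same_kernel l f g}. b g / (p * n ^ ?m g))
        = real (card {f \<in> ?F. same_kernel l f g}) * (b g / (p * n ^ ?m g))" by simp
    also have "\<dots> \<le> real (n ^ ?m g) * (b g / (p * n ^ ?m g))"
      using card_same_kernel_le[of l n g] b[OF g] p by (intro mult_right_mono) (auto simp flip: of_nat_power)
    also have "\<dots> = b g / p" using n by simp
    finally show "(\<Sum>f\<in>{f \<in> ?F. same_kernel l f g}. b g / (p * n ^ ?m g)) \<le> b g / p" .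
  qed
  finally show ?thesis by (simp add: sum_divide_distrib)
qed

section \<open>Moments of the weight of a walk\<close>

lemma expectation_prod_Pi_pmf_finite:
  fixes f :: "'a \<Rightarrow> 'b \<Rightarrow> real"
  assumes "finite A" "\<And>x. x \<in> A \<Longrightarrow> finite (set_pmf (P x))"
  shows "pmf_mean (Pi_pmf A dflt P) (\<lambda>y. \<Prod>x\<in>A. f x (y x))
    = (\<Prod>x\<in>A. pmf_mean (P x) (f x))"
proof -
  let ?E = "pmf_mean (Pi_pmf A dflt P)"
  have ind: "prob_space.indep_vars (measure_pmf (Pi_pmf A dflt P)) (\<lambda>_. borel) (\<lambda>x y. f x (y x)) A"
    by (rule prob_space.indep_vars_compose2[OF measure_pmf.prob_space_axioms indep_vars_Pi_pmf[OF assms(1)]]) auto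
  have fin: "finite (set_pmf (Pi_pmf A dflt P))"
    using assms by (subst set_Pi_pmf) (auto intro: finite_PiE_dflt)
  have "?E (\<lambda>y. \<Prod>x\<in>A. f x (y x)) = (\<Prod>x\<in>A. ?E (\<lambda>y. f x (y x)))"
    by (rule prob_space.indep_vars_lebesgue_integral[OF measure_pmf.prob_space_axioms assms(1) ind]) (rule integrable_measure_pmf_finite[OF fin])
  also have "\<dots> = (\<Prod>x\<in>A. pmf_mean (P x) (f x))"
  proof (intro prod.cong refl)
    fix x assume "x \<in> A"
    then have "P x = map_pmf (\<lambda>y. y x) (Pi_pmf A dflt P)" using Pi_pmf_component[OF assms(1), of x dflt P] by simp
    then show "?E (\<lambda>y. f x (y x)) = pmf_mean (P x) (f x)" by simp
  qed
  finally show ?thesis .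
qed

definition edge_mult :: "nat \<Rightarrow> (nat \<Rightarrow> nat) \<Rightarrow> nat \<times> nat \<Rightarrow> nat" where
  "edge_mult l f e = card {t. t < l \<and> step_edge l f t = e}"

definition pairs_pmf :: "nat \<Rightarrow> (nat \<times> nat \<Rightarrow> real) \<Rightarrow> (nat \<times> nat \<Rightarrow> bool) pmf" where
  "pairs_pmf n \<pi> = Pi_pmf (csbm_pairs n) False (\<lambda>e. bernoulli_pmf (\<pi> e))"

lemma finite_set_pairs_pmf [simp]: "finite (set_pmf (pairs_pmf n \<pi>))"
  unfolding pairs_pmf_def by (subst set_Pi_pmf) (auto intro!: finite_PiE_dflt)

lemma walk_weight_loop:
  assumes "t < l" "f (cyc_pred l t) = f t" shows "walk_weight (sym_of val E) l f = 0"
  unfolding walk_weight_def using assms by (intro prod_zero) (auto simp: sym_of_def)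

text \<open>Grouping the steps by the pair they use makes the weight a product over independent
  pairs, with the number of traversals as exponent.\<close>

lemma expectation_walk_weight:
  assumes f: "f \<in> walks l n" and nl: "\<And>t. t < l \<Longrightarrow> f (cyc_pred l t) \<noteq> f t"
  shows "pmf_mean (pairs_pmf n \<pi>) (\<lambda>E. walk_weight (sym_of val E) l f)
    = (\<Prod>e\<in>csbm_pairs n. pmf_mean (bernoulli_pmf (\<pi> e)) (\<lambda>x. val e x ^ edge_mult l f e))"
proof -
  have "walk_weight (sym_of val E) l f = (\<Prod>e\<in>csbm_pairs n. val e (E e) ^ edge_mult l f e)" for E
  proof -
    have "walk_weight (sym_of val E) l f = (\<Prod>t<l. val (step_edge l f t) (E (step_edge l f t)))"
      unfolding walk_weight_def step_edge_def using nl by (intro prod.cong refl) (auto simp: sym_of_def)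
    also have "\<dots> = (\<Prod>e\<in>csbm_pairs n. \<Prod>t\<in>{t. t \<in> {..<l} \<and> step_edge l f t = e}. val (step_edge l f t) (E (step_edge l f t)))"
    proof (rule prod.group[symmetric])
      show "step_edge l f ` {..<l} \<subseteq> csbm_pairs n"
        using f nl cyc_pred_less unfolding step_edge_def
        by (intro image_subsetI pair_of_in_csbm_pairs) (auto simp: PiE_iff)
    qed auto
    also have "\<dots> = (\<Prod>e\<in>csbm_pairs n. \<Prod>t\<in>{t. t \<in> {..<l} \<and> step_edge l f t = e}. val e (E e))"
      by (intro prod.cong refl) auto
    finally show ?thesis by (simp add: edge_mult_def)
  qed
  then show ?thesis unfolding pairs_pmf_def
    using expectation_prod_Pi_pmf_finite[OF finite_csbm_pairs,
        of n "\<lambda>e. bernoulli_pmf (\<pi> e)" False "\<lambda>e x. val e x ^ edge_mult l f e"] by simp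
qed

text \<open>These are the walks that can have nonzero mean weight: a loop has weight 0, and a pair
  traversed exactly once contributes a centred independent factor.\<close>

definition doubled_walk :: "nat \<Rightarrow> (nat \<Rightarrow> nat) \<Rightarrow> bool" where
  "doubled_walk l f \<longleftrightarrow> (\<forall>t<l. f (cyc_pred l t) \<noteq> f t) \<and> (\<forall>t<l. edge_mult l f (step_edge l f t) \<ge> 2)"

lemma doubled_walk_kernel:
  assumes "same_kernel l f g" "doubled_walk l f" shows "doubled_walk l g"
proof -
  have "step_edge l f s = step_edge l f t \<longleftrightarrow> step_edge l g s = step_edge l g t" if "s < l" "t < l" for s t
    using assms(1) that cyc_pred_less unfolding step_edge_def pair_of_eq_iff same_kernel_def by metis
  then have "edge_mult l f (step_edge l f t) = edge_mult l g (step_edge l g t)" if "t < l" for t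
    unfolding edge_mult_def using that by (intro arg_cong[where f=card]) auto
  moreover have "f (cyc_pred l t) = f t \<longleftrightarrow> g (cyc_pred l t) = g t" if "t < l" for t
    using assms(1) that cyc_pred_less unfolding same_kernel_def by metis
  ultimately show ?thesis using assms(2) unfolding doubled_walk_def by metis
qed

lemma card_vertices_le_edges: "card (f ` {..<l}) \<le> Suc (card (step_edge l f ` {..<l}))"
proof -
  have "card (f ` {..<Suc t}) \<le> Suc (card (step_edge l f ` {1..<Suc t}))" if "Suc t \<le> l" for t
    using that
  proof (induction t)
    case 0 then show ?case by (simp add: lessThan_Suc)
  next
    case (Suc t)
    have IH: "card (f ` {..<Suc t}) \<le> Suc (card (step_edge l f ` {1..<Suc t}))" using Suc by simp
    have e: "{1..<Suc (Suc t)} = insert (Suc t) {1..<Suc t}" by auto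
    show ?case
    proof (cases "f (Suc t) \<in> f ` {..<Suc t}")
      case True
      then have "card (f ` {..<Suc (Suc t)}) = card (f ` {..<Suc t})"
        by (simp add: lessThan_Suc[of "Suc t"] insert_absorb)
      moreover have "card (step_edge l f ` {1..<Suc t}) \<le> card (step_edge l f ` {1..<Suc (Suc t)})"
        by (intro card_mono image_mono) auto
      ultimately show ?thesis using IH by linarith
    next
      case False
      have "step_edge l f (Suc t) \<notin> step_edge l f ` {1..<Suc t}"
      proof
        assume "step_edge l f (Suc t) \<in> step_edge l f ` {1..<Suc t}"
        then obtain s where s: "1 \<le> s" "s < Suc t" "step_edge l f (Suc t) = step_edge l f s" by auto
        then have "f (Suc t) = f s \<or> f (Suc t) = f (s - 1)"
          by (auto simp: step_edge_def pair_of_eq_iff cyc_pred_def)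
        moreover have "s - 1 < Suc t" using s by simp
        ultimately show False using False s by blast
      qed
      then have "card (step_edge l f ` {1..<Suc (Suc t)}) = Suc (card (step_edge l f ` {1..<Suc t}))"
        unfolding e by simp
      moreover have "card (f ` {..<Suc (Suc t)}) \<le> Suc (card (f ` {..<Suc t}))"
        unfolding lessThan_Suc[of "Suc t"] by (simp add: card_insert_if)
      ultimately show ?thesis using IH by linarith
    qed
  qed
  then have "l > 0 \<Longrightarrow> card (f ` {..<l}) \<le> Suc (card (step_edge l f ` {1..<l}))"
    using Suc_pred[of l] by (metis order_refl)
  moreover have "card (step_edge l f ` {1..<l}) \<le> card (step_edge l f ` {..<l})"
    by (intro card_mono image_mono) auto
  ultimately show ?thesis by (cases "l = 0") auto
qed

lemma doubled_walk_edges: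
  assumes "doubled_walk l f" shows "2 * card (step_edge l f ` {..<l}) \<le> l"
proof -
  have "2 * card (step_edge l f ` {..<l}) = (\<Sum>e\<in>step_edge l f ` {..<l}. 2)" by simp
  also have "\<dots> \<le> (\<Sum>e\<in>step_edge l f ` {..<l}. edge_mult l f e)"
    using assms by (intro sum_mono) (auto simp: doubled_walk_def)
  also have "\<dots> = (\<Sum>e\<in>step_edge l f ` {..<l}. \<Sum>t\<in>{t. t \<in> {..<l} \<and> step_edge l f t = e}. 1)"
    by (simp add: edge_mult_def)
  also have "\<dots> = (\<Sum>t\<in>{..<l}. 1)" by (rule sum.group) auto
  finally show ?thesis by simp
qed

text \<open>The centred variable is bounded by 1, so its absolute moments of order at least 2 are at
  most the variance \<open>q (1 - q)\<close>.\<close>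

lemma bernoulli_moment:
  assumes "0 \<le> q" "q \<le> p" "p \<le> (1::real)"
  shows "pmf_mean (bernoulli_pmf q) (\<lambda>b. (of_bool b - q) ^ 1) = 0"
    and "m \<ge> 2 \<Longrightarrow> \<bar>pmf_mean (bernoulli_pmf q) (\<lambda>b. (of_bool b - q) ^ m)\<bar> \<le> p"
proof -
  show "pmf_mean (bernoulli_pmf q) (\<lambda>b. (of_bool b - q) ^ 1) = 0"
    using assms by (simp add: algebra_simps)
  assume m: "m \<ge> 2"
  have "\<bar>pmf_mean (bernoulli_pmf q) (\<lambda>b. (of_bool b - q) ^ m)\<bar>
      \<le> q * (1 - q) ^ m + (1 - q) * q ^ m"
  proof -
    have "\<bar>(- q) ^ m\<bar> = q ^ m" using assms by (simp add: power_abs)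
    then have "\<bar>(1 - q) * (- q) ^ m\<bar> = (1 - q) * q ^ m" using assms by (simp add: abs_mult)
    moreover have "\<bar>q * (1 - q) ^ m\<bar> = q * (1 - q) ^ m" using assms by simp
    ultimately show ?thesis using assms abs_triangle_ineq[of "q * (1 - q) ^ m" "(1 - q) * (- q) ^ m"]
      by (simp add: mult.commute)
  qed
  also have "q * (1 - q) ^ m + (1 - q) * q ^ m \<le> q"
  proof -
    have "q * (1 - q) ^ m + (1 - q) * q ^ m \<le> q * (1 - q) ^ 2 + (1 - q) * q ^ 2"
      using assms m by (intro add_mono mult_left_mono power_decreasing) auto
    also have "\<dots> = q * (1 - q)" by (simp add: power2_eq_square algebra_simps)
    also have "\<dots> \<le> q" using assms by (simp add: mult_left_le)
    finally show ?thesis .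
  qed
  finally show "\<bar>pmf_mean (bernoulli_pmf q) (\<lambda>b. (of_bool b - q) ^ m)\<bar> \<le> p"
    using assms by linarith
qed

definition ref_val :: "nat \<times> nat \<Rightarrow> bool \<Rightarrow> real" where
  "ref_val e b = (if b then 2 else - 1)"

lemma ref_moment:
  "pmf_mean (bernoulli_pmf (1/3)) (\<lambda>b. ref_val e b ^ 1) = 0"
  "m \<noteq> 1 \<Longrightarrow> pmf_mean (bernoulli_pmf (1/3)) (\<lambda>b. ref_val e b ^ m) \<ge> 1"
proof -
  show "pmf_mean (bernoulli_pmf (1/3)) (\<lambda>b. ref_val e b ^ 1) = 0"
    by (simp add: ref_val_def)
  assume m: "m \<noteq> 1"
  consider "m = 0" | "m = 2" | "m \<ge> 3" using m by linarith
  then show "pmf_mean (bernoulli_pmf (1/3)) (\<lambda>b. ref_val e b ^ m) \<ge> 1"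
  proof cases
    case 3
    \<comment> \<open>For \<open>m \<ge> 3\<close> the moment is
      \<open>(2^m + 2 * (-1)^m) / 3\<close>, at least \<open>(8 - 2) / 3\<close>.\<close>
    have "(2::real) ^ 3 \<le> 2 ^ m" using 3 by (intro power_increasing) auto
    moreover have "(-1::real) ^ m \<ge> -1" by (cases "even m") auto
    ultimately show ?thesis by (simp add: ref_val_def)
  qed (auto simp: ref_val_def)
qed

text \<open>A walk of positive mean uses each of its pairs at least twice, hence at most
  \<open>r\<close> pairs and \<open>r + 1\<close> vertices, and its mean is at most \<open>p\<close>
  to the number of pairs. A reference walk of the same kernel has mean at least 1. One extra factor
  \<open>p\<close> pays for the possible extra vertex, which is the hypothesis of
  \<open>kernel_comparison\<close>.\<close>

theorem trace_comparison:
  fixes p :: real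
  assumes p: "0 < p" "p \<le> 1" and \<pi>: "\<And>e. 0 \<le> \<pi> e \<and> \<pi> e \<le> p" and n: "n > 0" and r: "r > 0"
    and d: "real d \<ge> p * n + r"
  shows "pmf_mean (pairs_pmf n \<pi>)
      (\<lambda>E. \<Sum>i<n. mat_pow n (sym_of (\<lambda>e b. of_bool b - \<pi> e) E) (2 * r) (unit_vec i) i)
    \<le> pmf_mean (pairs_pmf d (\<lambda>_. 1/3))
      (\<lambda>E. \<Sum>i<d. mat_pow d (sym_of ref_val E) (2 * r) (unit_vec i) i) / p"
proof -
  let ?l = "2 * r"
  let ?val = "\<lambda>e b. of_bool b - \<pi> e :: real"
  define a where "a f = pmf_mean (pairs_pmf n \<pi>) (\<lambda>E. walk_weight (sym_of ?val E) ?l f)" for f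
  define b where "b g = pmf_mean (pairs_pmf d (\<lambda>_. 1/3)) (\<lambda>E. walk_weight (sym_of ref_val E) ?l g)" for g
  have int: "integrable (measure_pmf (pairs_pmf N \<rho>)) h" for N \<rho> and h :: "_ \<Rightarrow> real"
    by (rule integrable_measure_pmf_finite) simp
  have A: "pmf_mean (pairs_pmf n \<pi>)
      (\<lambda>E. \<Sum>i<n. mat_pow n (sym_of ?val E) ?l (unit_vec i) i) = (\<Sum>f\<in>walks ?l n. a f)"
    unfolding a_def using r by (subst Bochner_Integration.integral_sum[symmetric]) (auto simp: trace_walks int)
  have B: "pmf_mean (pairs_pmf d (\<lambda>_. 1/3))
      (\<lambda>E. \<Sum>i<d. mat_pow d (sym_of ref_val E) ?l (unit_vec i) i) = (\<Sum>g\<in>walks ?l d. b g)"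
    unfolding b_def using r by (subst Bochner_Integration.integral_sum[symmetric]) (auto simp: trace_walks int)
  have b0: "b g \<ge> (if doubled_walk ?l g then 1 else 0)" if g: "g \<in> walks ?l d" for g
  proof (cases "\<forall>t<?l. g (cyc_pred ?l t) \<noteq> g t")
    case False
    then have "b g = 0" unfolding b_def using walk_weight_loop[of _ ?l g] by auto
    then show ?thesis using False by (auto simp: doubled_walk_def)
  next
    case True
    have eq: "b g = (\<Prod>e\<in>csbm_pairs d. pmf_mean (bernoulli_pmf (1/3)) (\<lambda>x. ref_val e x ^ edge_mult ?l g e))"
      unfolding b_def by (rule expectation_walk_weight[OF g]) (use True in auto)
    show ?thesis
    proof (cases "\<exists>e\<in>csbm_pairs d. edge_mult ?l g e = 1")
      case t: True
      then obtain e where e: "e \<in> csbm_pairs d" "edge_mult ?l g e = 1" by blast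
      have "b g = 0" unfolding eq using ref_moment(1)[of e] e by (intro prod_zero bexI[of _ e]) simp_all
      moreover have "\<not> doubled_walk ?l g"
      proof -
        from t obtain e where e: "edge_mult ?l g e = 1" by blast
        then have "{t. t < ?l \<and> step_edge ?l g t = e} \<noteq> {}" unfolding edge_mult_def by (metis card.empty zero_neq_one)
        then obtain t where "t < ?l" "step_edge ?l g t = e" by auto
        then show ?thesis using e unfolding doubled_walk_def by auto
      qed
      ultimately show ?thesis by simp
    next
      case False
      then have "1 \<le> b g" unfolding eq using ref_moment(2) by (intro prod_ge_1) auto
      then show ?thesis by simp
    qed
  qed
  have a0: "doubled_walk ?l f \<and> a f \<le> p ^ card (step_edge ?l f ` {..<?l})"
    if f: "f \<in> walks ?l n" and pos: "a f > 0" for f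
  proof -
    have nl: "\<forall>t<?l. f (cyc_pred ?l t) \<noteq> f t"
    proof (intro allI impI notI)
      fix t assume "t < ?l" "f (cyc_pred ?l t) = f t"
      from walk_weight_loop[OF this] have "a f = 0" unfolding a_def by simp
      then show False using pos by simp
    qed
    let ?E = "\<lambda>e. pmf_mean (bernoulli_pmf (\<pi> e)) (\<lambda>x. ?val e x ^ edge_mult ?l f e)"
    have eq: "a f = (\<Prod>e\<in>csbm_pairs n. ?E e)"
      unfolding a_def by (rule expectation_walk_weight[OF f]) (use nl in auto)
    have n1: "edge_mult ?l f e \<noteq> 1" if e: "e \<in> csbm_pairs n" for e
    proof
      assume "edge_mult ?l f e = 1"
      then have "?E e = 0" using bernoulli_moment(1)[of "\<pi> e" p] \<pi>[of e] p by simp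
      then have "a f = 0" unfolding eq using e by (intro prod_zero) auto
      then show False using pos by simp
    qed
    have sub: "step_edge ?l f ` {..<?l} \<subseteq> csbm_pairs n"
      using f nl cyc_pred_less unfolding step_edge_def
      by (intro image_subsetI pair_of_in_csbm_pairs) (auto simp: PiE_iff)
    have pos_mult: "edge_mult ?l f (step_edge ?l f t) > 0" if "t < ?l" for t
      using that unfolding edge_mult_def by (subst card_gt_0_iff) auto
    have ge2: "edge_mult ?l f e \<ge> 2" if "e \<in> step_edge ?l f ` {..<?l}" for e
      using n1[of e] sub that pos_mult by fastforce
    have "a f \<le> (\<Prod>e\<in>csbm_pairs n. \<bar>?E e\<bar>)" unfolding eq abs_prod[symmetric] by (rule abs_ge_self)
    also have "\<dots> = (\<Prod>e\<in>step_edge ?l f ` {..<?l}. \<bar>?E e\<bar>)"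
    proof (rule prod.mono_neutral_right[OF finite_csbm_pairs sub], intro ballI)
      fix e assume "e \<in> csbm_pairs n - step_edge ?l f ` {..<?l}"
      then have "edge_mult ?l f e = 0" unfolding edge_mult_def by auto
      then show "\<bar>?E e\<bar> = 1" by simp
    qed
    also have "\<dots> \<le> (\<Prod>e\<in>step_edge ?l f ` {..<?l}. p)"
    proof (intro prod_mono conjI abs_ge_zero)
      fix e assume "e \<in> step_edge ?l f ` {..<?l}"
      from bernoulli_moment(2)[OF _ _ p(2) ge2[OF this]] \<pi>[of e] show "\<bar>?E e\<bar> \<le> p" by blast
    qed
    finally show ?thesis using nl ge2 by (auto simp: doubled_walk_def)
  qed
  show ?thesis
    unfolding A B
  proof (rule kernel_comparison[OF p(1) n d])
    fix g assume "g \<in> walks ?l d"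
    then show "0 \<le> b g" using b0[of g] by (auto split: if_splits)
  next
    fix f assume f: "f \<in> walks ?l n" "a f > 0"
    show "card (f ` {..<?l}) \<le> Suc r"
      using card_vertices_le_edges[of f ?l] doubled_walk_edges[of ?l f] a0[OF f] by linarith
  next
    fix f g assume f: "f \<in> walks ?l n" and g: "g \<in> walks ?l d"
      and pos: "a f > 0" and K: "same_kernel ?l f g"
    have "b g \<ge> 1" using b0[OF g] doubled_walk_kernel[OF K] a0[OF f pos] by simp
    have "p * a f \<le> p ^ Suc (card (step_edge ?l f ` {..<?l}))" using a0[OF f pos] p by simp
    also have "\<dots> \<le> p ^ card (f ` {..<?l})" using p card_vertices_le_edges by (intro power_decreasing) auto
    also have "\<dots> \<le> p ^ card (f ` {..<?l}) * b g" using \<open>b g \<ge> 1\<close> p by simp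
    finally show "p * a f \<le> p ^ card (f ` {..<?l}) * b g" .
  qed
qed

section \<open>The operator norm of the noise\<close>

lemma dotp_add_left: "dotp n (\<lambda>i. x i + y i) z = dotp n x z + dotp n y z"
  by (simp add: dotp_def algebra_simps sum.distrib)

lemma dotp_add_right: "dotp n z (\<lambda>i. x i + y i) = dotp n z x + dotp n z y"
  by (simp add: dotp_def algebra_simps sum.distrib)

lemma dotp_scale_left: "dotp n (\<lambda>i. c * x i) z = c * dotp n x z"
  by (simp add: dotp_def algebra_simps sum_distrib_left)

lemma dotp_scale_right: "dotp n z (\<lambda>i. c * x i) = c * dotp n z x"
  by (simp add: dotp_def algebra_simps sum_distrib_left)

text \<open>Let \<open>s\<close> be the supremum of the form over pairs from the unit ball.
  Replacing both arguments by net points, whose norms may reach 9/8, costs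
  \<open>9/8 * 1/8 + 1/8 = 17/64\<close> of \<open>s\<close>, so
  \<open>s \<le> T + 17/64 * s\<close>. Absorbing the last term needs \<open>s\<close> finite, which
  the sum of all \<open>\<bar>M i j\<bar>\<close> ensures.\<close>

lemma op_bounded_of_net:
  assumes T: "T \<ge> 0" and net: "\<And>x. vnorm n x \<le> 1 \<Longrightarrow> \<exists>z\<in>Z. vnorm n (\<lambda>i. x i - z i) \<le> 1/8"
    and Z: "\<And>z z'. z \<in> Z \<Longrightarrow> z' \<in> Z \<Longrightarrow> dotp n z (mat_vec n M z') \<le> T"
  shows "op_bounded n M (2 * T)"
proof -
  let ?L = "\<lambda>x. vnorm n x"
  let ?q = "\<lambda>x y. dotp n x (mat_vec n M y)"
  define A where "A = {?q x y | x y. ?L x \<le> 1 \<and> ?L y \<le> 1}"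
  define s where "s = Sup A"
  have bdd: "bdd_above A"
  proof (rule bdd_aboveI)
    fix a assume "a \<in> A"
    then obtain x y where a: "a = ?q x y" and xy: "?L x \<le> 1" "?L y \<le> 1" by (auto simp: A_def)
    have y1: "\<bar>y j\<bar> \<le> 1" if "j < n" for j using L2_member[OF that, of y] xy(2) by linarith
    have x1: "\<bar>x j\<bar> \<le> 1" if "j < n" for j using L2_member[OF that, of x] xy(1) by linarith
    have "a \<le> (\<Sum>i<n. \<bar>x i * (\<Sum>j<n. M i j * y j)\<bar>)"
      unfolding a dotp_def mat_vec_def by (intro sum_mono) auto
    also have "\<dots> \<le> (\<Sum>i<n. \<Sum>j<n. \<bar>M i j\<bar>)"
    proof (intro sum_mono)
      fix i assume i: "i \<in> {..<n}"
      have "\<bar>x i * (\<Sum>j<n. M i j * y j)\<bar> \<le> 1 * \<bar>\<Sum>j<n. M i j * y j\<bar>"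
        unfolding abs_mult using x1[of i] i by (intro mult_right_mono) auto
      also have "\<dots> \<le> (\<Sum>j<n. \<bar>M i j * y j\<bar>)" by simp
      also have "\<dots> \<le> (\<Sum>j<n. \<bar>M i j\<bar>)"
        unfolding abs_mult using y1 by (intro sum_mono mult_left_le) auto
      finally show "\<bar>x i * (\<Sum>j<n. M i j * y j)\<bar> \<le> (\<Sum>j<n. \<bar>M i j\<bar>)" .
    qed
    finally show "a \<le> (\<Sum>i<n. \<Sum>j<n. \<bar>M i j\<bar>)" .
  qed
  have le_s: "?q x y \<le> s" if "?L x \<le> 1" "?L y \<le> 1" for x y
    unfolding s_def using that by (intro cSup_upper bdd) (auto simp: A_def)
  have z0: "?L (\<lambda>_. 0) = 0" by (simp add: L2_set_def)
  have s0: "s \<ge> 0" using le_s[of "\<lambda>_. 0" "\<lambda>_. 0"] z0 by (simp add: dotp_def)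
  have hom: "?q x y \<le> ?L x * ?L y * s" for x y
  proof (cases "?L x = 0 \<or> ?L y = 0")
    case True
    then have "?q x y = 0"
      by (auto simp: L2_set_eq_0_iff dotp_def mat_vec_def intro!: sum.neutral)
    then show ?thesis using True by auto
  next
    case False
    then have pos: "?L x > 0" "?L y > 0" using L2_set_nonneg by (metis less_eq_real_def)+
    let ?x = "\<lambda>i. inverse (?L x) * x i" and ?y = "\<lambda>i. inverse (?L y) * y i"
    have "?q ?x ?y \<le> s" by (rule le_s) (use pos in \<open>simp_all only: L2_set_scale, simp_all\<close>)
    then have "inverse (?L x) * (inverse (?L y) * ?q x y) \<le> s"
      by (simp only: mat_vec_scale dotp_scale_left dotp_scale_right)
    then show ?thesis using pos by (simp add: field_simps)
  qed
  have "s \<le> T + 17/64 * s"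
    unfolding s_def
  proof (rule cSup_least)
    show "A \<noteq> {}" using z0 by (auto simp: A_def intro!: exI[of _ "\<lambda>_. 0"])
  next
    fix a assume "a \<in> A"
    then obtain x y where a: "a = ?q x y" and xy: "?L x \<le> 1" "?L y \<le> 1" by (auto simp: A_def)
    obtain u where u: "u \<in> Z" "?L (\<lambda>i. x i - u i) \<le> 1/8" using net[OF xy(1)] by blast
    obtain v where v: "v \<in> Z" "?L (\<lambda>i. y i - v i) \<le> 1/8" using net[OF xy(2)] by blast
    have Lu: "?L u \<le> 9/8"
    proof -
      have "?L u = ?L (\<lambda>i. x i + (-1) * (x i - u i))" by simp
      also have "\<dots> \<le> ?L x + ?L (\<lambda>i. (-1) * (x i - u i))" by (rule L2_set_triangle_ineq)
      also have "\<dots> \<le> 9/8" unfolding L2_set_scale using xy u by simp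
      finally show ?thesis .
    qed
    have "?q x y = ?q (\<lambda>i. u i + (x i - u i)) y" by simp
    also have "\<dots> = ?q u y + ?q (\<lambda>i. x i - u i) y" by (rule dotp_add_left)
    also have "?q u y = ?q u (\<lambda>i. v i + 1 * (y i - v i))" by simp
    also have "\<dots> = ?q u v + ?q u (\<lambda>i. y i - v i)" unfolding mat_vec_lin dotp_add_right by simp
    finally have "a = ?q u v + ?q u (\<lambda>i. y i - v i) + ?q (\<lambda>i. x i - u i) y" by (simp add: a)
    also have "?q u (\<lambda>i. y i - v i) \<le> 9/8 * (1/8) * s"
      by (rule order_trans[OF hom]) (intro mult_right_mono mult_mono Lu v s0, auto)
    also have "?q (\<lambda>i. x i - u i) y \<le> 1/8 * 1 * s"
      by (rule order_trans[OF hom]) (intro mult_right_mono mult_mono xy u s0, auto)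
    also have "?q u v \<le> T" by (rule Z[OF u(1) v(1)])
    finally show "a \<le> T + 17/64 * Sup A" unfolding s_def[symmetric] by simp
  qed
  then have sT: "s \<le> 2 * T" using T by simp
  show ?thesis unfolding op_bounded_def
  proof
    fix x
    let ?y = "mat_vec n M x"
    have "?L ?y * ?L ?y = ?q ?y x" using L2_set_sq_dotp[of ?y n] by (simp add: power2_eq_square)
    also have "\<dots> \<le> ?L ?y * ?L x * s" by (rule hom)
    also have "\<dots> \<le> ?L ?y * ?L x * (2 * T)" using sT by (intro mult_left_mono) auto
    finally have "?L ?y * ?L ?y \<le> ?L ?y * (2 * T * ?L x)" by (simp add: mult_ac)
    then show "?L ?y \<le> 2 * T * ?L x"
    proof (cases "?L ?y = 0")
      case False
      then have "?L ?y > 0" using L2_set_nonneg by (metis less_eq_real_def)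
      with \<open>?L ?y * ?L ?y \<le> _\<close> show ?thesis by (subst (asm) mult_le_cancel_left_pos)
    qed (use T in auto)
  qed
qed

text \<open>Rounding a unit vector to the mesh \<open>1 / (4 * sqrt d)\<close> moves it by at most 1/8, and
  \<open>(4 * 9/8)\<^sup>2 \<le> 21\<close>; the box only makes the set finite.\<close>

definition grid :: "nat \<Rightarrow> (nat \<Rightarrow> int) set" where
  "grid d = {z \<in> PiE {..<d} (\<lambda>_. {- int (5 * d)..int (5 * d)}). (\<Sum>i<d. (z i)\<^sup>2) \<le> 21 * int d}"

definition grid_vec :: "nat \<Rightarrow> (nat \<Rightarrow> int) \<Rightarrow> nat \<Rightarrow> real" where
  "grid_vec d z i = real_of_int (z i) / (4 * sqrt d)"

text \<open>Comparison with a geometric series through \<open>exp (- k^2) \<le> 2^(-k)\<close>; the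
  remainder subtracted from 3 carries the induction.\<close>

lemma sum_exp_neg_sq: "(\<Sum>a\<in>{- int B..int B}. exp (- (real_of_int a)\<^sup>2)) \<le> 3"
proof -
  have e2: "exp (-1::real) \<le> 1/2"
  proof -
    have "exp 1 \<ge> (2::real)" using exp_ge_add_one_self[of 1] by simp
    then show ?thesis by (simp add: exp_minus field_simps)
  qed
  have ek: "exp (- (real k)\<^sup>2) \<le> (1/2) ^ k" for k :: nat
  proof -
    have "real k \<le> (real k)\<^sup>2" by (cases k) (auto simp: power2_eq_square algebra_simps)
    then have "exp (- (real k)\<^sup>2) \<le> exp (real k * (-1))" by simp
    also have "\<dots> = exp (-1) ^ k" by (simp only: exp_of_nat_mult)
    also have "\<dots> \<le> (1/2) ^ k" by (intro power_mono e2) simp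
    finally show ?thesis .
  qed
  have "(\<Sum>a\<in>{- int B..int B}. exp (- (real_of_int a)\<^sup>2)) \<le> 3 - 2 * (1/2) ^ B"
  proof (induction B)
    case (Suc B)
    have eq: "{- int (Suc B)..int (Suc B)} = insert (- int (Suc B)) (insert (int (Suc B)) {- int B..int B})" by auto
    have "(\<Sum>a\<in>{- int (Suc B)..int (Suc B)}. exp (- (real_of_int a)\<^sup>2))
       = 2 * exp (- (real (Suc B))\<^sup>2) + (\<Sum>a\<in>{- int B..int B}. exp (- (real_of_int a)\<^sup>2))"
      unfolding eq
      by (subst sum.insert, simp, simp, subst sum.insert) (auto simp: power2_eq_square algebra_simps)
    also have "\<dots> \<le> 2 * (1/2) ^ Suc B + (3 - 2 * (1/2) ^ B)" using Suc ek[of "Suc B"] by (intro add_mono mult_left_mono) auto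
    also have "\<dots> = 3 - 2 * (1/2) ^ Suc B" by simp
    finally show ?case .
  qed simp
  then show ?thesis by (rule order_trans) simp
qed

lemma finite_grid [simp]: "finite (grid d)"
  unfolding grid_def by (rule finite_subset[OF _ finite_PiE[of "{..<d}" "\<lambda>_. {- int (5 * d)..int (5 * d)}"]]) auto

text \<open>Exponential weighting: each grid point \<open>z\<close> has weight
  \<open>exp (21 d - sum of z_i^2) \<ge> 1\<close>, and over the whole box the weights factorise
  into one-dimensional sums, each at most \<open>3 \<le> exp 2\<close>.\<close>

lemma card_grid: "real (card (grid d)) \<le> exp (23 * real d)"
proof -
  let ?P = "PiE {..<d} (\<lambda>_. {- int (5 * d)..int (5 * d)})"
  have fin: "finite ?P" by (intro finite_PiE) auto
  have "real (card (grid d)) = (\<Sum>z\<in>grid d. 1)" by simp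
  also have "\<dots> \<le> (\<Sum>z\<in>grid d. exp (21 * d) * (\<Prod>i<d. exp (- (real_of_int (z i))\<^sup>2)))"
  proof (rule sum_mono)
    fix z assume "z \<in> grid d"
    then have "(\<Sum>i<d. (z i)\<^sup>2) \<le> 21 * int d" by (simp add: grid_def)
    then have "real_of_int (\<Sum>i<d. (z i)\<^sup>2) \<le> real_of_int (21 * int d)" by (simp only: of_int_le_iff)
    then have "0 \<le> 21 * real d + (\<Sum>i<d. - (real_of_int (z i))\<^sup>2)" by (simp add: sum_negf)
    then have "1 \<le> exp (21 * real d + (\<Sum>i<d. - (real_of_int (z i))\<^sup>2))" by simp
    also have "\<dots> = exp (21 * d) * (\<Prod>i<d. exp (- (real_of_int (z i))\<^sup>2))" by (simp add: exp_add exp_sum)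
    finally show "1 \<le> exp (21 * d) * (\<Prod>i<d. exp (- (real_of_int (z i))\<^sup>2))" .
  qed
  also have "\<dots> \<le> (\<Sum>z\<in>?P. exp (21 * d) * (\<Prod>i<d. exp (- (real_of_int (z i))\<^sup>2)))"
  proof (rule sum_mono2[OF fin])
    show "grid d \<subseteq> ?P" unfolding grid_def by (rule Collect_restrict)
  qed (intro mult_nonneg_nonneg prod_nonneg, auto)
  also have "\<dots> = exp (21 * d) * (\<Sum>z\<in>?P. \<Prod>i<d. exp (- (real_of_int (z i))\<^sup>2))"
    by (simp only: sum_distrib_left)
  also have "(\<Sum>z\<in>?P. \<Prod>i<d. exp (- (real_of_int (z i))\<^sup>2))
      = (\<Prod>i<d. \<Sum>a\<in>{- int (5 * d)..int (5 * d)}. exp (- (real_of_int a)\<^sup>2))"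
    by (rule prod_sum_PiE[symmetric]) auto
  also have "exp (21 * d) * \<dots> \<le> exp (21 * d) * (\<Prod>i<d. exp 2)"
  proof (intro mult_left_mono prod_mono conjI sum_nonneg)
    have "(3::real) \<le> exp 2" using exp_ge_add_one_self[of "2::real"] by simp
    then show "(\<Sum>a\<in>{- int (5 * d)..int (5 * d)}. exp (- (real_of_int a)\<^sup>2)) \<le> exp 2"
      using sum_exp_neg_sq[of "5 * d"] by linarith
  qed auto
  also have "\<dots> = exp (23 * real d)" by (simp add: exp_of_nat_mult[symmetric] exp_add[symmetric])
  finally show ?thesis .
qed

lemma L2_grid_vec:
  assumes "z \<in> grid d" "d > 0" shows "(vnorm d (grid_vec d z))\<^sup>2 \<le> 21/16"
proof -
  have "(\<Sum>i<d. (z i)\<^sup>2) \<le> 21 * int d" using assms by (simp add: grid_def)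
  then have *: "real_of_int (\<Sum>i<d. (z i)\<^sup>2) \<le> real_of_int (21 * int d)" by (simp only: of_int_le_iff)
  have "(vnorm d (grid_vec d z))\<^sup>2 = (\<Sum>i<d. (real_of_int (z i))\<^sup>2) / (16 * d)"
    by (simp add: L2_set_def sum_nonneg grid_vec_def power_divide power_mult_distrib sum_divide_distrib)
  also have "\<dots> \<le> 21 / 16" using * assms(2) by (simp add: field_simps)
  finally show ?thesis .
qed

lemma grid_net:
  assumes d: "d > 0" and x: "vnorm d x \<le> 1"
  shows "\<exists>z\<in>grid_vec d ` grid d. vnorm d (\<lambda>i. x i - z i) \<le> 1/8"
proof -
  let ?L = "\<lambda>x. vnorm d x"
  define z where "z = restrict (\<lambda>i. round (4 * sqrt d * x i)) {..<d}"
  have sd: "sqrt d > 0" using d by simp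
  have err: "\<bar>x i - grid_vec d z i\<bar> \<le> 1 / (8 * sqrt d)" if "i < d" for i
  proof -
    have "\<bar>of_int (round (4 * sqrt d * x i)) - 4 * sqrt d * x i\<bar> \<le> 1/2" by (rule of_int_round_abs_le)
    then have "\<bar>(of_int (round (4 * sqrt d * x i)) - 4 * sqrt d * x i) / (4 * sqrt d)\<bar> \<le> (1/2) / (4 * sqrt d)"
      unfolding abs_divide using sd by (intro frac_le) auto
    moreover have "(of_int (round (4 * sqrt d * x i)) - 4 * sqrt d * x i) / (4 * sqrt d) = grid_vec d z i - x i"
      using that sd by (simp add: grid_vec_def z_def diff_divide_distrib)
    ultimately show ?thesis by (simp add: abs_minus_commute)
  qed
  have e8: "?L (\<lambda>i. x i - grid_vec d z i) \<le> 1/8"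
  proof -
    have "?L (\<lambda>i. x i - grid_vec d z i) = ?L (\<lambda>i. \<bar>x i - grid_vec d z i\<bar>)" by (simp add: L2_set_def)
    also have "\<dots> \<le> ?L (\<lambda>i. 1 / (8 * sqrt d))" by (rule L2_set_mono) (use err in auto)
    also have "\<dots> = 1/8" using sd by (simp add: L2_set_constant)
    finally show ?thesis .
  qed
  have Lg: "?L (grid_vec d z) \<le> 9/8"
  proof -
    have "?L (grid_vec d z) = ?L (\<lambda>i. x i + (-1) * (x i - grid_vec d z i))" by simp
    also have "\<dots> \<le> ?L x + ?L (\<lambda>i. (-1) * (x i - grid_vec d z i))" by (rule L2_set_triangle_ineq)
    also have "\<dots> \<le> 9/8" unfolding L2_set_scale using x e8 by simp
    finally show ?thesis .
  qed
  have "(\<Sum>i<d. (real_of_int (z i))\<^sup>2) / (16 * d) = (?L (grid_vec d z))\<^sup>2"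
    by (simp add: L2_set_def sum_nonneg grid_vec_def power_divide power_mult_distrib sum_divide_distrib)
  also have "\<dots> \<le> (9/8)\<^sup>2" using Lg by (intro power_mono) auto
  finally have "(\<Sum>i<d. (real_of_int (z i))\<^sup>2) \<le> 21 * real d" using d by (simp add: power2_eq_square field_simps)
  then have "real_of_int (\<Sum>i<d. (z i)\<^sup>2) \<le> real_of_int (21 * int d)" by simp
  then have sumz: "(\<Sum>i<d. (z i)\<^sup>2) \<le> 21 * int d" by (simp only: of_int_le_iff)
  \<comment> \<open>A single coordinate is at most \<open>sqrt (21 d) \<le> 5 d\<close>, so the box
    does not cut off the rounded vector.\<close>
  have "\<bar>z i\<bar> \<le> int (5 * d)" if "i < d" for i
  proof -
    have "(z i)\<^sup>2 \<le> (\<Sum>i<d. (z i)\<^sup>2)" using that by (intro member_le_sum) auto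
    also have "\<dots> \<le> 21 * int d" by (rule sumz)
    also have "\<dots> \<le> (int (5 * d))\<^sup>2"
    proof -
      have "1 * int d \<le> int d * int d" using d by (intro mult_right_mono) auto
      then show ?thesis by (simp add: power2_eq_square)
    qed
    finally have "\<bar>z i\<bar>\<^sup>2 \<le> (int (5 * d))\<^sup>2" by simp
    then show ?thesis by (rule power2_le_imp_le) simp
  qed
  then have "- int (5 * d) \<le> z i \<and> z i \<le> int (5 * d)" if "i < d" for i using that by fastforce
  then have "z \<in> grid d" using sumz by (auto simp: grid_def z_def)
  then show ?thesis using e8 by blast
qed

text \<open>Hoeffding's lemma for a centred variable in an interval of length 3, which gives
  \<open>(3 s)^2 / 8\<close>. For \<open>s \<ge> 0\<close> the parameter is \<open>3 s\<close> with
  probability 1/3 of the upper value; for \<open>s < 0\<close> it is \<open>- 3 s\<close> with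
  probability 2/3 of the lower value.\<close>

lemma ref_mgf:
  "pmf_mean (bernoulli_pmf (1/3)) (\<lambda>b. exp (s * ref_val e b)) \<le> exp (9 * s\<^sup>2 / 8)"
proof -
  have E: "pmf_mean (bernoulli_pmf (1/3)) (\<lambda>b. exp (s * ref_val e b)) = exp (2 * s) / 3 + exp (- s) * 2 / 3"
    by (simp add: ref_val_def mult.commute)
  show ?thesis
  proof (cases "s \<ge> 0")
    case True
    have pos: "1 + (1/3) * (exp (3 * s) - 1) > 0" using exp_gt_zero[of "3 * s"] by (simp add: field_simps add_pos_pos)
    have "- (3 * s) * (1/3) + ln (1 + (1/3) * (exp (3 * s) - 1)) \<le> (3 * s)\<^sup>2 / 8"
      by (rule Hoeffdings_lemma_aux) (use True in auto)
    then have "exp (- (3 * s) * (1/3) + ln (1 + (1/3) * (exp (3 * s) - 1))) \<le> exp ((3 * s)\<^sup>2 / 8)" by (simp only: exp_le_cancel_iff)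
    moreover have "exp (- (3 * s) * (1/3) + ln (1 + (1/3) * (exp (3 * s) - 1))) = exp (- s) * (1 + (1/3) * (exp (3 * s) - 1))"
      unfolding exp_add exp_ln[OF pos] by simp
    moreover have "exp (- s) * (1 + (1/3) * (exp (3 * s) - 1)) = exp (2 * s) / 3 + exp (- s) * 2 / 3"
    proof -
      have "exp (- s) * exp (3 * s) = exp (2 * s)" by (simp add: exp_add[symmetric])
      then show ?thesis by (simp add: algebra_simps)
    qed
    ultimately have "exp (2 * s) / 3 + exp (- s) * 2 / 3 \<le> exp ((3 * s)\<^sup>2 / 8)" by linarith
    then show ?thesis unfolding E by (simp add: power_mult_distrib)
  next
    case False
    have pos: "1 + (2/3) * (exp (- 3 * s) - 1) > 0" using exp_gt_zero[of "- 3 * s"] by (simp add: field_simps add_pos_pos)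
    have "- (- 3 * s) * (2/3) + ln (1 + (2/3) * (exp (- 3 * s) - 1)) \<le> (- 3 * s)\<^sup>2 / 8"
      by (rule Hoeffdings_lemma_aux) (use False in auto)
    then have "exp (- (- 3 * s) * (2/3) + ln (1 + (2/3) * (exp (- 3 * s) - 1))) \<le> exp ((- 3 * s)\<^sup>2 / 8)" by (simp only: exp_le_cancel_iff)
    moreover have "exp (- (- 3 * s) * (2/3) + ln (1 + (2/3) * (exp (- 3 * s) - 1))) = exp (2 * s) * (1 + (2/3) * (exp (- 3 * s) - 1))"
      unfolding exp_add exp_ln[OF pos] by simp
    moreover have "exp (2 * s) * (1 + (2/3) * (exp (- 3 * s) - 1)) = exp (2 * s) / 3 + exp (- s) * 2 / 3"
    proof -
      have "exp (2 * s) * exp (- 3 * s) = exp (- s)" by (simp add: exp_add[symmetric])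
      then show ?thesis by (simp add: algebra_simps)
    qed
    ultimately have "exp (2 * s) / 3 + exp (- s) * 2 / 3 \<le> exp ((- 3 * s)\<^sup>2 / 8)" by linarith
    then show ?thesis unfolding E by (simp add: power_mult_distrib)
  qed
qed

section \<open>Norm and trace of the reference matrix\<close>

lemma sum_offdiag:
  fixes h :: "nat \<Rightarrow> nat \<Rightarrow> real"
  shows "(\<Sum>i<n. \<Sum>j<n. if i = j then 0 else h i j) = (\<Sum>(i,j)\<in>csbm_pairs n. h i j + h j i)"
proof -
  let ?U = "csbm_pairs n" and ?V = "(\<lambda>(i,j). (j,i)) ` csbm_pairs n" and ?D = "(\<lambda>i. (i,i)) ` {..<n}"
  have fin: "finite ?U" by simp
  have S: "{..<n} \<times> {..<n} = (?U \<union> ?V) \<union> ?D" by (auto simp: csbm_pairs_def image_iff)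
  have "(\<Sum>i<n. \<Sum>j<n. if i = j then 0 else h i j) = (\<Sum>(i,j)\<in>{..<n} \<times> {..<n}. if i = j then 0 else h i j)"
    by (rule sum.cartesian_product)
  also have "\<dots> = (\<Sum>(i,j)\<in>?U \<union> ?V. if i = j then 0 else h i j) + (\<Sum>(i,j)\<in>?D. if i = j then 0 else h i j)"
    unfolding S by (rule sum.union_disjoint) (use fin in \<open>auto simp: csbm_pairs_def\<close>)
  also have "(\<Sum>(i,j)\<in>?D. if i = j then 0 else h i j) = 0" by (rule sum.neutral) auto
  also have "(\<Sum>(i,j)\<in>?U \<union> ?V. if i = j then 0 else h i j)
     = (\<Sum>(i,j)\<in>?U. if i = j then 0 else h i j) + (\<Sum>(i,j)\<in>?V. if i = j then 0 else h i j)"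
    by (rule sum.union_disjoint) (use fin in \<open>auto simp: csbm_pairs_def\<close>)
  also have "(\<Sum>(i,j)\<in>?V. if i = j then 0 else h i j) = (\<Sum>(i,j)\<in>?U. if i = j then 0 else h j i)"
    by (subst sum.reindex) (auto simp: inj_on_def case_prod_unfold intro!: sum.cong)
  also have "(\<Sum>(i,j)\<in>?U. if i = j then 0 else h i j) + (\<Sum>(i,j)\<in>?U. if i = j then 0 else h j i) + 0
      = (\<Sum>(i,j)\<in>?U. h i j + h j i)"
    unfolding sum.distrib[symmetric] add_0_right by (intro sum.cong refl) (auto simp: csbm_pairs_def)
  finally show ?thesis .
qed

lemma bilinear_sym_of:
  "dotp n x (mat_vec n (sym_of val E) y) = (\<Sum>e\<in>csbm_pairs n. val e (E e) * (x (fst e) * y (snd e) + x (snd e) * y (fst e)))"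
proof -
  have "dotp n x (mat_vec n (sym_of val E) y) = (\<Sum>i<n. \<Sum>j<n. if i = j then 0 else val (pair_of i j) (E (pair_of i j)) * x i * y j)"
    unfolding dotp_def mat_vec_def sum_distrib_left by (intro sum.cong refl) (auto simp: sym_of_def)
  also have "\<dots> = (\<Sum>e\<in>csbm_pairs n. val e (E e) * (x (fst e) * y (snd e) + x (snd e) * y (fst e)))"
    unfolding sum_offdiag
    by (intro sum.cong refl) (auto simp: csbm_pairs_def pair_of_def algebra_simps min_def max_def)
  finally show ?thesis .
qed

text \<open>Each pair enters through both orders of its ends;
  \<open>(a + b)^2 \<le> 2 (a^2 + b^2)\<close> turns the 9/8 of \<open>ref_mgf\<close> into 9/4, and
  the squares then sum over ordered pairs to at most the product of the squared norms.\<close>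

lemma ref_bilinear_mgf:
  "pmf_mean (pairs_pmf d (\<lambda>_. 1/3)) (\<lambda>E. exp (\<theta> * dotp d x (mat_vec d (sym_of ref_val E) y)))
    \<le> exp (9/4 * \<theta>\<^sup>2 * ((vnorm d x)\<^sup>2 * (vnorm d y)\<^sup>2))"
proof -
  let ?c = "\<lambda>e. x (fst e) * y (snd e) + x (snd e) * y (fst e)"
  have "pmf_mean (pairs_pmf d (\<lambda>_. 1/3)) (\<lambda>E. exp (\<theta> * dotp d x (mat_vec d (sym_of ref_val E) y)))
    = pmf_mean (pairs_pmf d (\<lambda>_. 1/3)) (\<lambda>E. \<Prod>e\<in>csbm_pairs d. exp (\<theta> * ?c e * ref_val e (E e)))"
    unfolding bilinear_sym_of sum_distrib_left by (simp add: exp_sum mult_ac)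
  also have "\<dots> = (\<Prod>e\<in>csbm_pairs d. pmf_mean (bernoulli_pmf (1/3)) (\<lambda>b. exp (\<theta> * ?c e * ref_val e b)))"
    unfolding pairs_pmf_def by (rule expectation_prod_Pi_pmf_finite) auto
  also have "\<dots> \<le> (\<Prod>e\<in>csbm_pairs d. exp (9 * (\<theta> * ?c e)\<^sup>2 / 8))"
    by (intro prod_mono conjI ref_mgf integral_nonneg_AE) auto
  also have "\<dots> = exp (\<Sum>e\<in>csbm_pairs d. 9 * (\<theta> * ?c e)\<^sup>2 / 8)" by (simp add: exp_sum)
  also have "(\<Sum>e\<in>csbm_pairs d. 9 * (\<theta> * ?c e)\<^sup>2 / 8) \<le> (\<Sum>e\<in>csbm_pairs d. 9/4 * \<theta>\<^sup>2 *
      ((x (fst e))\<^sup>2 * (y (snd e))\<^sup>2 + (x (snd e))\<^sup>2 * (y (fst e))\<^sup>2))"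
  proof (rule sum_mono)
    fix e
    let ?a = "x (fst e) * y (snd e)" and ?b = "x (snd e) * y (fst e)"
    have "(?a + ?b)\<^sup>2 \<le> 2 * (?a\<^sup>2 + ?b\<^sup>2)" using zero_le_power2[of "?a - ?b"] by (simp add: power2_eq_square algebra_simps)
    then have "9/8 * \<theta>\<^sup>2 * (?a + ?b)\<^sup>2 \<le> 9/8 * \<theta>\<^sup>2 * (2 * (?a\<^sup>2 + ?b\<^sup>2))" by (intro mult_left_mono) auto
    moreover have "9 * (\<theta> * ?c e)\<^sup>2 / 8 = 9/8 * \<theta>\<^sup>2 * (?a + ?b)\<^sup>2" by (simp add: power_mult_distrib)
    moreover have "9/8 * \<theta>\<^sup>2 * (2 * (?a\<^sup>2 + ?b\<^sup>2)) = 9/4 * \<theta>\<^sup>2 * ((x (fst e))\<^sup>2 * (y (snd e))\<^sup>2 + (x (snd e))\<^sup>2 * (y (fst e))\<^sup>2)"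
      by (simp add: power_mult_distrib)
    ultimately show "9 * (\<theta> * ?c e)\<^sup>2 / 8 \<le> 9/4 * \<theta>\<^sup>2 * ((x (fst e))\<^sup>2 * (y (snd e))\<^sup>2 + (x (snd e))\<^sup>2 * (y (fst e))\<^sup>2)"
      by linarith
  qed
  also have "\<dots> = 9/4 * \<theta>\<^sup>2 * (\<Sum>(i,j)\<in>csbm_pairs d. (x i)\<^sup>2 * (y j)\<^sup>2 + (x j)\<^sup>2 * (y i)\<^sup>2)"
    by (simp only: sum_distrib_left[symmetric] case_prod_unfold)
  also have "\<dots> = 9/4 * \<theta>\<^sup>2 * (\<Sum>i<d. \<Sum>j<d. if i = j then 0 else (x i)\<^sup>2 * (y j)\<^sup>2)"
    by (simp only: sum_offdiag)
  also have "\<dots> \<le> 9/4 * \<theta>\<^sup>2 * (\<Sum>i<d. \<Sum>j<d. (x i)\<^sup>2 * (y j)\<^sup>2)"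
    by (intro mult_left_mono sum_mono) auto
  also have "\<dots> = 9/4 * \<theta>\<^sup>2 * ((vnorm d x)\<^sup>2 * (vnorm d y)\<^sup>2)"
    by (simp add: L2_set_def sum_nonneg sum_product)
  finally show ?thesis by simp
qed

text \<open>Union bound over pairs of grid points. With \<open>\<theta> = sqrt d\<close> and level
  \<open>52 * sqrt d\<close>, the Chernoff exponent is at most
  \<open>9/4 * (21/16)^2 * d - 52 * d \<le> - 48 * d\<close>, while there are at most
  \<open>exp (46 d)\<close> pairs. The factor 2 of the net argument turns 52 into 104.\<close>

lemma ref_norm_tail:
  assumes d: "d > 0"
  shows "pmf_prob (pairs_pmf d (\<lambda>_. 1/3)) {E. \<not> op_bounded d (sym_of ref_val E) (104 * sqrt d)} \<le> exp (- real d)"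
proof -
  let ?P = "pairs_pmf d (\<lambda>_. 1/3)" and ?v = "grid_vec d"
  let ?q = "\<lambda>E z z'. dotp d (?v z) (mat_vec d (sym_of ref_val E) (?v z'))"
  let ?B = "\<lambda>z z'. {E. ?q E z z' \<ge> 52 * sqrt d}"
  have sub: "{E. \<not> op_bounded d (sym_of ref_val E) (104 * sqrt d)} \<subseteq> (\<Union>(z,z')\<in>grid d \<times> grid d. ?B z z')"
  proof (rule subsetI, rule ccontr)
    fix E assume E: "E \<in> {E. \<not> op_bounded d (sym_of ref_val E) (104 * sqrt d)}"
      and n: "E \<notin> (\<Union>(z,z')\<in>grid d \<times> grid d. ?B z z')"
    have "op_bounded d (sym_of ref_val E) (2 * (52 * sqrt d))"
    proof (rule op_bounded_of_net[where Z="?v ` grid d"])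
      show "dotp d z (mat_vec d (sym_of ref_val E) z') \<le> 52 * sqrt d" if zz: "z \<in> ?v ` grid d" "z' \<in> ?v ` grid d" for z z'
        using n zz by force
    qed (use grid_net[OF d] in auto)
    then show False using E by simp
  qed
  have each: "pmf_prob ?P (?B z z') \<le> exp (- 48 * real d)" if "z \<in> grid d" "z' \<in> grid d" for z z'
  proof -
    let ?\<theta> = "sqrt d"
    have Beq: "?B z z' = {E \<in> space (measure_pmf ?P). exp (?\<theta> * ?q E z z') \<ge> exp (?\<theta> * (52 * sqrt d))}"
      using d by (simp only: exp_le_cancel_iff) simp
    have "pmf_prob ?P (?B z z') \<le> pmf_mean ?P (\<lambda>E. exp (?\<theta> * ?q E z z')) / exp (?\<theta> * (52 * sqrt d))"
      unfolding Beq by (rule integral_Markov_inequality_measure[where A="UNIV"]) (auto intro: integrable_measure_pmf_finite)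
    also have "\<dots> \<le> exp (9/4 * ?\<theta>\<^sup>2 * ((vnorm d (?v z))\<^sup>2 * (vnorm d (?v z'))\<^sup>2)) / exp (?\<theta> * (52 * sqrt d))"
      by (rule divide_right_mono[OF ref_bilinear_mgf]) simp
    also have "\<dots> = exp (9/4 * ?\<theta>\<^sup>2 * ((vnorm d (?v z))\<^sup>2 * (vnorm d (?v z'))\<^sup>2) - ?\<theta> * (52 * sqrt d))"
      by (simp add: exp_diff)
    also have "\<dots> \<le> exp (9/4 * ?\<theta>\<^sup>2 * ((21/16) * (21/16)) - ?\<theta> * (52 * sqrt d))"
      unfolding exp_le_cancel_iff
      by (intro diff_right_mono mult_left_mono mult_mono L2_grid_vec that d) auto
    also have "\<dots> \<le> exp (- 48 * real d)"
    proof -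
      have a: "?\<theta> * (52 * sqrt d) = 52 * real d" by simp
      have b: "?\<theta>\<^sup>2 = real d" by simp
      show ?thesis unfolding a b exp_le_cancel_iff by simp
    qed
    finally show ?thesis .
  qed
  have "pmf_prob ?P {E. \<not> op_bounded d (sym_of ref_val E) (104 * sqrt d)}
      \<le> pmf_prob ?P (\<Union>(z,z')\<in>grid d \<times> grid d. ?B z z')"
    by (rule measure_pmf.finite_measure_mono[OF sub]) simp
  also have "\<dots> \<le> (\<Sum>zz\<in>grid d \<times> grid d. pmf_prob ?P (case zz of (z,z') \<Rightarrow> ?B z z'))"
    by (rule measure_pmf.finite_measure_subadditive_finite) auto
  also have "\<dots> \<le> (\<Sum>zz\<in>grid d \<times> grid d. exp (- 48 * real d))"
    using each by (intro sum_mono) auto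
  also have "\<dots> = real (card (grid d)) * real (card (grid d)) * exp (- 48 * real d)" by (simp add: card_cartesian_product)
  also have "\<dots> \<le> exp (23 * real d) * exp (23 * real d) * exp (- 48 * real d)"
    by (intro mult_right_mono mult_mono card_grid) auto
  also have "\<dots> = exp (- 2 * real d)" by (simp add: exp_add[symmetric])
  also have "\<dots> \<le> exp (- real d)" by simp
  finally show ?thesis .
qed

text \<open>On the good event the trace is at most \<open>d\<close> times a power of the norm. Off
  it the crude bound \<open>(2 d)^(2 r)\<close> is compensated by the probability
  \<open>exp (- d)\<close>; \<open>rd\<close> says exactly that the product is at most 1.\<close>

lemma ref_trace:
  assumes d: "d > 0" and r: "r > 0" and rd: "2 * real r * ln (2 * d) \<le> d"
  shows "pmf_mean (pairs_pmf d (\<lambda>_. 1/3))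
      (\<lambda>E. \<Sum>i<d. mat_pow d (sym_of ref_val E) (2 * r) (unit_vec i) i) \<le> 2 * d * (104 * sqrt d) ^ (2 * r)"
proof -
  let ?P = "pairs_pmf d (\<lambda>_. 1/3)"
  let ?tr = "\<lambda>E. \<Sum>i<d. mat_pow d (sym_of ref_val E) (2 * r) (unit_vec i) i"
  let ?good = "\<lambda>E. op_bounded d (sym_of ref_val E) (104 * sqrt d)"
  let ?K = "104 * sqrt d"
  have g: "?tr E \<le> d * ?K ^ (2 * r)" if "?good E" for E
  proof -
    have "?tr E = (\<Sum>i<d. (vnorm d (mat_pow d (sym_of ref_val E) r (unit_vec i)))\<^sup>2)"
      by (rule trace_even_power[OF sym_sym_of])
    also have "\<dots> \<le> (\<Sum>i<d. (?K ^ r)\<^sup>2)"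
    proof (intro sum_mono power_mono L2_set_nonneg)
      fix i assume "i \<in> {..<d}"
      then show "vnorm d (mat_pow d (sym_of ref_val E) r (unit_vec i)) \<le> ?K ^ r"
        using op_bounded_pow[OF that, of r "unit_vec i"] L2_set_unit_vec[of i d] by simp
    qed
    also have "\<dots> = d * ?K ^ (2 * r)"
      by (simp only: sum_constant card_lessThan power_mult[symmetric] mult.commute[of r 2])
    finally show ?thesis .
  qed
  have b: "?tr E \<le> (2 * real d) ^ (2 * r)" for E
  proof -
    have "?tr E = (\<Sum>f\<in>walks (2 * r) d. walk_weight (sym_of ref_val E) (2 * r) f)"
      using r by (intro trace_walks) simp
    also have "\<dots> \<le> (\<Sum>f\<in>walks (2 * r) d. 2 ^ (2 * r))"
    proof (rule sum_mono)
      fix f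
      have "walk_weight (sym_of ref_val E) (2 * r) f \<le> \<bar>walk_weight (sym_of ref_val E) (2 * r) f\<bar>" by simp
      also have "\<dots> \<le> (\<Prod>t<2 * r. 2)"
        unfolding walk_weight_def abs_prod by (intro prod_mono) (auto simp: sym_of_def ref_val_def)
      finally show "walk_weight (sym_of ref_val E) (2 * r) f \<le> 2 ^ (2 * r)" by simp
    qed
    also have "\<dots> = (2 * real d) ^ (2 * r)" by (simp add: card_PiE power_mult_distrib)
    finally show ?thesis .
  qed
  have "pmf_mean ?P ?tr \<le> pmf_mean ?P (\<lambda>E. d * ?K ^ (2 * r) + (2 * real d) ^ (2 * r) * indicator {E. \<not> ?good E} E)"
    using g b by (intro integral_mono integrable_measure_pmf_finite) (auto simp: indicator_def add_increasing)
  also have "\<dots> = d * ?K ^ (2 * r) + (2 * real d) ^ (2 * r) * pmf_prob ?P {E. \<not> ?good E}"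
    by (subst Bochner_Integration.integral_add) (auto intro: integrable_measure_pmf_finite)
  also have "\<dots> \<le> d * ?K ^ (2 * r) + (2 * real d) ^ (2 * r) * exp (- real d)"
    using ref_norm_tail[OF d] by (intro add_left_mono mult_left_mono) auto
  also have "(2 * real d) ^ (2 * r) * exp (- real d) \<le> 1"
  proof -
    have "(2 * real d) ^ (2 * r) = exp (real (2 * r) * ln (2 * d))"
      unfolding exp_of_nat_mult using d by simp
    then have "(2 * real d) ^ (2 * r) * exp (- real d) = exp (2 * real r * ln (2 * d) - d)"
      by (simp add: exp_diff exp_minus field_simps)
    then show ?thesis using rd by simp
  qed
  also have "1 \<le> d * ?K ^ (2 * r)"
  proof -
    have "1 \<le> sqrt d" using d by simp
    then have "1 \<le> ?K" by linarith
    then have "1 \<le> ?K ^ (2 * r)" by (rule one_le_power)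
    moreover have "1 \<le> real d" using d by simp
    ultimately show ?thesis using mult_mono[of 1 "real d" 1 "?K ^ (2 * r)"] by simp
  qed
  finally show ?thesis by (simp add: mult_ac)
qed

text \<open>Markov's inequality for the trace of order \<open>2 r\<close>, with \<open>r\<close>
  between \<open>ln n\<close> and \<open>2 * ln n\<close>. Here \<open>d \<le> 4 n p\<close> gives
  \<open>104 * sqrt d \<le> 208 * sqrt (n p)\<close>, and the spare factor 9 in
  \<open>1872 = 9 * 208\<close> gives \<open>9^(-2 r) \<le> exp (- 4 r) \<le> n^(-4)\<close>. The
  threshold \<open>n0\<close> is uniform in \<open>p\<close> and \<open>\<pi>\<close>.\<close>

lemma noise_norm_tail:
  "\<exists>n0. \<forall>n\<ge>n0. \<forall>p \<pi>. ln (real n) ^ 3 / n \<le> p \<longrightarrow> p \<le> 1 \<longrightarrow> (\<forall>e. 0 \<le> \<pi> e \<and> \<pi> e \<le> p) \<longrightarrow>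
    pmf_prob (pairs_pmf n \<pi>) {E. \<not> op_bounded n (sym_of (\<lambda>e b. of_bool b - \<pi> e) E) (1872 * sqrt (n * p))} \<le> 8 / real n ^ 3"
proof -
  have "eventually (\<lambda>x::real. 4 * x powr (1/3) * ln (2 * x) \<le> x) at_top" by real_asymp
  then obtain x0 :: real where x0: "\<And>x. x \<ge> x0 \<Longrightarrow> 4 * x powr (1/3) * ln (2 * x) \<le> x"
    by (auto simp: eventually_at_top_linorder)
  have "eventually (\<lambda>n::nat. ln (real n) ^ 3 \<ge> x0 \<and> ln (real n) \<ge> 2 \<and> n > 0) at_top"
    by (intro eventually_conj; real_asymp)
  then obtain n0 where n0: "\<And>n::nat. n \<ge> n0 \<Longrightarrow> ln (real n) ^ 3 \<ge> x0 \<and> ln (real n) \<ge> 2 \<and> n > 0"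
    by (auto simp: eventually_at_top_linorder)
  show ?thesis
  proof (intro exI[of _ n0] allI impI)
    fix n p and \<pi> :: "nat \<times> nat \<Rightarrow> real"
    assume "n \<ge> n0" and p: "ln (real n) ^ 3 / n \<le> p" "p \<le> 1" and \<pi>: "\<forall>e. 0 \<le> \<pi> e \<and> \<pi> e \<le> p"
    then have L3: "ln (real n) ^ 3 \<ge> x0" and L2: "ln (real n) \<ge> 2" and n: "n > 0" using n0 by auto
    let ?L = "ln (real n)" and ?P = "pairs_pmf n \<pi>"
    let ?M = "sym_of (\<lambda>e b. of_bool b - \<pi> e)"
    let ?K = "1872 * sqrt (n * p)"
    have np: "?L ^ 3 \<le> p * n" using p(1) n by (simp add: field_simps)
    have p0: "p > 0" using np L2 n by (smt (verit) zero_less_power zero_less_mult_pos2 of_nat_0_less_iff)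
    \<comment> \<open>\<open>op_bounded_of_trace\<close> asks for a power of two; the least one
      above \<open>ln n\<close> is at most \<open>2 * ln n\<close>.\<close>
    define h where "h = (LEAST h. ?L \<le> 2 ^ h)"
    have "\<exists>h. ?L \<le> 2 ^ h" using real_arch_pow[of 2 ?L] by (auto intro: less_imp_le)
    then have h1: "?L \<le> 2 ^ h" unfolding h_def by (rule LeastI_ex)
    have h2: "2 ^ h \<le> 2 * ?L"
    proof (cases h)
      case 0 then show ?thesis using L2 by simp
    next
      case (Suc h')
      then have "\<not> ?L \<le> 2 ^ h'" unfolding h_def by (metis lessI not_less_Least)
      then show ?thesis using Suc by simp
    qed
    define r where "r = (2::nat) ^ h"
    have r: "r > 0" "?L \<le> real r" "real r \<le> 2 * ?L" using h1 h2 by (auto simp: r_def)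
    define d where "d = nat \<lceil>p * n\<rceil> + r"
    have d1: "real d \<ge> p * n + r" unfolding d_def by (simp add: of_nat_ceiling)
    have d2: "real d \<le> p * n + 1 + r"
    proof -
      have "real (nat \<lceil>p * n\<rceil>) \<le> p * n + 1" using p0 by (simp add: of_nat_nat)
      then show ?thesis unfolding d_def by simp
    qed
    have d0: "d > 0" using r by (simp add: d_def)
    have L3': "4 * ?L \<le> ?L ^ 3"
    proof -
      have "2 * 2 \<le> ?L * ?L" using L2 by (intro mult_mono) auto
      then have "(2 * 2) * ?L \<le> (?L * ?L) * ?L" using L2 by (intro mult_right_mono) auto
      then show ?thesis by (simp add: power3_eq_cube)
    qed
    have d3: "real d \<le> 4 * (p * n)" using d2 np r L2 L3' by linarith
    \<comment> \<open>The lower bound on \<open>p\<close> gives \<open>ln n \<le> d^(1/3)\<close>,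
      so \<open>r * ln (2 d)\<close> is of smaller order than \<open>d\<close>; \<open>x0\<close>
      makes this explicit.\<close>
    have rd: "2 * real r * ln (2 * real d) \<le> d"
    proof -
      have Ld: "?L ^ 3 \<le> d" using np d1 r by linarith
      then have "?L \<le> real d powr (1/3)"
      proof -
        have "?L = (?L ^ 3) powr (1/3)" using L2 powr_powr[of ?L 3 "1/3"] powr_realpow[of ?L 3] by simp
        also have "\<dots> \<le> real d powr (1/3)" using Ld L2 by (intro powr_mono2) auto
        finally show ?thesis .
      qed
      then have "2 * real r * ln (2 * real d) \<le> 4 * real d powr (1/3) * ln (2 * real d)"
        using r d0 by (intro mult_right_mono) auto
      also have "\<dots> \<le> d" using x0[of "real d"] Ld L3 by simp
      finally show ?thesis .
    qed
    let ?tr = "\<lambda>E. \<Sum>i<n. mat_pow n (?M E) (2 * r) (unit_vec i) i"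
    have "pmf_mean ?P ?tr \<le> (2 * d * (104 * sqrt d) ^ (2 * r)) / p"
      by (rule order_trans[OF trace_comparison[OF p0 p(2) _ n r(1) d1]])
        (use \<pi> p0 ref_trace[OF d0 r(1) rd] in \<open>auto intro: divide_right_mono\<close>)
    also have "\<dots> \<le> (8 * (p * n) * (208 * sqrt (n * p)) ^ (2 * r)) / p"
    proof -
      have "sqrt d \<le> sqrt (4 * (p * n))" using d3 by simp
      also have "\<dots> = 2 * sqrt (n * p)" by (simp add: real_sqrt_mult mult.commute)
      finally have "104 * sqrt d \<le> 208 * sqrt (n * p)" by simp
      then have "(104 * sqrt d) ^ (2 * r) \<le> (208 * sqrt (n * p)) ^ (2 * r)" by (intro power_mono) auto
      then show ?thesis using d3 p0 by (intro divide_right_mono mult_mono) auto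
    qed
    also have "\<dots> = 8 * n * (208 * sqrt (n * p)) ^ (2 * r)" using p0 by simp
    finally have Etr: "pmf_mean ?P ?tr \<le> 8 * n * (208 * sqrt (n * p)) ^ (2 * r)" .
    have K0: "?K > 0" using p0 n by simp
    have tr0: "?tr E \<ge> 0" for E
      unfolding trace_even_power[OF sym_sym_of] by (intro sum_nonneg) simp
    have "{E. \<not> op_bounded n (?M E) ?K} \<subseteq> {E \<in> space (measure_pmf ?P). ?tr E \<ge> ?K ^ (2 * r)}"
    proof
      fix E assume E: "E \<in> {E. \<not> op_bounded n (?M E) ?K}"
      show "E \<in> {E \<in> space (measure_pmf ?P). ?tr E \<ge> ?K ^ (2 * r)}"
      proof (rule ccontr)
        assume "\<not> ?thesis"
        then have "?tr E \<le> ?K ^ (2 * r)" by simp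
        then have "op_bounded n (?M E) ?K" unfolding r_def using K0 by (intro op_bounded_of_trace[OF sym_sym_of]) auto
        then show False using E by simp
      qed
    qed
    then have "pmf_prob ?P {E. \<not> op_bounded n (?M E) ?K} \<le> pmf_prob ?P {E \<in> space (measure_pmf ?P). ?tr E \<ge> ?K ^ (2 * r)}"
      by (intro measure_pmf.finite_measure_mono) auto
    also have "\<dots> \<le> pmf_mean ?P ?tr / ?K ^ (2 * r)"
      by (rule integral_Markov_inequality_measure[where A="UNIV"])
        (use tr0 K0 in \<open>auto intro: integrable_measure_pmf_finite\<close>)
    also have "\<dots> \<le> (8 * n * (208 * sqrt (n * p)) ^ (2 * r)) / ?K ^ (2 * r)"
      using Etr K0 by (intro divide_right_mono) auto
    also have "\<dots> = 8 * n * (1/9) ^ (2 * r)"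
    proof -
      have "?K = 9 * (208 * sqrt (n * p))" by simp
      then have "?K ^ (2 * r) = 9 ^ (2 * r) * (208 * sqrt (n * p)) ^ (2 * r)" by (simp only: power_mult_distrib)
      then show ?thesis using p0 n by (simp add: power_divide)
    qed
    also have "\<dots> \<le> 8 / real n ^ 3"
    proof -
      have "(exp 1 :: real) ^ 2 \<le> 3 ^ 2" using exp_le by (intro power_mono) auto
      have e2: "exp (2::real) \<le> 9" using \<open>exp 1 ^ 2 \<le> 3 ^ 2\<close> by (simp add: exp_of_nat_mult[symmetric] power2_eq_square exp_add[symmetric])
      have "(1/9::real) ^ (2 * r) \<le> exp (- 2) ^ (2 * r)"
        using e2 by (intro power_mono) (auto simp: exp_minus field_simps)
      also have "\<dots> = exp (- 4 * real r)" by (simp add: exp_of_nat_mult[symmetric])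
      also have "\<dots> \<le> exp (- 4 * ?L)" using r by simp
      also have "\<dots> = 1 / real n ^ 4"
        using n exp_of_nat_mult[of 4 ?L] by (simp add: exp_minus field_simps)
      finally have "8 * real n * (1/9) ^ (2 * r) \<le> 8 * real n * (1 / real n ^ 4)" by (intro mult_left_mono) auto
      also have "\<dots> = 8 / real n ^ 3" using n by (simp add: field_simps eval_nat_numeral)
      finally show ?thesis by simp
    qed
    finally show "pmf_prob ?P {E. \<not> op_bounded n (?M E) ?K} \<le> 8 / real n ^ 3" .
  qed
qed

section \<open>Entries of powers of the noise\<close>

definition cut_mat :: "nat set \<Rightarrow> (nat \<Rightarrow> nat \<Rightarrow> real) \<Rightarrow> nat \<Rightarrow> nat \<Rightarrow> real" where
  "cut_mat W M i j = (if i \<in> W \<or> j \<in> W then 0 else M i j)"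

definition cut_vec :: "nat set \<Rightarrow> (nat \<Rightarrow> real) \<Rightarrow> nat \<Rightarrow> real" where
  "cut_vec W v i = (if i \<in> W then 0 else v i)"

text \<open>Deleted vertices keep their index but get zero rows, columns and entries, so all
  matrices keep the size \<open>n\<close> and the iterate does not see any pair that meets
  \<open>W\<close>.\<close>

definition cut_iter :: "nat \<Rightarrow> (nat \<Rightarrow> nat \<Rightarrow> real) \<Rightarrow> (nat \<Rightarrow> real) \<Rightarrow> nat set \<Rightarrow> nat \<Rightarrow> nat \<Rightarrow> real" where
  "cut_iter n M v W l = mat_pow n (cut_mat W M) l (cut_vec W v)"

lemma cut_iter_in: "i \<in> W \<Longrightarrow> cut_iter n M v W l i = 0"
  unfolding cut_iter_def by (cases l) (auto simp: mat_vec_def cut_mat_def cut_vec_def)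

lemma cut_iter_empty: "cut_iter n M v {} l = mat_pow n M l v"
proof -
  have "cut_mat {} M = M" "cut_vec {} v = v" by (auto simp: cut_mat_def cut_vec_def fun_eq_iff)
  then show ?thesis by (simp add: cut_iter_def)
qed

lemma op_bounded_cut:
  assumes "op_bounded n M K" "K \<ge> 0" shows "op_bounded n (cut_mat W M) K"
  unfolding op_bounded_def
proof
  fix x
  have cut_le: "vnorm n (cut_vec W y) \<le> vnorm n y" for y
  proof -
    have "vnorm n (cut_vec W y) = vnorm n (\<lambda>i. \<bar>cut_vec W y i\<bar>)" by (simp add: L2_set_def)
    also have "\<dots> \<le> vnorm n (\<lambda>i. \<bar>y i\<bar>)" by (rule L2_set_mono) (auto simp: cut_vec_def)
    also have "\<dots> = vnorm n y" by (simp add: L2_set_def)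
    finally show ?thesis .
  qed
  have "mat_vec n (cut_mat W M) x = cut_vec W (mat_vec n M (cut_vec W x))"
    by (auto simp: fun_eq_iff mat_vec_def cut_mat_def cut_vec_def intro!: sum.cong)
  then have "vnorm n (mat_vec n (cut_mat W M) x) \<le> vnorm n (mat_vec n M (cut_vec W x))"
    using cut_le by simp
  also have "\<dots> \<le> K * vnorm n (cut_vec W x)" by (rule op_boundedD[OF assms(1)])
  also have "\<dots> \<le> K * vnorm n x" using cut_le assms(2) by (intro mult_left_mono) auto
  finally show "vnorm n (mat_vec n (cut_mat W M) x) \<le> K * vnorm n x" .
qed

text \<open>Decomposing the walks from \<open>i\<close> at their last visit to \<open>i\<close> turns an entry of a power of a matrix
  into products of a return weight, controlled by the operator norm, and of row \<open>i\<close> against an iterate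
  of the matrix with row and column \<open>i\<close> deleted.\<close>

lemma cut_iter_bound:
  assumes op: "op_bounded n M \<kappa>" and \<kappa>: "0 \<le> \<kappa>" "4 * \<kappa> \<le> b" and b: "b \<ge> 0" and v: "\<And>i. \<bar>v i\<bar> \<le> 1"
    and row: "\<And>W i l. W \<subseteq> {..<n} \<Longrightarrow> card W \<le> k \<Longrightarrow> i \<in> W \<Longrightarrow> l < k \<Longrightarrow>
      (\<forall>j<n. \<bar>cut_iter n M v W l j\<bar> \<le> b ^ l) \<Longrightarrow> \<bar>\<Sum>j<n. M i j * cut_iter n M v W l j\<bar> \<le> b ^ l * (b / 4)"
    and W: "W \<subseteq> {..<n}" "card W + j \<le> k" and i: "i < n"
  shows "\<bar>cut_iter n M v W j i\<bar> \<le> b ^ j"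
  using W i
\<comment> \<open>Each use of the induction hypothesis adds one deleted vertex and shortens the walk
  by at least one step, which preserves \<open>card W + j \<le> k\<close>.\<close>
proof (induction j arbitrary: W i rule: less_induct)
  case (less j)
  show ?case
  proof (cases "i \<in> W \<or> j = 0")
    case True
    then show ?thesis using b v by (auto simp: cut_iter_in) (auto simp: cut_iter_def cut_vec_def)
  next
    case False
    then have iW: "i \<notin> W" and j: "j > 0" by auto
    let ?W = "insert i W"
    let ?B = "cut_mat W M" and ?B' = "cut_mat ?W M"
    let ?\<rho> = "\<lambda>u. \<Sum>m<n. ?B i m * u m"
    let ?z = "\<lambda>t. ?\<rho> (cut_iter n M v ?W (j - 1 - t)) * mat_pow n ?B t (unit_vec i) i"
    have finW: "finite W" using less.prems(1) finite_subset by blast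
    have opB: "op_bounded n ?B \<kappa>" by (rule op_bounded_cut[OF op \<kappa>(1)])
    have diag: "\<bar>mat_pow n ?B t (unit_vec i) i\<bar> \<le> \<kappa> ^ t" for t
      using L2_member[OF less.prems(3), of "mat_pow n ?B t (unit_vec i)"]
        op_bounded_pow[OF opB \<kappa>(1), of t "unit_vec i"] L2_set_unit_vec[OF less.prems(3)] by simp
    have exit: "mat_pow n ?B j (cut_vec ?W v) = (\<lambda>m. mat_pow n ?B' j (cut_vec ?W v) m
      + (\<Sum>t<j. ?\<rho> (mat_pow n ?B' (j - 1 - t) (cut_vec ?W v)) * mat_pow n ?B t (unit_vec i) m))"
    proof (rule first_exit)
      fix u m assume u: "u i = (0::real)"
      show "mat_vec n ?B u m = mat_vec n ?B' u m + ?\<rho> u * unit_vec i m"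
      proof (cases "m = i")
        case True
        then show ?thesis by (simp add: mat_vec_def cut_mat_def unit_vec_def)
      next
        case False
        then show ?thesis using u
          by (auto simp: mat_vec_def cut_mat_def unit_vec_def intro!: sum.cong)
      qed
    next
      show "mat_vec n ?B' u i = 0" for u by (simp add: mat_vec_def cut_mat_def)
    qed (simp add: cut_vec_def)
    \<comment> \<open>The value of \<open>v\<close> at \<open>i\<close> itself accounts for the
      walks whose last visit to \<open>i\<close> is at their end.\<close>
    have split: "cut_vec W v = (\<lambda>m. cut_vec ?W v m + v i * unit_vec i m)"
      using iW by (auto simp: cut_vec_def unit_vec_def fun_eq_iff)
    have "cut_iter n M v W j i = mat_pow n ?B j (cut_vec ?W v) i + v i * mat_pow n ?B j (unit_vec i) i"
      unfolding cut_iter_def by (subst split) (simp only: mat_pow_lin)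
    also have "mat_pow n ?B j (cut_vec ?W v) i
       = (\<Sum>t<j. ?z t)"
      using cut_iter_in[of i ?W n M v j] unfolding exit cut_iter_def by simp
    finally have eq: "cut_iter n M v W j i = (\<Sum>t<j. ?z t)
       + v i * mat_pow n ?B j (unit_vec i) i" .
    have \<rho>: "\<bar>?\<rho> (cut_iter n M v ?W l)\<bar> \<le> b ^ l * (b / 4)" if l: "l < j" for l
    proof -
      have "?\<rho> (cut_iter n M v ?W l) = (\<Sum>m<n. M i m * cut_iter n M v ?W l m)"
      proof (intro sum.cong refl)
        fix m
        show "?B i m * cut_iter n M v ?W l m = M i m * cut_iter n M v ?W l m"
          using iW cut_iter_in[of m ?W n M v l] by (auto simp: cut_mat_def)
      qed
      also have "\<bar>\<dots>\<bar> \<le> b ^ l * (b / 4)"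
      proof (rule row)
        show "?W \<subseteq> {..<n}" using less.prems by auto
        show "card ?W \<le> k" using less.prems(2) iW finW j by simp
        show "l < k" using l less.prems(2) by simp
        show "\<forall>j<n. \<bar>cut_iter n M v ?W l j\<bar> \<le> b ^ l"
          using less.prems l iW finW by (intro allI impI less.IH) auto
      qed simp
      finally show ?thesis .
    qed
    have "\<bar>cut_iter n M v W j i\<bar> \<le> (\<Sum>t<j. \<bar>?z t\<bar>)
       + \<bar>v i * mat_pow n ?B j (unit_vec i) i\<bar>"
      unfolding eq by (rule order_trans[OF abs_triangle_ineq add_right_mono[OF sum_abs]])
    \<comment> \<open>A return of length \<open>t\<close> weighs at most \<open>(b/4)^t\<close>
      because \<open>4 * \<kappa> \<le> b\<close>. With the factor 1/4 of the row the series sums to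
      at most \<open>b^j / 3\<close>, which leaves room for the walks that end at
      \<open>i\<close>.\<close>
    also have "\<dots> \<le> (\<Sum>t<j. b ^ j / 4 * (1/4) ^ t) + b ^ j * (1/4)"
    proof (intro add_mono sum_mono)
      fix t assume "t \<in> {..<j}"
      then have t: "t < j" by simp
      have "\<bar>?z t\<bar> \<le> (b ^ (j - 1 - t) * (b / 4)) * (b / 4) ^ t"
        unfolding abs_mult
      proof (rule mult_mono)
        show "\<bar>?\<rho> (cut_iter n M v ?W (j - 1 - t))\<bar> \<le> b ^ (j - 1 - t) * (b / 4)" using t by (intro \<rho>) simp
        have "\<kappa> ^ t \<le> (b / 4) ^ t" using \<kappa> by (intro power_mono) auto
        then show "\<bar>mat_pow n ?B t (unit_vec i) i\<bar> \<le> (b / 4) ^ t" using diag[of t] by linarith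
      qed (use b in auto)
      also have "\<dots> = (b ^ (j - 1 - t) * b * b ^ t) / 4 * (1/4) ^ t"
        using power_mult_distrib[of b "1/4" t] by simp
      also have "b ^ (j - 1 - t) * b * b ^ t = b ^ j"
      proof -
        have "j = (j - 1 - t) + 1 + t" using t by simp
        then show ?thesis by (metis power_add power_one_right)
      qed
      finally show "\<bar>?z t\<bar> \<le> b ^ j / 4 * (1/4) ^ t" .
    next
      have "\<bar>v i * mat_pow n ?B j (unit_vec i) i\<bar> \<le> 1 * \<kappa> ^ j"
        unfolding abs_mult using v diag by (intro mult_mono) auto
      also have "\<dots> \<le> (b / 4) ^ j" using \<kappa> by (simp add: power_mono)
      also have "\<dots> = b ^ j * (1/4) ^ j" using power_mult_distrib[of b "1/4" j] by simp
      also have "\<dots> \<le> b ^ j * (1/4) ^ 1" using b j by (intro mult_left_mono power_decreasing) auto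
      finally show "\<bar>v i * mat_pow n ?B j (unit_vec i) i\<bar> \<le> b ^ j * (1/4)" by simp
    qed
    also have "(\<Sum>t<j. b ^ j / 4 * (1/4) ^ t) = b ^ j / 4 * (\<Sum>t<j. (1/4) ^ t)" by (simp only: sum_distrib_left)
    also have "\<dots> \<le> b ^ j / 4 * (4/3)"
    proof (rule mult_left_mono)
      have "(\<Sum>t<j. (1/4::real) ^ t) = (1 - (1/4) ^ j) / (1 - 1/4)" by (subst sum_gp_strict) auto
      then show "(\<Sum>t<j. (1/4::real) ^ t) \<le> 4/3" by simp
    qed (use b in simp)
    also have "b ^ j / 4 * (4/3) + b ^ j * (1/4) \<le> b ^ j"
      using zero_le_power[OF b, of j] by linarith
    finally show ?thesis by simp
  qed
qed

section \<open>Concentration of one row of the noise\<close>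

lemma exp_le_quadratic: fixes x :: real assumes "\<bar>x\<bar> \<le> 1" shows "exp x \<le> 1 + x + x\<^sup>2"
proof (cases "x \<ge> 0")
  case True
  then show ?thesis using assms by (intro exp_bound) auto
next
  case False
  define y where "y = - x"
  have y: "0 < y" "y \<le> 1" using False assms by (auto simp: y_def)
  \<comment> \<open>The product equals \<open>1 + y^3\<close>.\<close>
  have "1 \<le> (1 - y + y\<^sup>2) * (1 + y)" using y by (simp add: algebra_simps power2_eq_square)
  also have "\<dots> \<le> (1 - y + y\<^sup>2) * exp y" using y exp_ge_add_one_self[of y] by (intro mult_left_mono) (auto simp: add_increasing2)
  finally have "exp (- y) \<le> 1 - y + y\<^sup>2" by (simp add: exp_minus field_simps)
  then show ?thesis by (simp add: y_def)
qed

text \<open>From \<open>1 + y \<le> exp y\<close> and \<open>exp x - 1 - x \<le> x^2\<close>.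
  Restricting to \<open>\<bar>x\<bar> \<le> 1\<close> keeps the factor \<open>p\<close> in the
  exponent, where Hoeffding's lemma would give a constant, too large for sparse graphs.\<close>

lemma bernoulli_mgf:
  fixes q x :: real
  assumes "0 \<le> q" "q \<le> p" "p \<le> 1" "\<bar>x\<bar> \<le> 1"
  shows "pmf_mean (bernoulli_pmf q) (\<lambda>b. exp (x * (of_bool b - q))) \<le> exp (p * x\<^sup>2)"
proof -
  have "pmf_mean (bernoulli_pmf q) (\<lambda>b. exp (x * (of_bool b - q))) = exp (- (x * q)) * (1 + q * (exp x - 1))"
    using assms by (simp add: algebra_simps exp_diff exp_minus field_simps)
  also have "\<dots> \<le> exp (- (x * q)) * exp (q * (exp x - 1))"
    by (intro mult_left_mono exp_ge_add_one_self) auto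
  also have "\<dots> = exp (q * (exp x - 1 - x))" by (simp add: exp_add[symmetric] algebra_simps)
  also have "\<dots> \<le> exp (p * x\<^sup>2)"
  proof -
    have "q * (exp x - 1 - x) \<le> q * x\<^sup>2" using exp_le_quadratic[OF assms(4)] assms(1) by (intro mult_left_mono) auto
    also have "\<dots> \<le> p * x\<^sup>2" using assms by (intro mult_right_mono) auto
    finally show ?thesis by simp
  qed
  finally show ?thesis .
qed

text \<open>Fubini: the coordinates in \<open>A\<close> are frozen at an arbitrary \<open>g\<close>,
  and only the randomness of \<open>B\<close> is used.\<close>

lemma Pi_pmf_conditional_bound:
  assumes fin: "finite A" "finite B" and dis: "A \<inter> B = {}" and c: "c \<ge> 0"
    and le: "\<And>g. pmf_prob (Pi_pmf B d P) {f. Q (\<lambda>x. if x \<in> A then g x else f x)} \<le> c"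
  shows "pmf_prob (Pi_pmf (A \<union> B) d P) {h. Q h} \<le> c"
proof -
  let ?h = "\<lambda>(f, g) x. if x \<in> A then f x else g x"
  have "emeasure (measure_pmf (Pi_pmf (A \<union> B) d P)) {h. Q h}
      = emeasure (measure_pmf (pair_pmf (Pi_pmf A d P) (Pi_pmf B d P))) (?h -` {h. Q h})"
    unfolding Pi_pmf_union[OF fin dis] by simp
  also have "\<dots> = (\<integral>\<^sup>+x. indicator (?h -` {h. Q h}) x \<partial>pair_pmf (Pi_pmf A d P) (Pi_pmf B d P))"
    by simp
  also have "\<dots> = (\<integral>\<^sup>+g. \<integral>\<^sup>+f. indicator (?h -` {h. Q h}) (g, f) \<partial>Pi_pmf B d P \<partial>Pi_pmf A d P)"
    by (rule nn_integral_pair_pmf')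
  also have "\<dots> \<le> (\<integral>\<^sup>+g. ennreal c \<partial>Pi_pmf A d P)"
  proof (rule nn_integral_mono)
    fix g
    have "(\<integral>\<^sup>+f. indicator (?h -` {h. Q h}) (g, f) \<partial>Pi_pmf B d P)
      = (\<integral>\<^sup>+f. indicator {f. Q (\<lambda>x. if x \<in> A then g x else f x)} f \<partial>Pi_pmf B d P)"
      by (intro nn_integral_cong) (auto simp: indicator_def)
    also have "\<dots> = emeasure (Pi_pmf B d P) {f. Q (\<lambda>x. if x \<in> A then g x else f x)}" by simp
    also have "\<dots> \<le> ennreal c" unfolding measure_pmf.emeasure_eq_measure using le by (intro ennreal_leI)
    finally show "(\<integral>\<^sup>+f. indicator (?h -` {h. Q h}) (g, f) \<partial>Pi_pmf B d P) \<le> ennreal c" .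
  qed
  also have "\<dots> = ennreal c" by simp
  finally show ?thesis unfolding measure_pmf.emeasure_eq_measure using c by simp
qed

text \<open>The diagonal \<open>- p\<close> makes the decomposition exact although
  \<open>adj\<close> vanishes on the diagonal:
  \<open>- d/n = - p + (p - q)/2 + ((p + q)/2 - d/n)\<close>.\<close>

definition noise_mat :: "(nat \<times> nat \<Rightarrow> real) \<Rightarrow> real \<Rightarrow> (nat \<times> nat \<Rightarrow> bool) \<Rightarrow> nat \<Rightarrow> nat \<Rightarrow> real" where
  "noise_mat \<pi> p E i j = (if i = j then - p else of_bool (E (pair_of i j)) - \<pi> (pair_of i j))"

lemma sym_noise_mat: "sym_mat (noise_mat \<pi> p E)"
  by (auto simp: sym_mat_def noise_mat_def pair_of_commute)

text \<open>Chernoff's bound with \<open>\<theta> = sqrt (L / (n p)) / \<beta>\<close>: the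
  logarithm of the moment generating function is at most \<open>L\<close>, and
  \<open>\<theta>\<close> times the level is \<open>2 L\<close>. \<open>L \<le> n p\<close> gives
  \<open>\<theta> * \<beta> \<le> 1\<close>, the range of \<open>bernoulli_mgf\<close>;
  \<open>u i = 0\<close> removes the diagonal entry.\<close>

lemma row_chernoff:
  fixes p \<beta> L :: real and u :: "nat \<Rightarrow> real"
  assumes i: "i < n" and \<pi>: "\<And>e. 0 \<le> \<pi> e \<and> \<pi> e \<le> p" and p: "p \<le> 1" and np: "0 < L" "L \<le> n * p" and \<beta>: "\<beta> > 0"
    and u: "\<And>j. j < n \<Longrightarrow> \<bar>u j\<bar> \<le> \<beta>" "u i = 0" and sg: "sg = 1 \<or> sg = (-1::real)"
  defines "B \<equiv> pair_of i ` ({..<n} - {i})"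
  shows "pmf_prob (Pi_pmf B False (\<lambda>e. bernoulli_pmf (\<pi> e)))
     {f. sg * (\<Sum>j<n. noise_mat \<pi> p f i j * u j) \<ge> 2 * \<beta> * sqrt (L * (n * p))} \<le> exp (- L)"
proof -
  let ?J = "{..<n} - {i}"
  let ?P = "Pi_pmf B False (\<lambda>e. bernoulli_pmf (\<pi> e))"
  let ?X = "\<lambda>f. sg * (\<Sum>j<n. noise_mat \<pi> p f i j * u j)"
  let ?\<tau> = "2 * \<beta> * sqrt (L * (n * p))"
  \<comment> \<open>A left inverse of \<open>pair_of i\<close>: the end other than
    \<open>i\<close>.\<close>
  define oth where "oth e = (if fst e = i then snd e else fst e)" for e :: "nat \<times> nat"
  have oth: "oth (pair_of i j) = j" for j by (auto simp: oth_def pair_of_def min_def max_def)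
  have inj: "inj_on (pair_of i) ?J" by (rule inj_on_inverseI[of _ oth]) (rule oth)
  have finB: "finite B" by (simp add: B_def)
  define \<theta> where "\<theta> = sqrt (L / (n * p)) / \<beta>"
  have np0: "n * p > 0" using np by linarith
  have \<theta>: "\<theta> > 0" using np np0 \<beta> by (simp add: \<theta>_def)
  have \<theta>\<beta>: "\<theta> * \<beta> \<le> 1" using np np0 \<beta> by (simp add: \<theta>_def)
  have sg2: "sg\<^sup>2 = 1" "\<bar>sg\<bar> = 1" using sg by auto
  have X: "?X f = (\<Sum>e\<in>B. sg * u (oth e) * (of_bool (f e) - \<pi> e))" for f
  proof -
    have "(\<Sum>j<n. noise_mat \<pi> p f i j * u j) = (\<Sum>j\<in>?J. noise_mat \<pi> p f i j * u j)"
      using i u(2) by (intro sum.mono_neutral_right) auto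
    also have "\<dots> = (\<Sum>j\<in>?J. u (oth (pair_of i j)) * (of_bool (f (pair_of i j)) - \<pi> (pair_of i j)))"
      by (intro sum.cong refl) (auto simp: noise_mat_def oth)
    also have "\<dots> = (\<Sum>e\<in>B. u (oth e) * (of_bool (f e) - \<pi> e))"
      unfolding B_def by (simp add: sum.reindex[OF inj])
    finally show ?thesis by (simp add: sum_distrib_left mult.assoc)
  qed
  have uo: "\<bar>u (oth e)\<bar> \<le> \<beta>" if "e \<in> B" for e using that u(1) oth by (auto simp: B_def)
  let ?F = "\<lambda>e. pmf_mean (bernoulli_pmf (\<pi> e)) (\<lambda>b. exp (\<theta> * sg * u (oth e) * (of_bool b - \<pi> e)))"
  have "pmf_mean ?P (\<lambda>f. exp (\<theta> * ?X f))
     = pmf_mean ?P (\<lambda>f. \<Prod>e\<in>B. exp (\<theta> * sg * u (oth e) * (of_bool (f e) - \<pi> e)))"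
    unfolding X by (simp add: sum_distrib_left exp_sum finB mult.assoc)
  also have "\<dots> = (\<Prod>e\<in>B. ?F e)"
    by (rule expectation_prod_Pi_pmf_finite[OF finB]) auto
  also have "\<dots> \<le> (\<Prod>e\<in>B. exp (p * (\<theta> * \<beta>)\<^sup>2))"
  proof (intro prod_mono conjI)
    fix e assume e: "e \<in> B"
    show "0 \<le> ?F e"
      by (intro integral_nonneg_AE) auto
    have x: "\<bar>\<theta> * sg * u (oth e)\<bar> \<le> \<theta> * \<beta>" using uo[OF e] \<theta> by (simp add: abs_mult sg2 mult_left_mono)
    have "?F e
       \<le> exp (p * (\<theta> * sg * u (oth e))\<^sup>2)"
      using \<pi> p x \<theta>\<beta> by (intro bernoulli_mgf) auto
    also have "\<dots> \<le> exp (p * (\<theta> * \<beta>)\<^sup>2)"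
    proof -
      have "\<bar>\<theta> * sg * u (oth e)\<bar>\<^sup>2 \<le> (\<theta> * \<beta>)\<^sup>2" using x by (intro power_mono) auto
      moreover have "p \<ge> 0" using \<pi>[of undefined] by linarith
      ultimately show ?thesis by (simp add: mult_left_mono)
    qed
    finally show "?F e
       \<le> exp (p * (\<theta> * \<beta>)\<^sup>2)" .
  qed
  also have "\<dots> = exp (real (card B) * (p * (\<theta> * \<beta>)\<^sup>2))" by (simp add: exp_of_nat_mult)
  also have "\<dots> \<le> exp (real n * (p * (\<theta> * \<beta>)\<^sup>2))"
  proof -
    have "card B \<le> card {..<n}" unfolding B_def by (rule order_trans[OF card_image_le card_mono]) auto
    moreover have "p \<ge> 0" using \<pi>[of undefined] by linarith
    ultimately show ?thesis by (simp add: mult_right_mono)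
  qed
  also have "real n * (p * (\<theta> * \<beta>)\<^sup>2) = L"
  proof -
    have "(\<theta> * \<beta>)\<^sup>2 = L / (n * p)" using \<beta> np np0 by (simp add: \<theta>_def)
    then show ?thesis using np0 by (auto simp: zero_less_mult_iff)
  qed
  finally have E: "pmf_mean ?P (\<lambda>f. exp (\<theta> * ?X f)) \<le> exp L" .
  have \<theta>\<tau>: "\<theta> * ?\<tau> = 2 * L"
  proof -
    have "\<theta> * ?\<tau> = 2 * (sqrt (L / (n * p)) * sqrt (L * (n * p)))" using \<beta> by (simp add: \<theta>_def)
    also have "sqrt (L / (n * p)) * sqrt (L * (n * p)) = sqrt (L * L)"
      unfolding real_sqrt_mult[symmetric] using np0 by (auto simp: zero_less_mult_iff)
    finally show ?thesis using np by simp
  qed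
  have fin: "finite (set_pmf ?P)" by (subst set_Pi_pmf[OF finB]) (intro finite_PiE_dflt finB, auto)
  have eq: "{f. ?X f \<ge> ?\<tau>} = {f \<in> space (measure_pmf ?P). exp (\<theta> * ?X f) \<ge> exp (\<theta> * ?\<tau>)}"
    using \<theta> by (simp only: exp_le_cancel_iff) (simp add: mult.assoc)
  have "pmf_prob ?P {f. ?X f \<ge> ?\<tau>} \<le> pmf_mean ?P (\<lambda>f. exp (\<theta> * ?X f)) / exp (\<theta> * ?\<tau>)"
    unfolding eq by (rule integral_Markov_inequality_measure[where A=UNIV]) (auto intro: integrable_measure_pmf_finite[OF fin])
  also have "\<dots> \<le> exp L / exp (\<theta> * ?\<tau>)" using E by (intro divide_right_mono) auto
  also have "\<dots> = exp (- L)" unfolding \<theta>\<tau> by (simp add: exp_diff[symmetric])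
  finally show ?thesis .
qed

lemma cut_iter_cong:
  assumes i: "i \<in> W" and E: "\<And>e. fst e \<noteq> i \<Longrightarrow> snd e \<noteq> i \<Longrightarrow> E e = E' e"
  shows "cut_iter n (noise_mat \<pi> p E) v W l = cut_iter n (noise_mat \<pi> p E') v W l"
proof -
  have "cut_mat W (noise_mat \<pi> p E) = cut_mat W (noise_mat \<pi> p E')"
  proof (intro ext)
    fix a b
    show "cut_mat W (noise_mat \<pi> p E) a b = cut_mat W (noise_mat \<pi> p E') a b"
    proof (cases "a \<in> W \<or> b \<in> W")
      case False
      then have "fst (pair_of a b) \<noteq> i" "snd (pair_of a b) \<noteq> i" using i by (auto simp: pair_of_def min_def max_def)
      then show ?thesis using E[of "pair_of a b"] by (simp add: cut_mat_def noise_mat_def)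
    qed (auto simp: cut_mat_def)
  qed
  then show ?thesis by (simp add: cut_iter_def)
qed

text \<open>As \<open>i \<in> W\<close>, the iterate uses no pair containing \<open>i\<close>: given
  all other pairs it is a fixed vector, independent of row \<open>i\<close>. The bound by
  \<open>\<beta>\<close> depends only on those other pairs, so it can sit inside the event; where it
  fails, the conditional probability is 0.\<close>

lemma row_tail:
  fixes p \<beta> L :: real and v :: "nat \<Rightarrow> real"
  assumes i: "i < n" "i \<in> W" and \<pi>: "\<And>e. 0 \<le> \<pi> e \<and> \<pi> e \<le> p" and p: "p \<le> 1" and np: "0 < L" "L \<le> n * p" and \<beta>: "\<beta> > 0"
  shows "pmf_prob (pairs_pmf n \<pi>)
     {E. (\<forall>j<n. \<bar>cut_iter n (noise_mat \<pi> p E) v W l j\<bar> \<le> \<beta>) \<and>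
        \<bar>\<Sum>j<n. noise_mat \<pi> p E i j * cut_iter n (noise_mat \<pi> p E) v W l j\<bar> \<ge> 2 * \<beta> * sqrt (L * (n * p))} \<le> 2 * exp (- L)"
proof -
  let ?B = "pair_of i ` ({..<n} - {i})"
  let ?A = "csbm_pairs n - ?B"
  let ?u = "\<lambda>E. cut_iter n (noise_mat \<pi> p E) v W l"
  let ?\<tau> = "2 * \<beta> * sqrt (L * (n * p))"
  let ?Q = "\<lambda>E. (\<forall>j<n. \<bar>?u E j\<bar> \<le> \<beta>) \<and> \<bar>\<Sum>j<n. noise_mat \<pi> p E i j * ?u E j\<bar> \<ge> ?\<tau>"
  let ?P = "\<lambda>e. bernoulli_pmf (\<pi> e)"
  have AB: "csbm_pairs n = ?A \<union> ?B" using i by (auto intro: pair_of_in_csbm_pairs)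
  have nB: "fst e = i \<or> snd e = i" if "e \<in> ?B" for e using that by (auto simp: pair_of_def min_def max_def split: if_splits)
  have inB: "e \<in> ?B" if e: "e \<in> csbm_pairs n" "fst e = i \<or> snd e = i" for e
  proof -
    obtain a b where ab: "e = (a, b)" by (cases e)
    have "e = pair_of i (if a = i then b else a)" using e by (auto simp: ab csbm_pairs_def pair_of_def)
    moreover have "(if a = i then b else a) \<in> {..<n} - {i}" using e by (auto simp: ab csbm_pairs_def)
    ultimately show ?thesis by blast
  qed
  have "pmf_prob (Pi_pmf (?A \<union> ?B) False ?P) {E. ?Q E} \<le> 2 * exp (- L)"
  proof (rule Pi_pmf_conditional_bound)
    fix g :: "nat \<times> nat \<Rightarrow> bool"
    let ?h = "\<lambda>f x. if x \<in> ?A then g x else f x"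
    define u where "u = ?u (?h (\<lambda>_. False))"
    have uh: "?u (?h f) = u" if "\<And>e. e \<notin> ?B \<Longrightarrow> f e = False" for f
      unfolding u_def
    proof (rule cut_iter_cong[OF i(2)])
      fix e :: "nat \<times> nat" assume e: "fst e \<noteq> i" "snd e \<noteq> i"
      then have "e \<notin> ?B" using nB by blast
      then show "?h f e = ?h (\<lambda>_. False) e" using that by simp
    qed
    have rowh: "noise_mat \<pi> p (?h f) i j = noise_mat \<pi> p f i j" if "j < n" for f j
      using that by (auto simp: noise_mat_def)
    \<comment> \<open>Outside \<open>?B\<close> the law of \<open>f\<close> has the default value
      \<open>False\<close>. This makes \<open>?h f\<close> and \<open>?h (\<lambda>_. False)\<close>
      agree even at pairs outside \<open>csbm_pairs n\<close>, as \<open>cut_iter_cong\<close>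
      demands.\<close>
    have supp: "f e = False" if "f \<in> set_pmf (Pi_pmf ?B False ?P)" "e \<notin> ?B" for f e
    proof -
      have "f \<in> {f. \<forall>x. x \<notin> ?B \<longrightarrow> f x = False}" using that(1) set_Pi_pmf_subset[of ?B False ?P] by blast
      then show ?thesis using that(2) by blast
    qed
    have Qh: "?Q (?h f) \<longleftrightarrow> (\<forall>j<n. \<bar>u j\<bar> \<le> \<beta>) \<and> \<bar>\<Sum>j<n. noise_mat \<pi> p f i j * u j\<bar> \<ge> ?\<tau>"
      if "f \<in> set_pmf (Pi_pmf ?B False ?P)" for f
      using uh[OF supp[OF that]] rowh by simp
    show "pmf_prob (Pi_pmf ?B False ?P) {f. ?Q (?h f)} \<le> 2 * exp (- L)"
    proof (cases "\<forall>j<n. \<bar>u j\<bar> \<le> \<beta>")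
      case False
      then have "pmf_prob (Pi_pmf ?B False ?P) {f. ?Q (?h f)} = 0"
        using Qh by (intro measure_pmf_zero_iff[THEN iffD2]) blast
      then show ?thesis by simp
    next
      case True
      have ui: "u i = 0" unfolding u_def by (rule cut_iter_in[OF i(2)])
      let ?X = "\<lambda>f. \<Sum>j<n. noise_mat \<pi> p f i j * u j"
      let ?R = "\<lambda>sg. {f. sg * ?X f \<ge> ?\<tau>}"
      have "pmf_prob (Pi_pmf ?B False ?P) {f. ?Q (?h f)} \<le> pmf_prob (Pi_pmf ?B False ?P) (?R 1 \<union> ?R (-1))"
      proof (rule measure_pmf.finite_measure_mono_AE)
        show "AE f in Pi_pmf ?B False ?P. f \<in> {f. ?Q (?h f)} \<longrightarrow> f \<in> ?R 1 \<union> ?R (-1)"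
        proof (rule AE_pmfI, rule impI)
          fix f assume f: "f \<in> set_pmf (Pi_pmf ?B False ?P)" and "f \<in> {f. ?Q (?h f)}"
          then have "?Q (?h f)" by simp
          then have "\<bar>?X f\<bar> \<ge> ?\<tau>" using Qh[OF f] by blast
          then have "1 * ?X f \<ge> ?\<tau> \<or> -1 * ?X f \<ge> ?\<tau>" by (simp add: abs_if split: if_splits)
          then show "f \<in> ?R 1 \<union> ?R (-1)" by blast
        qed
      qed simp
      also have "\<dots> \<le> pmf_prob (Pi_pmf ?B False ?P) (?R 1) + pmf_prob (Pi_pmf ?B False ?P) (?R (-1))"
        by (rule measure_Un_le) auto
      also have "\<dots> \<le> exp (- L) + exp (- L)"
        by (intro add_mono row_chernoff i \<pi> p np \<beta> ui) (use True in auto)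
      finally show ?thesis by simp
    qed
  qed auto
  then show ?thesis unfolding pairs_pmf_def AB[symmetric] .
qed

text \<open>Union bound over a deleted set, a vertex in it and a length. Nonempty sets of size at
  most \<open>k\<close> are coded by lists of length exactly \<open>k\<close> with repetitions,
  which gives \<open>n^k * n * k\<close> events. The bound \<open>8 * sqrt (L * (n * p)) < b\<close>
  puts the row level \<open>2 * b^l * sqrt (L * (n * p))\<close> below the
  \<open>b^l * (b / 4)\<close> required by \<open>cut_iter_bound\<close>.\<close>

lemma entry_tail:
  fixes p b L \<kappa> :: real and v :: "nat \<Rightarrow> real"
  assumes \<pi>: "\<And>e. 0 \<le> \<pi> e \<and> \<pi> e \<le> p" and p: "p \<le> 1" and np: "0 < L" "L \<le> n * p" and n: "n > 0" and k: "k \<ge> 1"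
    and \<kappa>: "0 \<le> \<kappa>" "4 * \<kappa> \<le> b" and b: "b > 0" "8 * sqrt (L * (n * p)) < b" and v: "\<And>i. \<bar>v i\<bar> \<le> 1"
  shows "pmf_prob (pairs_pmf n \<pi>)
     {E. op_bounded n (noise_mat \<pi> p E) \<kappa> \<and> \<not> (\<forall>j\<le>k. \<forall>i<n. \<bar>mat_pow n (noise_mat \<pi> p E) j v i\<bar> \<le> b ^ j)}
   \<le> real n ^ (k + 1) * k * (2 * exp (- L))"
proof -
  let ?Bad = "{E. op_bounded n (noise_mat \<pi> p E) \<kappa> \<and> \<not> (\<forall>j\<le>k. \<forall>i<n. \<bar>mat_pow n (noise_mat \<pi> p E) j v i\<bar> \<le> b ^ j)}"
  let ?P = "pairs_pmf n \<pi>"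
  let ?u = "\<lambda>E W l. cut_iter n (noise_mat \<pi> p E) v W l"
  let ?\<tau> = "\<lambda>l. 2 * b ^ l * sqrt (L * (n * p))"
  let ?I = "({xs. set xs \<subseteq> {..<n} \<and> length xs = k} \<times> {..<n}) \<times> {..<k}"
  let ?D = "\<lambda>((xs, i), l). {E. i \<in> set xs \<and> (\<forall>j<n. \<bar>?u E (set xs) l j\<bar> \<le> b ^ l) \<and>
        \<bar>\<Sum>j<n. noise_mat \<pi> p E i j * ?u E (set xs) l j\<bar> \<ge> ?\<tau> l}"
  have finI: "finite ?I" by (auto intro: finite_lists_length_eq)
  have cardI: "card ?I = n ^ (k + 1) * k" by (simp add: card_cartesian_product card_lists_length_eq)
  have list_of: "\<exists>xs. set xs = W \<and> length xs = k" if W: "W \<subseteq> {..<n}" "card W \<le> k" "i \<in> W" for W i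
  proof -
    obtain ys where ys: "set ys = W" "distinct ys" using finite_distinct_list[of W] W(1) finite_subset by blast
    have "length ys \<le> k" using ys W(2) distinct_card by fastforce
    then have "set (ys @ replicate (k - length ys) i) = W \<and> length (ys @ replicate (k - length ys) i) = k"
      using ys W(3) by (auto simp: set_replicate_conv_if)
    then show ?thesis by blast
  qed
  have sub: "?Bad
     \<subseteq> (\<Union>x\<in>?I. ?D x)"
  proof (rule subsetI, rule ccontr)
    fix E assume E: "E \<in> ?Bad"
      and nD: "E \<notin> (\<Union>x\<in>?I. ?D x)"
    have row: "\<bar>\<Sum>j<n. noise_mat \<pi> p E i j * ?u E W l j\<bar> \<le> b ^ l * (b / 4)"
      if W: "W \<subseteq> {..<n}" "card W \<le> k" "i \<in> W" "l < k" "\<forall>j<n. \<bar>?u E W l j\<bar> \<le> b ^ l" for W i l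
    proof -
      obtain xs where xs: "set xs = W" "length xs = k" using list_of[OF W(1-3)] by blast
      have "((xs, i), l) \<in> ?I" using xs W by auto
      then have "E \<notin> ?D ((xs, i), l)" using nD by blast
      then have "\<bar>\<Sum>j<n. noise_mat \<pi> p E i j * ?u E W l j\<bar> < ?\<tau> l" using xs W by auto
      also have "?\<tau> l \<le> b ^ l * (b / 4)"
      proof -
        have "b ^ l * (2 * sqrt (L * (n * p))) \<le> b ^ l * (b / 4)" using b by (intro mult_left_mono) auto
        then show ?thesis by (simp add: mult_ac)
      qed
      finally show ?thesis by simp
    qed
    have "\<bar>mat_pow n (noise_mat \<pi> p E) j v i\<bar> \<le> b ^ j" if "j \<le> k" "i < n" for j i
    proof -
      have op: "op_bounded n (noise_mat \<pi> p E) \<kappa>" using E by simp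
      have "\<bar>?u E {} j i\<bar> \<le> b ^ j"
        by (rule cut_iter_bound[OF op \<kappa> _ v row]) (use that b in auto)
      then show ?thesis unfolding cut_iter_empty .
    qed
    then show False using E by blast
  qed
  have "pmf_prob ?P ?Bad
     \<le> pmf_prob ?P (\<Union>x\<in>?I. ?D x)"
    by (rule measure_pmf.finite_measure_mono[OF sub]) simp
  also have "\<dots> \<le> (\<Sum>x\<in>?I. pmf_prob ?P (?D x))"
    by (rule measure_pmf.finite_measure_subadditive_finite[OF finI]) auto
  also have "\<dots> \<le> (\<Sum>x\<in>?I. 2 * exp (- L))"
  proof (rule sum_mono)
    fix x assume "x \<in> ?I"
    then obtain xs i l where x: "x = ((xs, i), l)" "i < n" by auto
    show "pmf_prob ?P (?D x) \<le> 2 * exp (- L)"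
    proof (cases "i \<in> set xs")
      case True
      then show ?thesis
        using row_tail[OF x(2) True \<pi> p np, where \<beta>="b ^ l" and v=v and l=l] b by (simp add: x(1))
    qed (simp add: x(1))
  qed
  also have "\<dots> = real n ^ (k + 1) * k * (2 * exp (- L))" using cardI by simp
  finally show ?thesis .
qed

section \<open>Gaussian features\<close>

lemma gauss_mgf:
  assumes \<sigma>: "\<sigma> > 0"
  shows "(\<integral>\<^sup>+x. ennreal (exp (\<theta> * x)) \<partial>density lborel (normal_density 0 \<sigma>)) = ennreal (exp (\<sigma>\<^sup>2 * \<theta>\<^sup>2 / 2))"
proof -
  \<comment> \<open>Completing the square: the tilt by \<open>exp (\<theta> * x)\<close> moves the
    mean to \<open>\<sigma>^2 * \<theta>\<close>.\<close>
  have eq: "normal_density 0 \<sigma> x * exp (\<theta> * x) = exp (\<sigma>\<^sup>2 * \<theta>\<^sup>2 / 2) * normal_density (\<sigma>\<^sup>2 * \<theta>) \<sigma> x" for x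
  proof -
    have "- x\<^sup>2 / (2 * \<sigma>\<^sup>2) + \<theta> * x = \<sigma>\<^sup>2 * \<theta>\<^sup>2 / 2 + - (x - \<sigma>\<^sup>2 * \<theta>)\<^sup>2 / (2 * \<sigma>\<^sup>2)"
      using \<sigma> by (simp add: field_simps power2_eq_square)
    then have "exp (- x\<^sup>2 / (2 * \<sigma>\<^sup>2)) * exp (\<theta> * x) = exp (\<sigma>\<^sup>2 * \<theta>\<^sup>2 / 2) * exp (- (x - \<sigma>\<^sup>2 * \<theta>)\<^sup>2 / (2 * \<sigma>\<^sup>2))"
      by (simp only: exp_add[symmetric])
    then show ?thesis unfolding normal_density_def by (simp add: mult.assoc mult.left_commute)
  qed
  have one: "(\<integral>\<^sup>+x. ennreal (normal_density m \<sigma> x) \<partial>lborel) = 1" for m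
    using \<sigma> by (subst nn_integral_eq_integral) auto
  have "(\<integral>\<^sup>+x. ennreal (exp (\<theta> * x)) \<partial>density lborel (normal_density 0 \<sigma>))
     = (\<integral>\<^sup>+x. ennreal (normal_density 0 \<sigma> x) * ennreal (exp (\<theta> * x)) \<partial>lborel)"
    by (subst nn_integral_density) auto
  also have "\<dots> = (\<integral>\<^sup>+x. ennreal (exp (\<sigma>\<^sup>2 * \<theta>\<^sup>2 / 2)) * ennreal (normal_density (\<sigma>\<^sup>2 * \<theta>) \<sigma> x) \<partial>lborel)"
    by (intro nn_integral_cong) (simp add: ennreal_mult[symmetric] eq)
  also have "\<dots> = ennreal (exp (\<sigma>\<^sup>2 * \<theta>\<^sup>2 / 2))" by (simp add: nn_integral_cmult one)
  finally show ?thesis .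
qed

text \<open>Chernoff's bound with the optimal \<open>\<theta> = \<tau> / (\<sigma>^2 V^2)\<close>;
  with nonnegative integrals no integrability has to be checked.\<close>

lemma gauss_tail:
  fixes a :: "'i \<Rightarrow> real"
  assumes I: "finite I" and \<sigma>: "\<sigma> > 0" and V: "V > 0" "(\<Sum>x\<in>I. (a x)\<^sup>2) \<le> V\<^sup>2" and \<tau>: "\<tau> > 0"
  defines "N \<equiv> PiM I (\<lambda>_. density lborel (normal_density 0 \<sigma>))"
  shows "emeasure N {g \<in> space N. (\<Sum>x\<in>I. a x * g x) \<ge> \<tau>} \<le> ennreal (exp (- (\<tau>\<^sup>2 / (2 * \<sigma>\<^sup>2 * V\<^sup>2))))"
proof -
  let ?D = "density lborel (normal_density 0 \<sigma>)"
  interpret D: prob_space ?D using \<sigma> by (rule prob_space_normal_density)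
  interpret product_sigma_finite "\<lambda>_. ?D" by unfold_locales
  define \<theta> where "\<theta> = \<tau> / (\<sigma>\<^sup>2 * V\<^sup>2)"
  have \<theta>: "\<theta> > 0" using \<sigma> V \<tau> by (simp add: \<theta>_def)
  let ?u = "\<lambda>g. \<Prod>x\<in>I. ennreal (exp (\<theta> * a x * g x))"
  have u: "?u g = ennreal (exp (\<theta> * (\<Sum>x\<in>I. a x * g x)))" for g
    by (simp add: prod_ennreal exp_sum[OF I] sum_distrib_left mult.assoc)
  have mu: "(\<lambda>g. ?u g * indicator (space N) g) \<in> borel_measurable N"
    unfolding N_def by measurable
  have "{g \<in> space N. (\<Sum>x\<in>I. a x * g x) \<ge> \<tau>} \<subseteq> {g \<in> space N. 1 \<le> ennreal (exp (- (\<theta> * \<tau>))) * ?u g}"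
  proof
    fix g assume "g \<in> {g \<in> space N. (\<Sum>x\<in>I. a x * g x) \<ge> \<tau>}"
    then have g: "g \<in> space N" "(\<Sum>x\<in>I. a x * g x) \<ge> \<tau>" by auto
    have "1 \<le> exp (- (\<theta> * \<tau>)) * exp (\<theta> * (\<Sum>x\<in>I. a x * g x))"
      using g(2) \<theta> by (simp add: exp_add[symmetric])
    then have "1 \<le> ennreal (exp (- (\<theta> * \<tau>))) * ?u g"
      unfolding u by (simp add: ennreal_mult[symmetric] ennreal_1[symmetric] ennreal_leI del: ennreal_1)
    then show "g \<in> {g \<in> space N. 1 \<le> ennreal (exp (- (\<theta> * \<tau>))) * ?u g}" using g by simp
  qed
  then have "emeasure N {g \<in> space N. (\<Sum>x\<in>I. a x * g x) \<ge> \<tau>} \<le> emeasure N {g \<in> space N. 1 \<le> ennreal (exp (- (\<theta> * \<tau>))) * ?u g}"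
  proof (rule emeasure_mono)
    show "{g \<in> space N. 1 \<le> ennreal (exp (- (\<theta> * \<tau>))) * ?u g} \<in> sets N" unfolding N_def by measurable
  qed
  also have "\<dots> \<le> ennreal (exp (- (\<theta> * \<tau>))) * (\<integral>\<^sup>+g. ?u g * indicator (space N) g \<partial>N)"
    by (rule nn_integral_Markov_inequality[OF mu]) simp
  also have "(\<integral>\<^sup>+g. ?u g * indicator (space N) g \<partial>N) = (\<integral>\<^sup>+g. ?u g \<partial>N)"
    by (intro nn_integral_cong) simp
  also have "\<dots> = (\<Prod>x\<in>I. (\<integral>\<^sup>+y. ennreal (exp (\<theta> * a x * y)) \<partial>?D))"
    unfolding N_def by (rule product_nn_integral_prod[OF I]) measurable
  also have "\<dots> = ennreal (exp (\<sigma>\<^sup>2 * \<theta>\<^sup>2 / 2 * (\<Sum>x\<in>I. (a x)\<^sup>2)))"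
    unfolding gauss_mgf[OF \<sigma>] by (simp add: prod_ennreal exp_sum[OF I] sum_distrib_left power_mult_distrib mult.assoc)
  also have "ennreal (exp (- (\<theta> * \<tau>))) * \<dots> = ennreal (exp (- (\<theta> * \<tau>) + \<sigma>\<^sup>2 * \<theta>\<^sup>2 / 2 * (\<Sum>x\<in>I. (a x)\<^sup>2)))"
    by (simp add: ennreal_mult[symmetric] exp_add[symmetric])
  also have "\<dots> \<le> ennreal (exp (- (\<tau>\<^sup>2 / (2 * \<sigma>\<^sup>2 * V\<^sup>2))))"
  proof (rule ennreal_leI)
    have "\<sigma>\<^sup>2 * \<theta>\<^sup>2 / 2 * (\<Sum>x\<in>I. (a x)\<^sup>2) \<le> \<sigma>\<^sup>2 * \<theta>\<^sup>2 / 2 * V\<^sup>2"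
      by (rule mult_left_mono[OF V(2)]) simp
    moreover have "- (\<theta> * \<tau>) + \<sigma>\<^sup>2 * \<theta>\<^sup>2 / 2 * V\<^sup>2 = - (\<tau>\<^sup>2 / (2 * \<sigma>\<^sup>2 * V\<^sup>2))"
      using \<sigma> V unfolding \<theta>_def by (simp add: field_simps power2_eq_square)
    ultimately show "exp (- (\<theta> * \<tau>) + \<sigma>\<^sup>2 * \<theta>\<^sup>2 / 2 * (\<Sum>x\<in>I. (a x)\<^sup>2)) \<le> exp (- (\<tau>\<^sup>2 / (2 * \<sigma>\<^sup>2 * V\<^sup>2)))"
      by simp
  qed
  finally show ?thesis .
qed

section \<open>Measurability of the separation event\<close>

definition conv_score :: "nat \<Rightarrow> nat \<Rightarrow> nat set \<Rightarrow> (nat \<Rightarrow> real) \<Rightarrow> (nat \<Rightarrow> real) \<Rightarrow> nat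
    \<Rightarrow> (nat \<times> nat \<Rightarrow> bool) \<times> (nat \<times> nat \<Rightarrow> real) \<Rightarrow> (nat \<Rightarrow> real) \<Rightarrow> real \<Rightarrow> nat \<Rightarrow> real" where
  "conv_score n m S \<mu> \<nu> k \<omega> w b =
    mat_pow n (conv_mat n (fst \<omega>)) k (\<lambda>i. (\<Sum>l<m. features S \<mu> \<nu> (snd \<omega>) i l * w l) + b)"

definition splits_classes :: "nat \<Rightarrow> nat set \<Rightarrow> (nat \<Rightarrow> real) \<Rightarrow> bool" where
  "splits_classes n S y \<longleftrightarrow> ((\<forall>i\<in>S. y i > 0) \<and> (\<forall>i\<in>{..<n} - S. y i < 0)) \<or> ((\<forall>i\<in>S. y i < 0) \<and> (\<forall>i\<in>{..<n} - S. y i > 0))"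

lemma separable_after_iff:
  "separable_after n m S \<mu> \<nu> k \<omega> \<longleftrightarrow> (\<exists>w b. splits_classes n S (conv_score n m S \<mu> \<nu> k \<omega> w b))"
  by (simp add: separable_after_def conv_score_def splits_classes_def Let_def)

lemma mat_pow_sum: "mat_pow n M k (\<lambda>i. \<Sum>t\<in>T. x t i) = (\<lambda>i. \<Sum>t\<in>T. mat_pow n M k (x t) i)"
  by (induction k) (auto simp: mat_vec_sum)

lemma conv_score_linear:
  "conv_score n m S \<mu> \<nu> k \<omega> w b i =
    (\<Sum>l<m. w l * mat_pow n (conv_mat n (fst \<omega>)) k (\<lambda>i. features S \<mu> \<nu> (snd \<omega>) i l) i)
      + b * mat_pow n (conv_mat n (fst \<omega>)) k (\<lambda>_. 1) i"
proof -
  let ?A = "mat_vec n (conv_mat n (fst \<omega>)) ^^ k"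
  have "conv_score n m S \<mu> \<nu> k \<omega> w b = ?A (\<lambda>i. (\<Sum>l<m. w l * features S \<mu> \<nu> (snd \<omega>) i l) + b * 1)"
    by (simp add: conv_score_def mult.commute)
  also have "\<dots> = (\<lambda>i. (\<Sum>l<m. w l * ?A (\<lambda>i. features S \<mu> \<nu> (snd \<omega>) i l) i) + b * ?A (\<lambda>_. 1) i)"
    unfolding mat_pow_lin mat_pow_sum mat_pow_scale ..
  finally show ?thesis by simp
qed

text \<open>The scores are linear in \<open>(w, b)\<close>, and finitely many strict inequalities
  survive a small change of the parameters. Fixing \<open>w\<close> outside \<open>{..<m}\<close>
  through \<open>PiE\<close> leaves countably many candidates, so the event is a countable
  union.\<close>

lemma separable_after_rational:
  assumes S: "S \<subseteq> {..<n}"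
  shows "separable_after n m S \<mu> \<nu> k \<omega> \<longleftrightarrow>
    (\<exists>w\<in>PiE {..<m} (\<lambda>_. \<rat>). \<exists>b\<in>\<rat>. splits_classes n S (conv_score n m S \<mu> \<nu> k \<omega> w b))"
proof
  assume "separable_after n m S \<mu> \<nu> k \<omega>"
  then obtain w b where wb: "splits_classes n S (conv_score n m S \<mu> \<nu> k \<omega> w b)" unfolding separable_after_iff by blast
  let ?y = "conv_score n m S \<mu> \<nu> k \<omega>"
  let ?A = "\<lambda>l. mat_pow n (conv_mat n (fst \<omega>)) k (\<lambda>i. features S \<mu> \<nu> (snd \<omega>) i l)"
  let ?C = "mat_pow n (conv_mat n (fst \<omega>)) k (\<lambda>_. 1)"
  \<comment> \<open>\<open>D\<close> bounds the change of any score under a unit change of all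
    parameters, and \<open>e\<close> is the smallest margin. The added 1 keeps \<open>D\<close>
    positive, and the inserted 1 keeps the set in \<open>Min\<close> nonempty.\<close>
  define D where "D = 1 + (\<Sum>i<n. (\<Sum>l<m. \<bar>?A l i\<bar>) + \<bar>?C i\<bar>)"
  define e where "e = Min (insert 1 ((\<lambda>i. \<bar>?y w b i\<bar>) ` {..<n}))"
  have D: "D > 0" unfolding D_def by (intro add_pos_nonneg sum_nonneg add_nonneg_nonneg) auto
  have nz: "?y w b i \<noteq> 0" if "i < n" for i
    using wb that unfolding splits_classes_def by (cases "i \<in> S") force+
  have e: "e > 0" unfolding e_def using nz by (subst Min_gr_iff) auto
  have ey: "e \<le> \<bar>?y w b i\<bar>" if "i < n" for i unfolding e_def using that by (intro Min_le) auto
  define \<delta> where "\<delta> = e / (2 * D)"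
  have \<delta>: "\<delta> > 0" using e D by (simp add: \<delta>_def)
  have rat: "\<exists>r\<in>\<rat>. \<bar>r - x\<bar> \<le> \<delta>" for x :: real
  proof -
    obtain r where "r \<in> \<rat>" "x < r" "r < x + \<delta>" using Rats_dense_in_real[of x "x + \<delta>"] \<delta> by auto
    then show ?thesis by (intro bexI[of _ r]) auto
  qed
  then obtain R where R: "\<And>x. R x \<in> \<rat>" "\<And>x. \<bar>R x - x\<bar> \<le> \<delta>" by metis
  let ?w = "restrict (\<lambda>l. R (w l)) {..<m}"
  have close: "\<bar>?y ?w (R b) i - ?y w b i\<bar> < \<bar>?y w b i\<bar>" if i: "i < n" for i
  proof -
    have diff: "?y ?w (R b) i - ?y w b i = (\<Sum>l<m. (R (w l) - w l) * ?A l i) + (R b - b) * ?C i"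
      unfolding conv_score_linear by (simp add: algebra_simps sum_subtractf)
    have "\<bar>?y ?w (R b) i - ?y w b i\<bar> \<le> (\<Sum>l<m. \<bar>(R (w l) - w l) * ?A l i\<bar>) + \<bar>(R b - b) * ?C i\<bar>"
      unfolding diff by (rule order_trans[OF abs_triangle_ineq add_right_mono[OF sum_abs]])
    also have "\<dots> \<le> (\<Sum>l<m. \<delta> * \<bar>?A l i\<bar>) + \<delta> * \<bar>?C i\<bar>"
      unfolding abs_mult by (intro add_mono sum_mono mult_right_mono R abs_ge_zero)
    also have "\<dots> = \<delta> * ((\<Sum>l<m. \<bar>?A l i\<bar>) + \<bar>?C i\<bar>)" by (simp add: sum_distrib_left distrib_left)
    also have "\<dots> \<le> \<delta> * D"
    proof (rule mult_left_mono)
      have "(\<Sum>l<m. \<bar>?A l i\<bar>) + \<bar>?C i\<bar> \<le> (\<Sum>i<n. (\<Sum>l<m. \<bar>?A l i\<bar>) + \<bar>?C i\<bar>)"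
        by (rule member_le_sum[of i "{..<n}" "\<lambda>i. (\<Sum>l<m. \<bar>?A l i\<bar>) + \<bar>?C i\<bar>"]) (use i in \<open>auto intro: add_nonneg_nonneg sum_nonneg\<close>)
      then show "(\<Sum>l<m. \<bar>?A l i\<bar>) + \<bar>?C i\<bar> \<le> D" by (simp add: D_def)
    qed (use \<delta> in simp)
    also have "\<dots> = e / 2" using D by (simp add: \<delta>_def)
    also have "\<dots> < e" using e by simp
    also have "\<dots> \<le> \<bar>?y w b i\<bar>" by (rule ey[OF i])
    finally show ?thesis .
  qed
  have "?y ?w (R b) i > 0 \<longleftrightarrow> ?y w b i > 0" "?y ?w (R b) i < 0 \<longleftrightarrow> ?y w b i < 0" if "i < n" for i
    using close[OF that] by (auto simp: abs_if split: if_splits)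
  then have "splits_classes n S (?y ?w (R b))"
    using wb S unfolding splits_classes_def by (metis DiffD1 lessThan_iff subsetD)
  moreover have "?w \<in> PiE {..<m} (\<lambda>_. \<rat>)" using R by auto
  ultimately show "\<exists>w\<in>PiE {..<m} (\<lambda>_. \<rat>). \<exists>b\<in>\<rat>. splits_classes n S (?y w b)" using R by blast
next
  assume "\<exists>w\<in>PiE {..<m} (\<lambda>_. \<rat>). \<exists>b\<in>\<rat>. splits_classes n S (conv_score n m S \<mu> \<nu> k \<omega> w b)"
  then show "separable_after n m S \<mu> \<nu> k \<omega>" unfolding separable_after_iff by blast
qed

lemma measurable_mat_pow:
  assumes A: "\<And>i j. (\<lambda>\<omega>. A \<omega> i j) \<in> borel_measurable M" and x: "\<And>i. i < n \<Longrightarrow> (\<lambda>\<omega>. x \<omega> i) \<in> borel_measurable M" and i: "i < n"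
  shows "(\<lambda>\<omega>. mat_pow n (A \<omega>) k (x \<omega>) i) \<in> borel_measurable M"
  using i
proof (induction k arbitrary: i)
  case (Suc k)
  then show ?case using A by (simp add: mat_vec_def)
qed (use x in simp)

lemma conv_score_measurable:
  assumes i: "i < n"
  shows "(\<lambda>\<omega>. conv_score n m S \<mu> \<nu> k \<omega> w b i) \<in> borel_measurable (csbm n m S p q \<sigma>)"
  unfolding conv_score_def
proof (rule measurable_mat_pow[OF _ _ i])
  fix i j
  have "(\<lambda>E. conv_mat n E i j) \<in> borel_measurable (measure_pmf (csbm_graph n S p q))" by simp
  then show "(\<lambda>\<omega>. conv_mat n (fst \<omega>) i j) \<in> borel_measurable (csbm n m S p q \<sigma>)"
    unfolding csbm_def by (rule measurable_compose[OF measurable_fst])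
next
  fix i assume i: "i < n"
  have comp: "(\<lambda>\<omega>. snd \<omega> (i, l)) \<in> borel_measurable (csbm n m S p q \<sigma>)" if "l < m" for l
  proof -
    have "(\<lambda>g. g (i, l)) \<in> borel_measurable (csbm_noise n m \<sigma>)"
    proof -
      have "(\<lambda>g. g (i, l)) \<in> measurable (csbm_noise n m \<sigma>) (density lborel (normal_density 0 \<sigma>))"
        unfolding csbm_noise_def using i that by (intro measurable_component_singleton) auto
      then show ?thesis by simp
    qed
    then show ?thesis unfolding csbm_def by (rule measurable_compose[OF measurable_snd])
  qed
  show "(\<lambda>\<omega>. (\<Sum>l<m. features S \<mu> \<nu> (snd \<omega>) i l * w l) + b) \<in> borel_measurable (csbm n m S p q \<sigma>)"
    unfolding features_def using comp by (intro borel_measurable_add borel_measurable_sum borel_measurable_times) auto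
qed

lemma separable_event_sets:
  assumes S: "S \<subseteq> {..<n}"
  shows "{\<omega> \<in> space (csbm n m S p q \<sigma>). separable_after n m S \<mu> \<nu> k \<omega>} \<in> sets (csbm n m S p q \<sigma>)"
proof -
  let ?M = "csbm n m S p q \<sigma>"
  let ?I = "PiE {..<m} (\<lambda>_. \<rat>) \<times> (\<rat> :: real set)"
  let ?Q = "\<lambda>x. {\<omega> \<in> space ?M. splits_classes n S (conv_score n m S \<mu> \<nu> k \<omega> (fst x) (snd x))}"
  have "countable ?I" by (intro countable_SIGMA countable_PiE countable_rat) auto
  moreover have "?Q x \<in> sets ?M" for x
  proof -
    have meas: "(\<lambda>\<omega>. conv_score n m S \<mu> \<nu> k \<omega> (fst x) (snd x) i) \<in> borel_measurable ?M" if "i \<in> S \<or> i \<in> {..<n} - S" for i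
      using that S conv_score_measurable by auto
    have fin: "finite S" "finite ({..<n} - S)" using S finite_subset by auto
    show ?thesis unfolding splits_classes_def
      by (intro sets.sets_Collect_disj sets.sets_Collect_conj sets.sets_Collect_finite_All fin borel_measurable_less) (auto intro!: borel_measurable_less meas)
  qed
  ultimately have "(\<Union>x\<in>?I. ?Q x) \<in> sets ?M" by (intro sets.countable_UN') auto
  moreover have "{\<omega> \<in> space ?M. separable_after n m S \<mu> \<nu> k \<omega>} = (\<Union>x\<in>?I. ?Q x)"
  proof (rule set_eqI)
    fix \<omega>
    have gen: "(A \<and> (\<exists>w\<in>P. \<exists>b\<in>Q. R w b)) \<longleftrightarrow> (\<exists>x\<in>P \<times> Q. A \<and> R (fst x) (snd x))"
      for A and P :: "(nat \<Rightarrow> real) set" and Q :: "real set" and R by force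
    show "\<omega> \<in> {\<omega> \<in> space ?M. separable_after n m S \<mu> \<nu> k \<omega>} \<longleftrightarrow> \<omega> \<in> (\<Union>x\<in>?I. ?Q x)"
      unfolding separable_after_rational[OF S] UN_iff mem_Collect_eq by (rule gen)
  qed
  ultimately show ?thesis by simp
qed


section \<open>The block model as signal plus noise\<close>

definition sbm_prob :: "nat set \<Rightarrow> real \<Rightarrow> real \<Rightarrow> nat \<times> nat \<Rightarrow> real" where
  "sbm_prob S p q e = (if fst e \<in> S \<longleftrightarrow> snd e \<in> S then p else q)"

definition class_sign :: "nat set \<Rightarrow> nat \<Rightarrow> real" where
  "class_sign S i = (if i \<in> S then 1 else - 1)"

lemma csbm_graph_eq: "csbm_graph n S p q = pairs_pmf n (sbm_prob S p q)"
  unfolding csbm_graph_def pairs_pmf_def by (intro arg_cong[where f="Pi_pmf _ _"]) (auto simp: sbm_prob_def)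

lemma op_bounded_noise_mat:
  assumes op: "op_bounded n (sym_of (\<lambda>e b. of_bool b - \<pi> e) E) K" and p: "p \<ge> 0"
  shows "op_bounded n (noise_mat \<pi> p E) (K + p)"
  unfolding op_bounded_def
proof
  fix x
  let ?L = "\<lambda>x. vnorm n x" and ?M = "sym_of (\<lambda>e b. of_bool b - \<pi> e) E"
  have eq: "mat_vec n (noise_mat \<pi> p E) x i = mat_vec n ?M x i + (- p) * x i" if "i < n" for i
  proof -
    have "noise_mat \<pi> p E i j * x j = ?M i j * x j + (if j = i then (- p) * x j else 0)" for j
      by (auto simp: noise_mat_def sym_of_def)
    then show ?thesis unfolding mat_vec_def using that by (simp add: sum.distrib sum.delta)
  qed
  have "?L (mat_vec n (noise_mat \<pi> p E) x) = ?L (\<lambda>i. mat_vec n ?M x i + (- p) * x i)"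
    using eq by (intro L2_set_cong) auto
  also have "\<dots> \<le> ?L (mat_vec n ?M x) + ?L (\<lambda>i. (- p) * x i)" by (rule L2_set_triangle_ineq)
  also have "\<dots> \<le> K * ?L x + p * ?L x"
    unfolding L2_set_scale using op_boundedD[OF op] p by (intro add_mono) auto
  finally show "?L (mat_vec n (noise_mat \<pi> p E) x) \<le> (K + p) * ?L x" by (simp add: algebra_simps)
qed

definition regular_noise :: "nat \<Rightarrow> nat \<Rightarrow> (nat \<Rightarrow> real) \<Rightarrow> real \<Rightarrow> real \<Rightarrow> (nat \<Rightarrow> nat \<Rightarrow> real) \<Rightarrow> bool" where
  "regular_noise n k s \<kappa> b M \<longleftrightarrow> op_bounded n M \<kappa> \<and>
    (\<forall>j\<le>k. \<forall>i<n. \<bar>mat_pow n M j s i\<bar> \<le> b ^ j) \<and> (\<forall>j\<le>k. \<forall>i<n. \<bar>mat_pow n M j (\<lambda>_. 1) i\<bar> \<le> b ^ j)"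

text \<open>With \<open>L = (k + 5) * ln n\<close>, \<open>exp (- L) = n^(-(k + 5))\<close> beats
  the \<open>n^(k + 1) * k\<close> events of \<open>entry_tail\<close> and leaves
  \<open>2 k / n^4 \<le> 2 / n^3\<close> for each of the two vectors. Adding \<open>8 / n^3\<close>
  for the norm gives 12.\<close>

lemma regular_noise_prob:
  fixes p b :: real
  assumes n: "n > 1" and \<pi>: "\<And>e. 0 \<le> \<pi> e \<and> \<pi> e \<le> p" and p: "p \<le> 1"
    and tail: "pmf_prob (pairs_pmf n \<pi>) {E. \<not> op_bounded n (sym_of (\<lambda>e b. of_bool b - \<pi> e) E) K} \<le> 8 / real n ^ 3"
    and K: "K \<ge> 0" "K + p \<le> \<kappa>" "4 * \<kappa> \<le> b" and b: "b > 0" "8 * sqrt ((real k + 5) * ln n * (n * p)) < b"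
    and L: "(real k + 5) * ln n \<le> n * p" and k: "k \<ge> 1" "k \<le> n" and s: "\<And>i. \<bar>s i\<bar> \<le> 1"
  shows "pmf_prob (pairs_pmf n \<pi>) {E. regular_noise n k s \<kappa> b (noise_mat \<pi> p E)} \<ge> 1 - 12 / real n ^ 3"
proof -
  let ?P = "pairs_pmf n \<pi>" and ?M = "noise_mat \<pi> p"
  let ?R = "{E. regular_noise n k s \<kappa> b (?M E)}"
  let ?L = "(real k + 5) * ln n"
  let ?F = "\<lambda>v. {E. op_bounded n (?M E) \<kappa> \<and> \<not> (\<forall>j\<le>k. \<forall>i<n. \<bar>mat_pow n (?M E) j v i\<bar> \<le> b ^ j)}"
  let ?A = "{E. \<not> op_bounded n (sym_of (\<lambda>e b. of_bool b - \<pi> e) E) K}"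
  have p0: "p \<ge> 0" using \<pi>[of undefined] by linarith
  have \<kappa>0: "\<kappa> \<ge> 0" using K p0 by linarith
  have L0: "?L > 0" using n by (intro mult_pos_pos) auto
  have F: "pmf_prob ?P (?F v) \<le> 2 / real n ^ 3" if "\<And>i. \<bar>v i\<bar> \<le> 1" for v
  proof -
    have "pmf_prob ?P (?F v) \<le> real n ^ (k + 1) * k * (2 * exp (- ?L))"
      by (rule entry_tail[OF \<pi> p L0 L _ k(1) \<kappa>0 K(3) b that]) (use n in auto)
    also have "exp (- ?L) = 1 / real n ^ (k + 5)"
    proof -
      have "exp (real (k + 5) * ln n) = real n ^ (k + 5)" unfolding exp_of_nat_mult using n by simp
      then show ?thesis by (simp add: exp_minus inverse_eq_divide)
    qed
    also have "real n ^ (k + 1) * k * (2 * (1 / real n ^ (k + 5))) = 2 * k / real n ^ 4"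
      using n by (simp add: power_add field_simps eval_nat_numeral)
    also have "\<dots> \<le> 2 * n / real n ^ 4" using k by (intro divide_right_mono) auto
    also have "\<dots> = 2 / real n ^ 3" using n by (simp add: field_simps eval_nat_numeral)
    finally show ?thesis .
  qed
  have mono: "op_bounded n (?M E) \<kappa>" if "op_bounded n (sym_of (\<lambda>e b. of_bool b - \<pi> e) E) K" for E
    unfolding op_bounded_def
  proof
    fix x
    have "vnorm n (mat_vec n (?M E) x) \<le> (K + p) * vnorm n x"
      by (rule op_boundedD[OF op_bounded_noise_mat[OF that p0]])
    also have "\<dots> \<le> \<kappa> * vnorm n x" using K by (intro mult_right_mono) auto
    finally show "vnorm n (mat_vec n (?M E) x) \<le> \<kappa> * vnorm n x" .
  qed
  have "- ?R \<subseteq> (?A \<union> ?F s) \<union> ?F (\<lambda>_. 1)"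
    using mono unfolding regular_noise_def by auto
  then have "pmf_prob ?P (- ?R) \<le> pmf_prob ?P ((?A \<union> ?F s) \<union> ?F (\<lambda>_. 1))"
    by (intro measure_pmf.finite_measure_mono) auto
  also have "\<dots> \<le> pmf_prob ?P (?A \<union> ?F s) + pmf_prob ?P (?F (\<lambda>_. 1))"
    by (rule measure_Un_le) auto
  also have "pmf_prob ?P (?A \<union> ?F s) \<le> pmf_prob ?P ?A + pmf_prob ?P (?F s)"
    by (rule measure_Un_le) auto
  finally have "pmf_prob ?P (- ?R) \<le> 8 / real n ^ 3 + 2 / real n ^ 3 + 2 / real n ^ 3"
    using tail F[of s] F[of "\<lambda>_. 1"] s by simp
  moreover have "pmf_prob ?P (- ?R) = 1 - pmf_prob ?P ?R"
    using measure_pmf.prob_compl[of "?R" ?P] by (simp add: Compl_eq_Diff_UNIV)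
  ultimately show ?thesis by simp
qed

definition centered_adj :: "nat \<Rightarrow> (nat \<times> nat \<Rightarrow> bool) \<Rightarrow> nat \<Rightarrow> nat \<Rightarrow> real" where
  "centered_adj n E i j = adj E i j - avg_degree n E / n"

lemma sum_adj: "(\<Sum>i<n. \<Sum>j<n. adj E i j) = 2 * real (card {e \<in> csbm_pairs n. E e})"
proof -
  have "(\<Sum>i<n. \<Sum>j<n. adj E i j) = (\<Sum>i<n. \<Sum>j<n. if i = j then 0 else of_bool (E (pair_of i j)))"
    by (intro sum.cong refl) (auto simp: adj_def pair_of_def)
  also have "\<dots> = (\<Sum>(i,j)\<in>csbm_pairs n. of_bool (E (pair_of i j)) + of_bool (E (pair_of j i)))"
    by (rule sum_offdiag)
  also have "\<dots> = (\<Sum>e\<in>csbm_pairs n. 2 * of_bool (E e))"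
    by (intro sum.cong refl) (auto simp: csbm_pairs_def pair_of_def min_def max_def)
  also have "\<dots> = 2 * (\<Sum>e\<in>csbm_pairs n. of_bool (E e))" by (simp only: sum_distrib_left)
  also have "(\<Sum>e\<in>csbm_pairs n. of_bool (E e)) = real (card {e \<in> csbm_pairs n. E e})"
    by (simp add: of_bool_def sum.If_cases Int_def)
  finally show ?thesis .
qed

lemma sum_class_sign:
  assumes "S \<subseteq> {..<n}" "card S = n div 2" "even n" shows "(\<Sum>i<n. class_sign S i) = 0"
proof -
  have fin: "finite S" using assms(1) finite_subset by blast
  have "(\<Sum>i<n. class_sign S i) = (\<Sum>i\<in>{..<n} - S. class_sign S i) + (\<Sum>i\<in>S. class_sign S i)"
    by (rule sum.subset_diff[OF assms(1)]) simp
  also have "(\<Sum>i\<in>S. class_sign S i) = real (card S)" by (simp add: class_sign_def)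
  also have "(\<Sum>i\<in>{..<n} - S. class_sign S i) = (\<Sum>i\<in>{..<n} - S. - 1)"
    by (intro sum.cong refl) (auto simp: class_sign_def)
  also have "\<dots> = - real (card ({..<n} - S))" by simp
  also have "card ({..<n} - S) = n - card S" using assms(1) fin by (simp add: card_Diff_subset)
  also have "- real (n - card S) + real (card S) = 0" using assms by (auto elim!: evenE)
  finally show ?thesis .
qed

lemma signal_noise_csbm:
  fixes p q \<kappa> :: real
  assumes n: "n > 0" "even n" and S: "S \<subseteq> {..<n}" "card S = n div 2"
    and \<kappa>: "\<kappa> \<ge> 0" and k: "k \<ge> 1" and \<Lambda>: "\<Lambda> = n * (p - q) / 2" "\<Lambda> > 0" "32 * real k * \<kappa> \<le> \<Lambda>"
    and reg: "regular_noise n k (class_sign S) \<kappa> (\<Lambda> / 64) (noise_mat (sbm_prob S p q) p E)"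
  shows "signal_noise n k (noise_mat (sbm_prob S p q) p E) (centered_adj n E) (class_sign S) ((p + q) / 2 - avg_degree n E / n) \<kappa> \<Lambda>"
proof
  let ?M = "noise_mat (sbm_prob S p q) p E" and ?s = "class_sign S" and ?e = "(p + q) / 2 - avg_degree n E / n"
  show symM: "sym_mat ?M" by (rule sym_noise_mat)
  show opM: "op_bounded n ?M \<kappa>" using reg by (simp add: regular_noise_def)
  show "\<bar>?s i\<bar> = 1" for i by (simp add: class_sign_def)
  show bal: "(\<Sum>i<n. ?s i) = 0" by (rule sum_class_sign[OF S n(2)])
  have N: "centered_adj n E i j = ?M i j + \<Lambda> / n * ?s i * ?s j + ?e" for i j
  proof -
    have a: "\<Lambda> / n = (p - q) / 2" using n \<Lambda>(1) by simp
    have "pair_of i j = (i, j) \<or> pair_of i j = (j, i)" by (auto simp: pair_of_def min_def max_def)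
    then have \<pi>: "sbm_prob S p q (pair_of i j) = (if i \<in> S \<longleftrightarrow> j \<in> S then p else q)"
      by (auto simp: sbm_prob_def)
    have "adj E i j = (if i = j then 0 else of_bool (E (pair_of i j)))" by (auto simp: adj_def pair_of_def)
    then show ?thesis unfolding centered_adj_def noise_mat_def \<pi> a class_sign_def
      by (auto simp: field_simps)
  qed
  then show "centered_adj n E i j = ?M i j + \<Lambda> / n * ?s i * ?s j + ?e" for i j .
  show "real n * \<bar>?e\<bar> \<le> \<kappa>"
  proof -
    \<comment> \<open>The subtracted constant uses the empirical degree, so the entries sum to 0.
      The error \<open>e\<close> is thereby controlled by the norm of the noise, without a separate
      concentration bound for the number of edges.\<close>
    have "(\<Sum>i<n. \<Sum>j<n. centered_adj n E i j) = 0"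
      using n sum_adj[where n=n and E=E] by (simp add: centered_adj_def sum_subtractf avg_degree_def)
    then have "0 = (\<Sum>i<n. \<Sum>j<n. ?M i j + \<Lambda> / n * ?s i * ?s j + ?e)" by (simp only: N)
    also have "\<dots> = (\<Sum>i<n. \<Sum>j<n. ?M i j) + (\<Sum>i<n. \<Sum>j<n. \<Lambda> / n * ?s i * ?s j) + real n * (real n * ?e)"
      by (simp add: sum.distrib)
    also have "(\<Sum>i<n. \<Sum>j<n. \<Lambda> / n * ?s i * ?s j) = 0"
      unfolding sum_distrib_left[symmetric] bal by simp
    also have "(\<Sum>i<n. \<Sum>j<n. ?M i j) = dotp n (\<lambda>_. 1) (mat_vec n ?M (\<lambda>_. 1))" by (simp add: dotp_def mat_vec_def)
    finally have "real n * (real n * ?e) = - dotp n (\<lambda>_. 1) (mat_vec n ?M (\<lambda>_. 1))" by simp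
    then have "real n * (real n * \<bar>?e\<bar>) = \<bar>dotp n (\<lambda>_. 1) (mat_vec n ?M (\<lambda>_. 1))\<bar>"
      by (metis abs_minus_cancel abs_mult abs_of_nat)
    also have "\<dots> \<le> vnorm n (\<lambda>_. 1) * vnorm n (mat_vec n ?M (\<lambda>_. 1))" by (rule dotp_abs_le)
    also have "\<dots> \<le> vnorm n (\<lambda>_. 1) * (\<kappa> * vnorm n (\<lambda>_. 1))"
      by (intro mult_left_mono op_boundedD[OF opM]) simp
    also have "\<dots> = real n * \<kappa>" by (simp add: L2_set_def)
    finally show ?thesis using n by (subst (asm) mult_le_cancel_left_pos) auto
  qed
qed (use assms in \<open>auto simp: regular_noise_def\<close>)

text \<open>The offset \<open>b\<close> puts the hyperplane through the midpoint of the two means,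
  so the projected feature of \<open>i\<close> is \<open>\<Delta> / 2 * s i\<close> plus noise.
  After \<open>k\<close> rounds the signal is at least
  \<open>\<Delta> / 2 * (\<Lambda>^k / 4)\<close>, the level that the noise must stay below.\<close>

lemma separable_of_small_noise:
  fixes p q \<kappa> :: real
  assumes n: "n > 0" "even n" and S: "S \<subseteq> {..<n}" "card S = n div 2" and q: "q \<ge> 0"
    and \<kappa>: "\<kappa> \<ge> 0" and k: "k \<ge> 1" and Lam: "\<Lambda> = n * (p - q) / 2" "\<Lambda> > 0" "32 * real k * \<kappa> \<le> \<Lambda>"
    and reg: "regular_noise n k (class_sign S) \<kappa> (\<Lambda> / 64) (noise_mat (sbm_prob S p q) p E)"
    and \<Delta>: "\<Delta> = vdist m \<mu> \<nu>" "\<Delta> > 0"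
    and g: "\<And>i. i < n \<Longrightarrow> \<bar>\<Sum>(j,l)\<in>{..<n} \<times> {..<m}.
        (mat_pow n (centered_adj n E) k (unit_vec i) j * ((\<mu> l - \<nu> l) / \<Delta>)) * g (j, l)\<bar> < \<Delta> / 8 * \<Lambda> ^ k"
  shows "separable_after n m S \<mu> \<nu> k (E, g)"
proof -
  let ?M = "noise_mat (sbm_prob S p q) p E" and ?s = "class_sign S" and ?e = "(p + q) / 2 - avg_degree n E / n"
  let ?N = "centered_adj n E" and ?d = "avg_degree n E"
  interpret signal_noise n k ?M ?N ?s ?e \<kappa> \<Lambda>
    by (rule signal_noise_csbm[OF n S \<kappa> k Lam reg])
  define w where "w l = (\<mu> l - \<nu> l) / \<Delta>" for l
  define b where "b = - (\<Sum>l<m. (\<mu> l + \<nu> l) * w l) / 2"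
  define h where "h j = (\<Sum>l<m. w l * g (j, l))" for j
  \<comment> \<open>Rescaling by the degree must preserve signs. It differs from
    \<open>n (p + q) / 2\<close> by at most \<open>\<kappa>\<close>, and
    \<open>\<kappa> < \<Lambda> \<le> n (p + q) / 2\<close>.\<close>
  have d: "?d > 0"
  proof -
    have "real n * ?e = n * (p + q) / 2 - ?d" using n by (simp add: field_simps)
    then have "\<bar>n * (p + q) / 2 - ?d\<bar> \<le> \<kappa>" using e by (metis abs_mult abs_of_nat)
    moreover have "\<kappa> < \<Lambda>" using \<kappa>_le \<kappa> \<Lambda> by linarith
    moreover have "\<Lambda> \<le> n * (p + q) / 2" using Lam(1) q n by (simp add: mult_left_mono)
    ultimately show ?thesis by linarith
  qed
  have conv: "conv_mat n E = (\<lambda>i j. (1 / ?d) * ?N i j)"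
    using d by (auto simp: fun_eq_iff conv_mat_def centered_adj_def field_simps)
  have sq: "(\<Sum>l<m. (\<mu> l - \<nu> l) * w l) = \<Delta>"
  proof -
    have "(\<Sum>l<m. (\<mu> l - \<nu> l)\<^sup>2) = \<Delta>\<^sup>2" unfolding \<Delta>(1) vdist_def by (simp add: sum_nonneg)
    then show ?thesis using \<Delta>(2)
      by (simp add: w_def power2_eq_square[symmetric] sum_divide_distrib[symmetric]) (simp add: power2_eq_square)
  qed
  have feat: "(\<Sum>l<m. features S \<mu> \<nu> g i l * w l) + b = h i + \<Delta> / 2 * ?s i" for i
  proof -
    have "(\<Sum>l<m. features S \<mu> \<nu> g i l * w l) = (\<Sum>l<m. (if i \<in> S then \<mu> l else \<nu> l) * w l) + h i"
      unfolding features_def h_def sum.distrib[symmetric] by (intro sum.cong refl) (simp add: algebra_simps)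
    moreover have "(\<Sum>l<m. (if i \<in> S then \<mu> l else \<nu> l) * w l) = (\<Sum>l<m. (\<mu> l + \<nu> l) * w l) / 2 + ?s i * (\<Sum>l<m. (\<mu> l - \<nu> l) * w l) / 2"
      by (cases "i \<in> S") (simp_all add: class_sign_def sum_distrib_right sum_divide_distrib sum.distrib[symmetric] sum_subtractf[symmetric] field_simps)
    ultimately show ?thesis unfolding sq b_def by (simp add: field_simps)
  qed
  let ?y = "conv_score n m S \<mu> \<nu> k (E, g) w b"
  have score: "?y i = (1 / ?d) ^ k * (mat_pow n ?N k h i + \<Delta> / 2 * mat_pow n ?N k ?s i)" for i
    unfolding conv_score_def fst_conv snd_conv feat conv scaled_mat_pow mat_pow_lin ..
  have hN: "\<bar>mat_pow n ?N k h i\<bar> < \<Delta> / 8 * \<Lambda> ^ k" if i: "i < n" for i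
  proof -
    have "mat_pow n ?N k h i = dotp n h (mat_pow n ?N k (unit_vec i))"
      using dotp_mat_pow[OF symN, of n k h "unit_vec i"] dotp_unit_vec[OF i] by simp
    also have "\<dots> = (\<Sum>j<n. \<Sum>l<m. (mat_pow n ?N k (unit_vec i) j * w l) * g (j, l))"
      unfolding dotp_def h_def sum_distrib_right by (intro sum.cong refl) (simp add: mult_ac)
    also have "\<dots> = (\<Sum>(j,l)\<in>{..<n} \<times> {..<m}. (mat_pow n ?N k (unit_vec i) j * w l) * g (j, l))"
      by (rule sum.cartesian_product)
    finally show ?thesis using g[OF i] by (simp add: w_def)
  qed
  have sign: "?s i * ?y i > 0" if i: "i < n" for i
  proof -
    have "- \<bar>mat_pow n ?N k h i\<bar> \<le> ?s i * mat_pow n ?N k h i"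
      by (auto simp: class_sign_def)
    moreover have "\<Delta> / 2 * (?s i * mat_pow n ?N k ?s i) \<ge> \<Delta> / 2 * (\<Lambda> ^ k / 4)"
      using entry_lower[OF i] \<Delta> by (intro mult_left_mono) auto
    ultimately have "?s i * mat_pow n ?N k h i + \<Delta> / 2 * (?s i * mat_pow n ?N k ?s i) > 0"
      using hN[OF i] by linarith
    then have "(1 / ?d) ^ k * (?s i * mat_pow n ?N k h i + \<Delta> / 2 * (?s i * mat_pow n ?N k ?s i)) > 0"
      using d by (intro mult_pos_pos) auto
    then show ?thesis unfolding score by (simp add: algebra_simps)
  qed
  have "splits_classes n S (?y)"
    unfolding splits_classes_def
  proof (intro disjI1 conjI ballI)
    show "0 < ?y i" if "i \<in> S" for i
      using sign[of i] that S(1) by (auto simp: class_sign_def)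
    show "?y i < 0" if "i \<in> {..<n} - S" for i
      using sign[of i] that by (auto simp: class_sign_def)
  qed
  then show ?thesis unfolding separable_after_iff by blast
qed

section \<open>Separation\<close>

text \<open>For a fixed graph the noise at \<open>i\<close> is a Gaussian linear form with
  coefficients \<open>c i j * w l\<close>; as \<open>w\<close> is a unit vector, their Euclidean
  norm is that of row \<open>i\<close> of \<open>N^k\<close>. The factor
  \<open>sqrt (8 * ln n)\<close> in \<open>snr\<close> makes each of the \<open>2 n\<close>
  one-sided tails at most \<open>n^(-4)\<close>.\<close>

lemma noise_slice_prob:
  fixes p q \<kappa> :: real
  assumes n: "n > 1" "even n" and S: "S \<subseteq> {..<n}" "card S = n div 2" and q: "q \<ge> 0" and \<sigma>: "\<sigma> > 0"
    and \<kappa>: "\<kappa> \<ge> 0" and k: "k \<ge> 1" and Lam: "\<Lambda> = n * (p - q) / 2" "\<Lambda> > 0" "32 * real k * \<kappa> \<le> \<Lambda>"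
    and reg: "regular_noise n k (class_sign S) \<kappa> (\<Lambda> / 64) (noise_mat (sbm_prob S p q) p E)"
    and \<Delta>: "\<Delta> = vdist m \<mu> \<nu>" "\<Delta> > 0"
    and snr: "\<sigma> * (\<kappa> ^ k + 24 * \<Lambda> ^ k / sqrt n) * sqrt (8 * ln n) \<le> \<Delta> / 8 * \<Lambda> ^ k"
    and meas: "{g \<in> space (csbm_noise n m \<sigma>). separable_after n m S \<mu> \<nu> k (E, g)} \<in> sets (csbm_noise n m \<sigma>)"
  shows "measure (csbm_noise n m \<sigma>) {g \<in> space (csbm_noise n m \<sigma>). separable_after n m S \<mu> \<nu> k (E, g)} \<ge> 1 - 2 / real n ^ 3"
proof -
  let ?N = "csbm_noise n m \<sigma>" and ?I = "{..<n} \<times> {..<m}"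
  let ?X = "{g \<in> space ?N. separable_after n m S \<mu> \<nu> k (E, g)}"
  define \<tau> where "\<tau> = \<Delta> / 8 * \<Lambda> ^ k"
  define V where "V = \<kappa> ^ k + 24 * \<Lambda> ^ k / sqrt n"
  define c where "c i = mat_pow n (centered_adj n E) k (unit_vec i)" for i
  define w where "w l = (\<mu> l - \<nu> l) / \<Delta>" for l
  have n0: "n > 0" using n by simp
  have ln0: "ln (real n) > 0" using n by simp
  have row: "vnorm n (c i) \<le> V" if "i < n" for i
    unfolding c_def V_def by (rule signal_noise.row_norm[OF signal_noise_csbm[OF n0 n(2) S \<kappa> k Lam reg] that])
  have V: "V > 0" unfolding V_def using \<kappa> Lam(2) n by (intro add_nonneg_pos) auto
  have \<tau>: "\<tau> > 0" using \<Delta> Lam(2) by (simp add: \<tau>_def)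
  have w2: "(\<Sum>l<m. (w l)\<^sup>2) = 1"
  proof -
    have "(\<Sum>l<m. (\<mu> l - \<nu> l)\<^sup>2) = \<Delta>\<^sup>2" unfolding \<Delta>(1) vdist_def by (simp add: sum_nonneg)
    then show ?thesis using \<Delta>(2) by (simp add: w_def power_divide sum_divide_distrib[symmetric])
  qed
  interpret D: prob_space "density lborel (normal_density 0 \<sigma>)" using \<sigma> by (rule prob_space_normal_density)
  interpret P: prob_space ?N unfolding csbm_noise_def by (rule prob_space_PiM) (rule D.prob_space_axioms)
  let ?B = "\<lambda>(i, sg). {g \<in> space ?N. (\<Sum>x\<in>?I. (sg * (c i (fst x) * w (snd x))) * g x) \<ge> \<tau>}"
  let ?J = "{..<n} \<times> {1, -1::real}"
  have tail: "emeasure ?N (?B x) \<le> ennreal (1 / real n ^ 4)" and tail_sets: "?B x \<in> sets ?N" if x: "x \<in> ?J" for x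
  proof -
    obtain i sg where xi: "x = (i, sg)" "i < n" "sg = 1 \<or> sg = -1" using x by auto
    have "(\<Sum>x\<in>?I. (sg * (c i (fst x) * w (snd x)))\<^sup>2) = (\<Sum>x\<in>?I. (c i (fst x))\<^sup>2 * (w (snd x))\<^sup>2)"
      using xi(3) by (intro sum.cong refl) (auto simp: power_mult_distrib)
    also have "\<dots> = (\<Sum>j<n. \<Sum>l<m. (c i j)\<^sup>2 * (w l)\<^sup>2)" by (simp add: sum.cartesian_product case_prod_unfold)
    also have "\<dots> = (\<Sum>j<n. (c i j)\<^sup>2) * (\<Sum>l<m. (w l)\<^sup>2)" by (simp add: sum_product)
    also have "\<dots> = (vnorm n (c i))\<^sup>2" by (simp add: w2 L2_set_def sum_nonneg)
    also have "\<dots> \<le> V\<^sup>2" using row[OF xi(2)] by (intro power_mono) auto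
    finally have V2: "(\<Sum>x\<in>?I. (sg * (c i (fst x) * w (snd x)))\<^sup>2) \<le> V\<^sup>2" .
    have "emeasure ?N (?B x) \<le> ennreal (exp (- (\<tau>\<^sup>2 / (2 * \<sigma>\<^sup>2 * V\<^sup>2))))"
      unfolding xi(1) prod.case csbm_noise_def by (rule gauss_tail[OF _ \<sigma> V V2 \<tau>]) simp
    also have "\<dots> \<le> ennreal (1 / real n ^ 4)"
    proof (rule ennreal_leI)
      have "(\<sigma> * V * sqrt (8 * ln n))\<^sup>2 \<le> \<tau>\<^sup>2"
        using snr \<sigma> V ln0 unfolding V_def[symmetric] \<tau>_def[symmetric] by (intro power_mono) auto
      then have "4 * ln n \<le> \<tau>\<^sup>2 / (2 * \<sigma>\<^sup>2 * V\<^sup>2)"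
        using \<sigma> V ln0 by (simp add: power_mult_distrib field_simps)
      then have "exp (- (\<tau>\<^sup>2 / (2 * \<sigma>\<^sup>2 * V\<^sup>2))) \<le> exp (- (real 4 * ln n))" by simp
      also have "\<dots> = 1 / real n ^ 4"
        unfolding exp_minus exp_of_nat_mult using n0 by (simp add: inverse_eq_divide)
      finally show "exp (- (\<tau>\<^sup>2 / (2 * \<sigma>\<^sup>2 * V\<^sup>2))) \<le> 1 / real n ^ 4" .
    qed
    finally show "emeasure ?N (?B x) \<le> ennreal (1 / real n ^ 4)" .
    show "?B x \<in> sets ?N" unfolding xi(1) prod.case csbm_noise_def by measurable
  qed
  have "space ?N - ?X \<subseteq> (\<Union>x\<in>?J. ?B x)"
  proof (rule subsetI, rule ccontr)
    fix g assume g: "g \<in> space ?N - ?X" and nB: "g \<notin> (\<Union>x\<in>?J. ?B x)"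
    have "separable_after n m S \<mu> \<nu> k (E, g)"
    proof (rule separable_of_small_noise[OF n0 n(2) S q \<kappa> k Lam reg \<Delta>])
      fix i assume i: "i < n"
      let ?s = "\<Sum>x\<in>?I. (c i (fst x) * w (snd x)) * g x"
      have "g \<notin> ?B (i, 1)" "g \<notin> ?B (i, -1)" using nB i by blast+
      then have "?s < \<tau>" "- ?s < \<tau>" using g by (auto simp: sum_negf)
      then have "\<bar>?s\<bar> < \<tau>" by linarith
      then show "\<bar>\<Sum>(j,l)\<in>?I. (mat_pow n (centered_adj n E) k (unit_vec i) j * ((\<mu> l - \<nu> l) / \<Delta>)) * g (j, l)\<bar> < \<Delta> / 8 * \<Lambda> ^ k"
        by (simp add: c_def w_def \<tau>_def case_prod_unfold)
    qed
    then show False using g by simp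
  qed
  then have "P.prob (space ?N - ?X) \<le> P.prob (\<Union>x\<in>?J. ?B x)"
    using tail_sets by (intro P.finite_measure_mono sets.finite_UN) auto
  also have "\<dots> \<le> (\<Sum>x\<in>?J. P.prob (?B x))"
    using tail_sets by (intro P.finite_measure_subadditive_finite) auto
  also have "\<dots> \<le> (\<Sum>x\<in>?J. 1 / real n ^ 4)"
  proof (rule sum_mono)
    fix x assume "x \<in> ?J"
    from tail[OF this] show "P.prob (?B x) \<le> 1 / real n ^ 4"
      unfolding P.emeasure_eq_measure by (simp add: ennreal_le_iff)
  qed
  also have "\<dots> = 2 / real n ^ 3" using n0 by (simp add: card_cartesian_product field_simps eval_nat_numeral)
  finally show ?thesis using P.prob_compl[OF meas] by simp
qed

section \<open>Choice of the constants and integration over the graph\<close>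

lemma sqrt_quotient_mult: "y > 0 \<Longrightarrow> sqrt (x / y) * y = sqrt (x * y)"
proof -
  assume y: "y > 0"
  have "sqrt (x / y) * y = sqrt (x / y) * sqrt (y * y)" using y by simp
  also have "\<dots> = sqrt (x * y)" unfolding real_sqrt_mult[symmetric] using y by simp
  finally show ?thesis .
qed

text \<open>With \<open>X = sqrt (ln n * (n * p))\<close> the gap gives
  \<open>\<Lambda> \<ge> 500000 * k * X\<close>; its most demanding use is
  \<open>256 * \<kappa> \<le> \<Lambda>\<close>, that is \<open>256 * 1873 \<le> 500000\<close>. The
  1873 is 1872 plus room for the diagonal \<open>- p\<close>, and \<open>3746 = 2 * 1873\<close>
  comes from \<open>\<Lambda> \<ge> \<gamma> * (n * p) / 2\<close>. Finally
  \<open>600 = 8 * 3 * (1 + 24)\<close>: the 1/8 of the noise level, \<open>sqrt 8 \<le> 3\<close>,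
  and the two terms of \<open>row_norm\<close>.\<close>

lemma csbm_separable_prob:
  fixes p q \<sigma> :: real
  assumes n: "n > 1" "even n" "ln n \<ge> 1" and S: "S \<subseteq> {..<n}" "card S = n div 2"
    and q: "0 \<le> q" and p: "p \<le> 1" "p \<ge> ln n ^ 3 / n" and \<sigma>: "\<sigma> > 0" and k: "k \<ge> 1"
    and gap: "(p - q) / (p + q) \<ge> 1000000 * real k * sqrt (ln n / (n * p))"
    and snr: "vdist m \<mu> \<nu> / \<sigma> \<ge> 600 * max (sqrt (ln n / n)) ((3746 / ((p - q) / (p + q) * sqrt (n * p))) ^ k * sqrt (ln n))"
    and tail: "\<And>\<pi>. (\<forall>e. 0 \<le> \<pi> e \<and> \<pi> e \<le> p) \<Longrightarrow>
      pmf_prob (pairs_pmf n \<pi>) {E. \<not> op_bounded n (sym_of (\<lambda>e b. of_bool b - \<pi> e) E) (1872 * sqrt (n * p))} \<le> 8 / real n ^ 3"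
  shows "measure (csbm n m S p q \<sigma>) {\<omega> \<in> space (csbm n m S p q \<sigma>). separable_after n m S \<mu> \<nu> k \<omega>} \<ge> 1 - 14 / real n ^ 3"
proof -
  define \<gamma> where "\<gamma> = (p - q) / (p + q)"
  define X where "X = sqrt (ln n * (n * p))"
  define \<kappa> where "\<kappa> = 1873 * sqrt (n * p)"
  define \<Lambda> where "\<Lambda> = n * (p - q) / 2"
  define \<Delta> where "\<Delta> = vdist m \<mu> \<nu>"
  have n0: "real n > 0" using n by simp
  have k1: "real k \<ge> 1" using k by simp
  have "1 \<le> ln n ^ 3" using n by (intro one_le_power) auto
  also have "\<dots> \<le> n * p" using p(2) n0 by (simp add: field_simps)
  finally have np: "n * p \<ge> 1" .
  then have p0: "p > 0" using n0 by (smt (verit) mult_nonneg_nonpos)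
  have np0: "n * p > 0" using np by linarith
  have sq1: "sqrt (n * p) \<ge> 1" using np by simp
  have X1: "X \<ge> sqrt (n * p)"
  proof -
    have "1 * (n * p) \<le> ln n * (n * p)" using n np0 by (intro mult_right_mono) auto
    then show ?thesis unfolding X_def by simp
  qed
  then have X0: "X > 0" using sq1 by linarith
  have \<gamma>np: "\<gamma> * (n * p) \<ge> 1000000 * k * X"
  proof -
    have "1000000 * k * sqrt (ln n / (n * p)) * (n * p) \<le> \<gamma> * (n * p)"
      using gap np0 unfolding \<gamma>_def by (intro mult_right_mono) auto
    moreover have "1000000 * k * sqrt (ln n / (n * p)) * (n * p) = 1000000 * k * X"
      using sqrt_quotient_mult[OF np0, of "ln n"] by (simp add: X_def mult.assoc)
    ultimately show ?thesis by linarith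
  qed
  have kX: "k * X > 0" using k1 X0 by (intro mult_pos_pos) auto
  have \<gamma>0: "\<gamma> > 0"
  proof -
    have "\<gamma> * (n * p) > 0" using \<gamma>np kX by linarith
    then show ?thesis using np0 by (simp add: zero_less_mult_iff)
  qed
  have \<gamma>1: "\<gamma> \<le> 1" using p0 q by (simp add: \<gamma>_def)
  have \<Lambda>\<gamma>: "\<Lambda> = \<gamma> * (n * (p + q) / 2)" using p0 q by (simp add: \<Lambda>_def \<gamma>_def)
  have \<Lambda>ge: "\<Lambda> \<ge> \<gamma> * (n * p) / 2"
  proof -
    have "\<gamma> * (n * p / 2) \<le> \<gamma> * (n * (p + q) / 2)" using \<gamma>0 q n0 by (intro mult_left_mono) auto
    then show ?thesis unfolding \<Lambda>\<gamma> by simp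
  qed
  have \<Lambda>X: "\<Lambda> \<ge> 500000 * (k * X)" using \<Lambda>ge \<gamma>np by linarith
  have \<Lambda>0: "\<Lambda> > 0" using \<Lambda>X kX by linarith
  have pq: "q \<le> p" using \<Lambda>0 n0 by (simp add: \<Lambda>_def zero_less_mult_iff)
  have k\<kappa>: "k * \<kappa> \<le> 1873 * (k * X)"
  proof -
    have "k * sqrt (n * p) \<le> k * X" using X1 k1 by (intro mult_left_mono) auto
    moreover have "k * \<kappa> = 1873 * (k * sqrt (n * p))" by (simp add: \<kappa>_def)
    ultimately show ?thesis by linarith
  qed
  have \<kappa>0: "\<kappa> > 0" using sq1 by (simp add: \<kappa>_def)
  have "1 * \<kappa> \<le> k * \<kappa>" using k1 \<kappa>0 by (intro mult_right_mono) auto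
  then have \<kappa>b: "4 * \<kappa> \<le> \<Lambda> / 64" using k\<kappa> \<Lambda>X kX by linarith
  have k\<Lambda>: "32 * real k * \<kappa> \<le> \<Lambda>" using k\<kappa> \<Lambda>X kX by linarith
  have kk: "real k \<le> real k ^ 2" using k1 by (simp add: power2_eq_square)
  \<comment> \<open>\<open>\<gamma> \<le> 1\<close> turns the gap into an upper bound on
    \<open>k\<close>: \<open>3 k X \<le> n p\<close>, and squaring gives
    \<open>9 k^2 * ln n \<le> n p\<close>.\<close>
  have klog: "6 * real k ^ 2 * ln n \<le> n * p"
  proof -
    have "1000000 * k * X \<le> n * p" using \<gamma>np \<gamma>1 np0 by (smt (verit) mult_left_le_one_le mult_le_cancel_right1)
    then have "3 * (k * X) \<le> n * p" using kX by linarith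
    then have "(3 * (k * X)) ^ 2 \<le> (n * p) ^ 2" by (rule power_mono) (use kX in linarith)
    moreover have "(3 * (k * X)) ^ 2 = (9 * real k ^ 2 * ln n) * (n * p)" using np0 n by (simp add: X_def power_mult_distrib)
    ultimately have "(9 * real k ^ 2 * ln n) * (n * p) \<le> (n * p) * (n * p)" by (simp only: power2_eq_square[of "n * p"])
    then have "9 * real k ^ 2 * ln n \<le> n * p" using np0 by (simp only: mult_le_cancel_right_pos)
    moreover have "real k ^ 2 * ln n \<ge> 0" using n by simp
    ultimately show ?thesis by linarith
  qed
  have L6: "(real k + 5) * ln n \<le> 6 * real k ^ 2 * ln n" 
  proof (rule mult_right_mono)
    show "real k + 5 \<le> 6 * real k ^ 2" using kk k1 by linarith
  qed (use n in simp)
  have L: "(real k + 5) * ln n \<le> n * p" using L6 klog by linarith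
  have kn: "k \<le> n"
  proof -
    have "real k ^ 2 * 1 \<le> real k ^ 2 * ln n" using n by (intro mult_left_mono) auto
    moreover have "n * p \<le> n" using p n0 by simp
    ultimately have "real k \<le> real n" using kk klog by linarith
    then show ?thesis by simp
  qed
  \<comment> \<open>\<open>k + 5 \<le> 6 k^2\<close> absorbs the cost of the union bound into one
    factor \<open>k\<close>: the left side is at most \<open>24 * k * X\<close>.\<close>
  have sL: "8 * sqrt ((real k + 5) * ln n * (n * p)) < \<Lambda> / 64"
  proof -
    have "(real k + 5) * ln n * (n * p) \<le> 9 * real k ^ 2 * ln n * (n * p)"
    proof (rule mult_right_mono)
      have "real k ^ 2 * ln n \<ge> 0" using n by simp
      then show "(real k + 5) * ln n \<le> 9 * real k ^ 2 * ln n" using L6 by linarith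
    qed (use np0 in simp)
    also have "\<dots> = (3 * (k * X))\<^sup>2" using np0 n by (simp add: X_def power_mult_distrib)
    finally have "sqrt ((real k + 5) * ln n * (n * p)) \<le> 3 * (k * X)"
      using kX by (intro real_le_lsqrt) auto
    then show ?thesis using \<Lambda>X kX by linarith
  qed
  let ?\<pi> = "sbm_prob S p q"
  let ?P = "pairs_pmf n ?\<pi>" and ?N = "csbm_noise n m \<sigma>"
  let ?G = "{E. regular_noise n k (class_sign S) \<kappa> (\<Lambda> / 64) (noise_mat ?\<pi> p E)}"
  have \<pi>: "0 \<le> ?\<pi> e \<and> ?\<pi> e \<le> p" for e using q pq p0 by (auto simp: sbm_prob_def)
  have G: "pmf_prob ?P ?G \<ge> 1 - 12 / real n ^ 3"
  proof (rule regular_noise_prob[OF n(1) \<pi> p(1) tail _ _ \<kappa>b _ sL L k kn])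
    show "\<forall>e. 0 \<le> ?\<pi> e \<and> ?\<pi> e \<le> p" using \<pi> by blast
    show "1872 * sqrt (n * p) + p \<le> \<kappa>" unfolding \<kappa>_def using p(1) sq1 by linarith
  qed (use np0 \<Lambda>0 in \<open>auto simp: class_sign_def\<close>)
  have snr': "\<sigma> * (\<kappa> ^ k + 24 * \<Lambda> ^ k / sqrt n) * sqrt (8 * ln n) \<le> \<Delta> / 8 * \<Lambda> ^ k" and \<Delta>0: "\<Delta> > 0"
  proof -
    let ?r = "3746 / (\<gamma> * sqrt (n * p))"
    define mx where "mx = max (sqrt (ln n / n)) (?r ^ k * sqrt (ln n))"
    have \<Delta>: "600 * mx * \<sigma> \<le> \<Delta>"
      using snr unfolding mx_def \<Delta>_def \<gamma>_def[symmetric] by (simp only: pos_le_divide_eq[OF \<sigma>])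
    have mx1: "sqrt (ln n) / sqrt n \<le> mx" unfolding mx_def by (simp add: real_sqrt_divide)
    have mx2: "?r ^ k * sqrt (ln n) \<le> mx" unfolding mx_def by simp
    have "sqrt (ln n) / sqrt n > 0" using n n0 by simp
    then have mx0: "mx > 0" using mx1 by linarith
    show "\<Delta> > 0" using \<Delta> mx0 \<sigma> by (smt (verit) mult_pos_pos)
    \<comment> \<open>The base of the power in the separation condition is an upper bound for the
      noise-to-signal ratio \<open>\<kappa> / \<Lambda>\<close>.\<close>
    have "\<kappa> \<le> ?r * \<Lambda>"
    proof -
      have "?r * (\<gamma> * (n * p) / 2) \<le> ?r * \<Lambda>" using \<Lambda>ge \<gamma>0 np0 by (intro mult_left_mono) auto
      moreover have "?r * (\<gamma> * (n * p) / 2) = \<kappa>"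
      proof -
        have "?r * (\<gamma> * (n * p) / 2) = 1873 * ((n * p) / sqrt (n * p))" using \<gamma>0 by simp
        also have "(n * p) / sqrt (n * p) = sqrt (n * p)" using np0 by (intro real_div_sqrt) simp
        finally show ?thesis by (simp add: \<kappa>_def)
      qed
      ultimately show ?thesis by simp
    qed
    then have "\<kappa> ^ k \<le> (?r * \<Lambda>) ^ k" using \<kappa>0 by (intro power_mono) auto
    then have "\<kappa> ^ k * sqrt (ln n) \<le> (?r * \<Lambda>) ^ k * sqrt (ln n)" using n by (intro mult_right_mono) auto
    also have "\<dots> = \<Lambda> ^ k * (?r ^ k * sqrt (ln n))" by (simp only: power_mult_distrib mult_ac)
    also have "\<dots> \<le> \<Lambda> ^ k * mx" using mx2 \<Lambda>0 by (intro mult_left_mono) auto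
    finally have t1: "\<kappa> ^ k * sqrt (ln n) \<le> \<Lambda> ^ k * mx" .
    have t2: "24 * \<Lambda> ^ k / sqrt n * sqrt (ln n) \<le> 24 * (\<Lambda> ^ k * mx)"
    proof -
      have "\<Lambda> ^ k * (sqrt (ln n) / sqrt n) \<le> \<Lambda> ^ k * mx" using mx1 \<Lambda>0 by (intro mult_left_mono) auto
      then show ?thesis by simp
    qed
    have s8: "sqrt (8 * ln n) \<le> 3 * sqrt (ln n)"
    proof -
      have "sqrt 8 \<le> sqrt (3 * 3)" by (intro real_sqrt_le_mono) simp
      then have "sqrt 8 \<le> 3" by simp
      then show ?thesis unfolding real_sqrt_mult using n by (intro mult_right_mono) auto
    qed
    have pos: "0 \<le> \<sigma> * (\<kappa> ^ k + 24 * \<Lambda> ^ k / sqrt n)" using \<sigma> \<kappa>0 \<Lambda>0 by simp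
    have "\<sigma> * (\<kappa> ^ k + 24 * \<Lambda> ^ k / sqrt n) * sqrt (8 * ln n) \<le> \<sigma> * (\<kappa> ^ k + 24 * \<Lambda> ^ k / sqrt n) * (3 * sqrt (ln n))"
      by (rule mult_left_mono[OF s8 pos])
    also have "\<dots> = 3 * \<sigma> * (\<kappa> ^ k * sqrt (ln n) + 24 * \<Lambda> ^ k / sqrt n * sqrt (ln n))" by (simp add: algebra_simps)
    also have "\<dots> \<le> 3 * \<sigma> * (\<Lambda> ^ k * mx + 24 * (\<Lambda> ^ k * mx))"
      using t1 t2 \<sigma> by (intro mult_left_mono add_mono) auto
    also have "\<dots> = (600 * mx * \<sigma>) / 8 * \<Lambda> ^ k" by (simp add: algebra_simps)
    also have "\<dots> \<le> \<Delta> / 8 * \<Lambda> ^ k" using \<Delta> \<Lambda>0 by (intro mult_right_mono divide_right_mono) auto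
    finally show "\<sigma> * (\<kappa> ^ k + 24 * \<Lambda> ^ k / sqrt n) * sqrt (8 * ln n) \<le> \<Delta> / 8 * \<Lambda> ^ k" .
  qed
  interpret D: prob_space "density lborel (normal_density 0 \<sigma>)" using \<sigma> by (rule prob_space_normal_density)
  interpret N: prob_space ?N unfolding csbm_noise_def by (rule prob_space_PiM) (rule D.prob_space_axioms)
  let ?C = "csbm n m S p q \<sigma>"
  let ?X = "{\<omega> \<in> space ?C. separable_after n m S \<mu> \<nu> k \<omega>}"
  have C: "?C = measure_pmf ?P \<Otimes>\<^sub>M ?N" by (simp add: csbm_def csbm_graph_eq)
  have X: "?X \<in> sets ?C" by (rule separable_event_sets[OF S(1)])
  have slice: "Pair E -` ?X = {g \<in> space ?N. separable_after n m S \<mu> \<nu> k (E, g)}" for E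
    by (auto simp: C space_pair_measure)
  have slice_sets: "Pair E -` ?X \<in> sets ?N" for E
    using sets_Pair1[OF X[unfolded C]] by (simp add: C)
  interpret C: prob_space ?C
    unfolding C by (rule prob_space_pair[OF measure_pmf.prob_space_axioms N.prob_space_axioms])
  have good: "N.prob (Pair E -` ?X) \<ge> 1 - 2 / real n ^ 3" if "E \<in> ?G" for E
    unfolding slice
  proof (rule noise_slice_prob[OF n(1,2) S q \<sigma> _ k \<Lambda>_def \<Lambda>0 k\<Lambda> _ \<Delta>_def \<Delta>0 snr'])
    show "{g \<in> space ?N. separable_after n m S \<mu> \<nu> k (E, g)} \<in> sets ?N" using slice_sets[of E] unfolding slice .
  qed (use that \<kappa>0 in auto)
  have n3: "1 - 2 / real n ^ 3 \<ge> 0"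
  proof -
    have "(2::real) ^ 3 \<le> real n ^ 3" using n by (intro power_mono) auto
    then show ?thesis using n0 by (simp add: divide_le_eq)
  qed
  \<comment> \<open>Integrating the slices over good graphs only loses \<open>12 / n^3\<close> from
    the graph and \<open>2 / n^3\<close> from the Gaussian noise.\<close>
  have "ennreal (pmf_prob ?P ?G * (1 - 2 / real n ^ 3)) = emeasure ?P ?G * ennreal (1 - 2 / real n ^ 3)"
    unfolding measure_pmf.emeasure_eq_measure using n3 by (simp add: ennreal_mult)
  also have "\<dots> = (\<integral>\<^sup>+E. ennreal (1 - 2 / real n ^ 3) * indicator ?G E \<partial>?P)"
    by (simp add: nn_integral_cmult_indicator mult.commute)
  also have "\<dots> \<le> (\<integral>\<^sup>+E. emeasure ?N (Pair E -` ?X) \<partial>?P)"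
  proof (rule nn_integral_mono)
    fix E
    show "ennreal (1 - 2 / real n ^ 3) * indicator ?G E \<le> emeasure ?N (Pair E -` ?X)"
      using good[of E] unfolding N.emeasure_eq_measure by (cases "E \<in> ?G") (auto intro: ennreal_leI)
  qed
  also have "\<dots> = emeasure ?C ?X"
    using N.emeasure_pair_measure_alt[OF X[unfolded C]] by (simp add: C)
  also have "\<dots> = ennreal (C.prob ?X)" by (rule C.emeasure_eq_measure)
  finally have "pmf_prob ?P ?G * (1 - 2 / real n ^ 3) \<le> C.prob ?X"
    by (simp add: ennreal_le_iff)
  moreover have "(1 - 12 / real n ^ 3) * (1 - 2 / real n ^ 3) \<le> pmf_prob ?P ?G * (1 - 2 / real n ^ 3)"
    using G n3 by (intro mult_right_mono) auto
  moreover have "1 - 14 / real n ^ 3 \<le> (1 - 12 / real n ^ 3) * (1 - 2 / real n ^ 3)"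
  proof -
    have "1 - (x + y) \<le> (1 - x) * (1 - y)" if "x \<ge> 0" "y \<ge> 0" for x y :: real
      using mult_nonneg_nonneg[OF that] by (simp add: algebra_simps)
    from this[of "12 / real n ^ 3" "2 / real n ^ 3"] show ?thesis by simp
  qed
  ultimately show ?thesis by linarith
qed

theorem theorem2:
  shows "\<forall>K>0. \<exists>c0>0. \<exists>C>0. \<exists>c1>0. \<exists>c>0. \<exists>n0::nat.
    \<forall>(n::nat) (m::nat) (S::nat set) (p::real) (q::real) (\<mu>::nat \<Rightarrow> real) (\<nu>::nat \<Rightarrow> real)
      (\<sigma>::real) (k::nat).
      n \<ge> n0 \<longrightarrow> even n \<longrightarrow> S \<subseteq> {..<n} \<longrightarrow> card S = n div 2 \<longrightarrow>
      0 \<le> q \<longrightarrow> q \<le> 1 \<longrightarrow> 0 \<le> p \<longrightarrow> p \<le> 1 \<longrightarrow> \<sigma> > 0 \<longrightarrow>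
      1 \<le> k \<longrightarrow> real k \<le> K * ln (real n) \<longrightarrow>
      p \<ge> (ln (real n)) ^ 3 / real n \<longrightarrow>
      (p - q) / (p + q) \<ge> c0 * real k * sqrt (ln (real n) / (real n * p)) \<longrightarrow>
      vdist m \<mu> \<nu> / \<sigma> \<ge> c1 * max (sqrt (ln (real n) / real n))
          ((C / ((p - q) / (p + q) * sqrt (real n * p))) ^ k * sqrt (ln (real n))) \<longrightarrow>
      measure (csbm n m S p q \<sigma>)
        {\<omega> \<in> space (csbm n m S p q \<sigma>). separable_after n m S \<mu> \<nu> k \<omega>}
        \<ge> 1 - real n powr (- c)"
proof -
  obtain n1 where n1: "\<And>n p \<pi>. n \<ge> n1 \<Longrightarrow> ln (real n) ^ 3 / n \<le> p \<Longrightarrow> p \<le> 1 \<Longrightarrow> (\<forall>e. 0 \<le> \<pi> e \<and> \<pi> e \<le> p) \<Longrightarrow>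
    pmf_prob (pairs_pmf n \<pi>) {E. \<not> op_bounded n (sym_of (\<lambda>e b. of_bool b - \<pi> e) E) (1872 * sqrt (n * p))} \<le> 8 / real n ^ 3"
    using noise_norm_tail by blast
  have main: "measure (csbm n m S p q \<sigma>) {\<omega> \<in> space (csbm n m S p q \<sigma>). separable_after n m S \<mu> \<nu> k \<omega>} \<ge> 1 - real n powr (- 1)"
    if a: "n \<ge> max n1 4" "even n" "S \<subseteq> {..<n}" "card S = n div 2" "0 \<le> q" "p \<le> 1" "\<sigma> > 0" "1 \<le> k"
      "p \<ge> (ln (real n)) ^ 3 / real n" "(p - q) / (p + q) \<ge> 1000000 * real k * sqrt (ln (real n) / (real n * p))"
      "vdist m \<mu> \<nu> / \<sigma> \<ge> 600 * max (sqrt (ln (real n) / real n))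
          ((3746 / ((p - q) / (p + q) * sqrt (real n * p))) ^ k * sqrt (ln (real n)))"
    for n m S p q \<mu> \<nu> \<sigma> k
  proof -
    have n4: "real n \<ge> 4" "n \<ge> n1" using a(1) by auto
    have "exp 1 \<le> real n" using exp_le n4 by linarith
    then have ln1: "ln n \<ge> 1" using n4 by (subst ln_ge_iff) auto
    have "1 - 14 / real n ^ 3 \<le> measure (csbm n m S p q \<sigma>) {\<omega> \<in> space (csbm n m S p q \<sigma>). separable_after n m S \<mu> \<nu> k \<omega>}"
      by (rule csbm_separable_prob[OF _ a(2) ln1 a(3,4,5,6,9,7,8,10,11) n1[OF n4(2) a(9,6)]]) (use n4 in auto)
    \<comment> \<open>\<open>n \<ge> 4\<close> gives \<open>n^2 \<ge> 14\<close>, so the exponent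
      can be taken as 1.\<close>
    moreover have "14 / real n ^ 3 \<le> real n powr (- 1)"
    proof -
      have "14 \<le> real n * real n" using mult_mono[of 4 "real n" 4 "real n"] n4 by simp
      then have "14 / real n ^ 3 \<le> (real n * real n) / real n ^ 3" by (intro divide_right_mono) auto
      also have "\<dots> = real n powr (- 1)" using n4 by (simp add: powr_minus powr_one field_simps eval_nat_numeral)
      finally show ?thesis .
    qed
    ultimately show ?thesis by linarith
  qed
  show ?thesis
    by (rule allI, rule impI, rule exI[of _ "1000000"], rule conjI, simp, rule exI[of _ "3746"], rule conjI, simp,
        rule exI[of _ "600"], rule conjI, simp, rule exI[of _ "1"], rule conjI, simp, rule exI[of _ "max n1 4"],
        (rule allI | rule impI)+, rule main, assumption+)
qed

end
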